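(* Let $A\subseteq\mathbb R^2$ be a nonempty bounded set, $v\in S^1$ and $\alpha:A\to\mathbb R$. For $t\in\mathbb R$ let $L_t=\mathrm{conv}_c(\{x+t\alpha(x)v: x\in A\})$. Then $F(t)=\mathrm{Vol}(L_t)\in[0,\infty]$ is a convex function of $t\in\mathbb R$.
   Context: For $x\in\mathbb R^2$, $B(x,1)$ is the closed Euclidean unit disk centered at $x$. For $A\subseteq\mathbb R^2$, $A^c=\bigcap_{x\in A}B(x,1)$ (with $\emptyset^c=\mathbb R^2$) and $\mathrm{conv}_c(A)=A^{cc}$; if $A$ is contained in no closed unit disk, $\mathrm{conv}_c(A)=\mathbb R^2$ and has infinite area. *)

theory Defs
  imports "HOL-Analysis.Analysis"
begin

definition spindle_dual :: "(real^2) set \<Rightarrow> (real^2) set" where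
  "spindle_dual A = (\<Inter>x\<in>A. cball x 1)"

definition spindle_hull :: "(real^2) set \<Rightarrow> (real^2) set" where
  "spindle_hull A = spindle_dual (spindle_dual A)"

end

theory Submission
  imports Defs
begin

text \<open>Take coordinates in which \<open>v\<close> is vertical. Let \<open>M0\<close>, \<open>M1\<close> be the hulls at times \<open>s\<close>, \<open>t\<close>, let
  \<open>E\<close> be their fibrewise average with weights \<open>1 - u\<close>, \<open>u\<close>, and let \<open>L\<close> be the hull of \<open>E\<close>, which
  contains the hull at the intermediate time; it suffices to compare the area of \<open>L\<close> with the
  average of the areas. Where the upper boundary of \<open>L\<close> is an arc between two contact points with
  \<open>E\<close> on the same half of a unit circle, it lies below the average of the upper boundaries of \<open>M0\<close>
  and \<open>M1\<close>, because curvature at least one is preserved when graphs are averaged; similarly for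
  the lower boundary. This can fail only near the two horizontal ends of \<open>L\<close>, where the boundary is
  an arc turning around the extreme point of its circle. There \<open>L\<close> is a circular segment over a
  chord between two points of \<open>E\<close>, and the corresponding chords in \<open>M0\<close>, \<open>M1\<close> also carry circular
  segments; the area of such a segment is a convex function of the squared chord length, and its
  derivative compensates for the polygonal part under the chord.\<close>

section \<open>Orthonormal frames and Lebesgue measure\<close>

text \<open>Supporting disks and contact points have one source: if a dual point cannot be moved in
  some direction, a contact on its unit circle blocks it. At the ends \<open>L\<close> can project
  beyond \<open>E\<close>, where no fibrewise inequality is available. Hence \<open>L\<close>,
  \<open>M0\<close> and \<open>M1\<close> are cut at the same four abscissas, those of the end
  chords of \<open>L\<close>; what lies between the chords then has an area linear in the boundary
  functions. The balance at a chord: keep its horizontal offset \<open>d\<close>, let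
  \<open>\<delta>\<close> be its vertical extent and \<open>s\<close> its half length. The extents
  over the same abscissas in \<open>M0\<close> and \<open>M1\<close> average to
  \<open>\<delta> + a + b\<close>, with gaps \<open>a, b >= 0\<close> at the two ends. With
  \<open>K = s / sqrt (1 - s^2)\<close>, convexity in the squared length gains at least
  \<open>K \<delta> (a + b) / 2\<close>, while the trapezoid term loses at most
  \<open>|d| (a + b) / 2\<close>. The inequality \<open>|d| <= K \<delta>\<close> says that the
  centre of the end arc has height between the two chord ends, which is why these are chosen on
  opposite halves of the circle. Finiteness of \<open>K\<close> requires chords shorter than two; a
  centre whose open unit disk contains \<open>L\<close> ensures this.\<close>

lemma orthonormal_frame_expand:
  fixes e f :: "real^2"
  assumes "norm e = 1" "norm f = 1" "e \<bullet> f = 0"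
  shows "x = (x \<bullet> e) *\<^sub>R e + (x \<bullet> f) *\<^sub>R f"
proof -
  have *: "e$1 * e$1 + e$2 * e$2 = 1" "f$1 * f$1 + f$2 * f$2 = 1" "e$1 * f$1 + e$2 * f$2 = 0"
    using assms by (auto simp: norm_eq_1 inner_vec_def sum_2)
  \<comment> \<open>The determinant is plus or minus one, which turns orthonormal rows into
    orthonormal columns.\<close>
  have d: "(e$1 * f$2 - e$2 * f$1)\<^sup>2 = 1"
    using * by algebra
  have "e$1 * e$1 + f$1 * f$1 = 1" "e$2 * e$2 + f$2 * f$2 = 1" "e$1 * e$2 + f$1 * f$2 = 0"
    using * d by algebra+
  then have "x$1 = (x$1 * e$1 + x$2 * e$2) * e$1 + (x$1 * f$1 + x$2 * f$2) * f$1"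
    "x$2 = (x$1 * e$1 + x$2 * e$2) * e$2 + (x$1 * f$1 + x$2 * f$2) * f$2"
    by algebra+
  then show ?thesis
    by (simp add: vec_eq_iff forall_2 inner_vec_def sum_2)
qed

lemma continuous_on_vector2:
  "continuous_on UNIV (\<lambda>p::real \<times> real. vector [fst p, snd p] :: real^2)"
proof -
  have "(vector [fst p, snd p] :: real^2) = fst p *\<^sub>R axis 1 1 + snd p *\<^sub>R axis 2 1"
    for p :: "real \<times> real"
    by (simp add: vec_eq_iff forall_2 axis_def)
  then show ?thesis by (simp add: continuous_intros)
qed

text \<open>The theorem lives in \<open>real^2\<close>, whereas iterated integrals are taken over
  pairs; this transfers the measure, which is determined by boxes.\<close>

lemma lborel_real2_eq_distr:
  "lborel = distr lborel borel (\<lambda>p::real \<times> real. vector [fst p, snd p] :: real^2)"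
proof (rule lborel_eqI)
  let ?f = "\<lambda>p::real \<times> real. vector [fst p, snd p] :: real^2"
  have m: "?f \<in> borel_measurable lborel"
    by (simp add: borel_measurable_continuous_onI continuous_on_vector2)
  fix l u :: "real^2" assume lu: "\<And>b. b \<in> Basis \<Longrightarrow> l \<bullet> b \<le> u \<bullet> b"
  have lu': "l$1 \<le> u$1" "l$2 \<le> u$2" using lu[of "axis 1 1"] lu[of "axis 2 1"]
    by (auto simp: inner_axis axis_in_Basis_iff)
  have "?f -` box l u = box (l$1, l$2) (u$1, u$2)"
    by (auto simp: box_def Basis_vec_def Basis_prod_def inner_axis forall_2 ball_Un)
  then have "emeasure (distr lborel borel ?f) (box l u) = emeasure lborel (box (l$1, l$2) (u$1, u$2))"
    using m by (subst emeasure_distr) auto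
  also have "\<dots> = ennreal (u$1 - l$1) * ennreal (u$2 - l$2)"
    using lu'
    by (subst emeasure_lborel_box)
       (auto simp: Basis_prod_def simp flip: ennreal_mult'')
  also have "\<dots> = ennreal (\<Prod>b\<in>Basis. (u - l) \<bullet> b)"
  proof -
    have B: "(Basis::(real^2) set) = {axis 1 1, axis 2 1}"
      by (auto simp: Basis_vec_def) (metis exhaust_2)
    have "(\<Prod>b\<in>{axis 1 1, axis 2 1}. (u - l) \<bullet> b) = (u$1 - l$1) * (u$2 - l$2)"
      by (subst prod.insert) (auto simp: inner_axis axis_eq_axis)
    then have "(\<Prod>b\<in>Basis. (u - l) \<bullet> b) = (u$1 - l$1) * (u$2 - l$2)"
      unfolding B .
    then show ?thesis using lu' by (simp add: ennreal_mult'')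
  qed
  finally show "emeasure (distr lborel borel ?f) (box l u) = ennreal (\<Prod>b\<in>Basis. (u - l) \<bullet> b)"
    by simp
qed simp

text \<open>Boundedness makes the measures finite, so that invariance of \<open>measure\<close>
  under orthogonal maps lifts to \<open>emeasure\<close>.\<close>

lemma emeasure_orthonormal_image:
  fixes e f :: "real^2" and S :: "(real \<times> real) set"
  assumes ef: "norm e = 1" "norm f = 1" "e \<bullet> f = 0" and S: "S \<in> sets borel" "bounded S"
  shows "emeasure lborel ((\<lambda>p. a + fst p *\<^sub>R e + snd p *\<^sub>R f) ` S) = emeasure lborel S"
    (is "emeasure _ (?g ` S) = _")
proof -
  let ?f = "\<lambda>p::real \<times> real. vector [fst p, snd p] :: real^2"
  let ?T = "\<lambda>x::real^2. x$1 *\<^sub>R e + x$2 *\<^sub>R f"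
  let ?h = "\<lambda>x::real^2. (x$1, x$2)"
  have hm: "?h \<in> borel_measurable borel"
    by (intro borel_measurable_continuous_onI continuous_intros)
  have fS: "?f ` S = ?h -` S"
    by (force simp: vec_eq_iff forall_2 image_iff)
  have fSb: "?f ` S \<in> sets borel"
    unfolding fS using measurable_sets[OF hm S(1)] by simp
  have fb: "bounded (?f ` S)"
  proof -
    obtain B where B: "\<And>p. p \<in> S \<Longrightarrow> norm p \<le> B" using S(2) by (auto simp: bounded_iff)
    have "norm (?f p) = norm p" for p
      by (simp add: norm_vec_def L2_set_def sum_2 norm_prod_def)
    then show ?thesis using B by (intro boundedI[of _ B]) auto
  qed
  have "emeasure lborel (?f ` S) = emeasure (distr lborel borel ?f) (?f ` S)"
    by (simp flip: lborel_real2_eq_distr)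
  also have "\<dots> = emeasure lborel (?f -` (?f ` S))"
  proof (subst emeasure_distr)
    show "?f \<in> borel_measurable lborel"
      by (simp add: borel_measurable_continuous_onI continuous_on_vector2)
  qed (use fSb in auto)
  also have "?f -` (?f ` S) = S"
    unfolding fS by auto
  finally have 1: "emeasure lborel (?f ` S) = emeasure lborel S" .
  have orth: "orthogonal_transformation ?T"
  proof (unfold orthogonal_transformation, intro conjI allI)
    show "linear ?T" by (intro linearI) (auto simp: algebra_simps)
    fix x :: "real^2"
    have ee: "e \<bullet> e = 1" "f \<bullet> f = 1" "f \<bullet> e = 0" using ef by (auto simp: norm_eq_1 inner_commute)
    have "?T x \<bullet> ?T x = x \<bullet> x"
      using ee ef(3)
      by (simp add: inner_add_left inner_add_right) (simp add: inner_vec_def sum_2)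
    then show "norm (?T x) = norm x" by (simp add: norm_eq_sqrt_inner)
  qed
  have lm: "?f ` S \<in> lmeasurable"
    using fSb fb by (intro bounded_set_imp_lmeasurable) auto
  have img: "?g ` S = (+) a ` ?T ` (?f ` S)"
    by (auto simp: image_image add.assoc)
  have "measure lebesgue (?g ` S) = measure lebesgue (?f ` S)"
    unfolding img measure_translation using measure_orthogonal_image[OF orth lm] by simp
  moreover have "?g ` S \<in> lmeasurable"
    unfolding img using measurable_orthogonal_image[OF orth lm] measurable_translation by blast
  ultimately have 2: "emeasure lebesgue (?g ` S) = emeasure lebesgue (?f ` S)"
    using lm by (simp add: emeasure_eq_measure2)
  have "?g ` S \<in> sets borel"
  proof -
    let ?k = "\<lambda>x. ((x - a) \<bullet> e, (x - a) \<bullet> f)"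
    have "?k \<in> borel_measurable borel"
      by (intro borel_measurable_continuous_onI continuous_intros)
    moreover have "?g ` S = ?k -` S"
    proof (intro set_eqI iffI)
      fix x assume "x \<in> ?g ` S"
      then obtain p where p: "p \<in> S" "x = ?g p" by blast
      have "x - a = fst p *\<^sub>R e + snd p *\<^sub>R f" using p(2) by simp
      then have "?k x = p"
        using ef by (simp add: inner_add_left inner_commute[of f e] norm_eq_1)
      then show "x \<in> ?k -` S" using p by simp
    next
      fix x assume x: "x \<in> ?k -` S"
      have "x - a = ((x - a) \<bullet> e) *\<^sub>R e + ((x - a) \<bullet> f) *\<^sub>R f"
        by (rule orthonormal_frame_expand[OF ef])
      then have "x = a + (((x - a) \<bullet> e) *\<^sub>R e + ((x - a) \<bullet> f) *\<^sub>R f)"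
        by (metis add.commute diff_add_cancel)
      then have "x = ?g (?k x)" by (simp add: add.assoc)
      then show "x \<in> ?g ` S" using x by blast
    qed
    ultimately show ?thesis using measurable_sets[of ?k borel borel S] S(1) by simp
  qed
  then show ?thesis using 1 2 fSb by simp
qed

text \<open>The rotated set placed by the standard frame of \<open>real^2\<close> is the original
  set placed by a rotated frame, and both placements preserve area.\<close>

lemma emeasure_planar_isometry_image:
  fixes S :: "(real \<times> real) set"
  assumes "a\<^sup>2 + b\<^sup>2 = 1" "S \<in> sets borel" "bounded S"
  shows "emeasure lborel ((\<lambda>p. (m + fst p * a - snd p * b, n + fst p * b + snd p * a)) ` S)
       = emeasure lborel S" (is "emeasure _ (?r ` S) = _")
proof -
  let ?e = "vector [a, b] :: real^2" and ?f = "vector [- b, a] :: real^2"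
  let ?g = "vector [1, 0] :: real^2" and ?h = "vector [0, 1] :: real^2"
  have ef: "norm ?e = 1" "norm ?f = 1" "?e \<bullet> ?f = 0" "norm ?g = 1" "norm ?h = 1" "?g \<bullet> ?h = 0"
    using assms(1) by (auto simp: norm_eq_1 inner_vec_def sum_2 power2_eq_square)
  let ?inv = "\<lambda>q. ((fst q - m) * a + (snd q - n) * b, (snd q - n) * a - (fst q - m) * b)"
  define r where "r = ?r"
  define r' where "r' = ?inv"
  have inv: "r' (r p) = p" "r (r' q) = q" for p q
  proof -
    have "a * a + b * b = 1" using assms(1) by (simp add: power2_eq_square)
    then have e: "(x * a - y * b) * a + (x * b + y * a) * b = x"
      "(x * b + y * a) * a - (x * a - y * b) * b = y"
      "(x * a + y * b) * a - (y * a - x * b) * b = x"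
      "(x * a + y * b) * b + (y * a - x * b) * a = y" for x y
      by algebra+
    show "r' (r p) = p" unfolding r_def r'_def using e(1,2)[of "fst p" "snd p"] by (simp add: prod_eq_iff)
    show "r (r' q) = q" unfolding r_def r'_def using e(3,4)[of "fst q - m" "snd q - n"]
      by (simp add: prod_eq_iff)
  qed
  have rS: "r ` S = r' -` S"
  proof (intro set_eqI iffI)
    fix q assume "q \<in> r ` S"
    then show "q \<in> r' -` S" by (auto simp: inv)
  next
    fix q assume "q \<in> r' -` S"
    then show "q \<in> r ` S" using inv(2)[of q] by (metis image_eqI vimage_eq)
  qed
  have "r' \<in> borel_measurable borel"
    unfolding r'_def by (intro borel_measurable_continuous_onI continuous_intros)
  then have b: "r ` S \<in> sets borel"
    unfolding rS using measurable_sets[of r' borel borel S] assms(2) by simp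
  have c: "continuous_on UNIV r" unfolding r_def by (intro continuous_intros)
  have bd: "bounded (r ` S)"
  proof -
    have "compact (r ` closure S)"
      using assms(3) c by (intro compact_continuous_image) (auto intro: continuous_on_subset)
    then show ?thesis
      by (meson bounded_subset compact_imp_bounded closure_subset image_mono)
  qed
  have "emeasure lborel (?r ` S) = emeasure lborel ((\<lambda>p. 0 + fst p *\<^sub>R ?g + snd p *\<^sub>R ?h) ` ?r ` S)"
    by (rule emeasure_orthonormal_image[of ?g ?h "?r ` S" 0, symmetric])
      (use ef b[unfolded r_def] bd[unfolded r_def] in auto)
  also have "(\<lambda>p. 0 + fst p *\<^sub>R ?g + snd p *\<^sub>R ?h) ` ?r ` S
     = (\<lambda>p. vector [m, n] + fst p *\<^sub>R ?e + snd p *\<^sub>R ?f) ` S"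
    unfolding image_image by (intro image_cong refl) (simp add: vec_eq_iff forall_2)
  also have "emeasure lborel \<dots> = emeasure lborel S"
    by (rule emeasure_orthonormal_image) (use ef assms in auto)
  finally show ?thesis .
qed

section \<open>Duality with respect to unit disks\<close>

definition sqdist :: "real \<times> real \<Rightarrow> real \<times> real \<Rightarrow> real" where
  "sqdist p q = (fst p - fst q)\<^sup>2 + (snd p - snd q)\<^sup>2"

text \<open>The counterpart of \<open>spindle_dual\<close> in coordinates with \<open>v\<close> vertical, where fibres parallel to \<open>v\<close>
  and Fubini's theorem are directly available.\<close>
definition bdual :: "(real \<times> real) set \<Rightarrow> (real \<times> real) set" where
  "bdual A = {c. \<forall>p\<in>A. sqdist p c \<le> 1}"

lemma sqdist_commute: "sqdist p q = sqdist q p"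
  by (simp add: sqdist_def power2_commute)

lemma dist_le_1_iff_sqdist: "dist p q \<le> 1 \<longleftrightarrow> sqdist p q \<le> 1"
  by (simp add: dist_prod_def sqdist_def dist_real_def)

lemma bdual_eq_cball: "bdual A = (\<Inter>p\<in>A. cball p 1)"
  by (auto simp: bdual_def dist_le_1_iff_sqdist)

lemma closed_bdual: "closed (bdual A)"
  unfolding bdual_eq_cball by (intro closed_INT ballI closed_cball)

lemma convex_bdual: "convex (bdual A)"
  unfolding bdual_eq_cball by (intro convex_INT convex_cball)

lemma compact_bdual: "A \<noteq> {} \<Longrightarrow> compact (bdual A)"
  unfolding compact_eq_bounded_closed
  by (auto simp: closed_bdual bdual_eq_cball intro: bounded_subset[OF bounded_cball])

lemma bdual_antimono: "A \<subseteq> B \<Longrightarrow> bdual B \<subseteq> bdual A"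
  by (auto simp: bdual_def)

lemma subset_bdual_bdual: "A \<subseteq> bdual (bdual A)"
  by (auto simp: bdual_def sqdist_commute)

lemma bdual_bdual_bdual: "bdual (bdual (bdual A)) = bdual A"
  using subset_bdual_bdual bdual_antimono by (metis subset_antisym)

lemma bdualD: "c \<in> bdual A \<Longrightarrow> p \<in> A \<Longrightarrow> sqdist p c \<le> 1"
  by (simp add: bdual_def)

text \<open>Applied to the dual of \<open>C\<close> in place of \<open>C\<close>, this yields unit disks supporting the hull.\<close>
lemma bdual_blocking_point:
  assumes C: "compact C" and c: "c \<in> bdual C"
    and out: "\<And>\<epsilon>. \<epsilon> > 0 \<Longrightarrow> (fst c + \<epsilon> * d1, snd c + \<epsilon> * d2) \<notin> bdual C"
  obtains u where "u \<in> C" "sqdist u c = 1"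
    "(fst u - fst c) * d1 + (snd u - snd c) * d2 \<le> 0"
proof -
  define e where "e n = inverse (real (Suc n))" for n
  have e: "e n > 0" "e \<longlonglongrightarrow> 0" for n
    unfolding e_def using LIMSEQ_inverse_real_of_nat by auto
  have "\<exists>u\<in>C. sqdist u (fst c + e n * d1, snd c + e n * d2) > 1" for n
    using out[OF e(1)[of n]] by (auto simp: bdual_def not_le)
  then obtain u where u: "\<And>n. u n \<in> C"
    "\<And>n. sqdist (u n) (fst c + e n * d1, snd c + e n * d2) > 1"
    by metis
  obtain l r where lr: "l \<in> C" "strict_mono r" "(u \<circ> r) \<longlonglongrightarrow> l"
    using C u(1) unfolding compact_def by metis
  have er: "(\<lambda>n. e (r n)) \<longlonglongrightarrow> 0"
    using LIMSEQ_subseq_LIMSEQ[OF e(2) lr(2)] by (simp add: o_def)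
  have ul: "(\<lambda>n. u (r n)) \<longlonglongrightarrow> l" using lr(3) by (simp add: o_def)
  have lim1: "(\<lambda>n. sqdist (u (r n)) (fst c + e (r n) * d1, snd c + e (r n) * d2)) \<longlonglongrightarrow>
      sqdist l (fst c + 0 * d1, snd c + 0 * d2)"
    unfolding sqdist_def fst_conv snd_conv by (intro tendsto_intros er ul)
  have "sqdist l (fst c + 0 * d1, snd c + 0 * d2) \<ge> 1"
    by (rule LIMSEQ_le_const[OF lim1]) (use u(2) less_imp_le in blast)
  then have l1: "sqdist l c = 1"
    using bdualD[OF c lr(1)] by (auto simp: sqdist_def)
  \<comment> \<open>\<open>u n\<close> is within one of \<open>c\<close> but not of the shifted
    centre, so its component along the shift is at most of order \<open>e n\<close>; in the limit it
    is nonpositive.\<close>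
  have key: "(fst (u n) - fst c) * d1 + (snd (u n) - snd c) * d2 \<le> e n * (d1\<^sup>2 + d2\<^sup>2)" for n
  proof -
    have "sqdist (u n) (fst c + e n * d1, snd c + e n * d2) = sqdist (u n) c
      + e n * (e n * (d1\<^sup>2 + d2\<^sup>2) - 2 * ((fst (u n) - fst c) * d1 + (snd (u n) - snd c) * d2))"
      unfolding sqdist_def by (simp add: power2_eq_square algebra_simps)
    then have "0 < e n * (e n * (d1\<^sup>2 + d2\<^sup>2) - 2 * ((fst (u n) - fst c) * d1 + (snd (u n) - snd c) * d2))"
      using u(2)[of n] bdualD[OF c u(1)[of n]] by linarith
    then have "2 * ((fst (u n) - fst c) * d1 + (snd (u n) - snd c) * d2) < e n * (d1\<^sup>2 + d2\<^sup>2)"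
      using e(1)[of n] by (simp add: zero_less_mult_iff)
    moreover have "0 \<le> e n * (d1\<^sup>2 + d2\<^sup>2)" using e(1)[of n] by simp
    ultimately show ?thesis by argo
  qed
  have "(\<lambda>n. (fst (u (r n)) - fst c) * d1 + (snd (u (r n)) - snd c) * d2) \<longlonglongrightarrow>
    (fst l - fst c) * d1 + (snd l - snd c) * d2"
    by (intro tendsto_intros ul)
  moreover have "(\<lambda>n. e (r n) * (d1\<^sup>2 + d2\<^sup>2)) \<longlonglongrightarrow> 0 * (d1\<^sup>2 + d2\<^sup>2)"
    by (intro tendsto_intros er)
  ultimately have "(fst l - fst c) * d1 + (snd l - snd c) * d2 \<le> 0 * (d1\<^sup>2 + d2\<^sup>2)"
    by (rule LIMSEQ_le) (use key in blast)
  then show ?thesis using that lr(1) l1 by simp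
qed

text \<open>For a point at distance one from \<open>c\<close>, lying within one of \<open>k\<close>
  means that its inner product with the vector from \<open>c\<close> to \<open>k\<close>, doubled,
  is at least the squared length of that vector. This passes to nonnegative combinations of total
  weight at least one, in particular to the minor arc from \<open>P\<close> to
  \<open>u\<close>.\<close>

lemma bdual_arc:
  assumes K: "K \<subseteq> bdual {P, u}" and "sqdist P c = 1" "sqdist u c = 1" "sqdist Z c \<le> 1"
    and ab: "a \<ge> 0" "b \<ge> 0" "a + b \<ge> 1"
    and Z: "fst Z - fst c = a * (fst P - fst c) + b * (fst u - fst c)"
      "snd Z - snd c = a * (snd P - snd c) + b * (snd u - snd c)"
  shows "Z \<in> bdual K"
  unfolding bdual_def
proof (intro CollectI ballI)
  fix k assume "k \<in> K"
  then have k: "sqdist P k \<le> 1" "sqdist u k \<le> 1" using K by (auto simp: bdual_def)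
  define x y where "x = fst k - fst c" and "y = snd k - snd c"
  have e: "sqdist q k = sqdist q c - 2 * ((fst q - fst c) * x + (snd q - snd c) * y) + (x\<^sup>2 + y\<^sup>2)" for q
    unfolding sqdist_def x_def y_def by (simp add: power2_eq_square algebra_simps)
  have "2 * ((fst P - fst c) * x + (snd P - snd c) * y) \<ge> x\<^sup>2 + y\<^sup>2"
    "2 * ((fst u - fst c) * x + (snd u - snd c) * y) \<ge> x\<^sup>2 + y\<^sup>2"
    using k assms(2,3) e[of P] e[of u] by linarith+
  then have "a * (2 * ((fst P - fst c) * x + (snd P - snd c) * y)) \<ge> a * (x\<^sup>2 + y\<^sup>2)"
    "b * (2 * ((fst u - fst c) * x + (snd u - snd c) * y)) \<ge> b * (x\<^sup>2 + y\<^sup>2)"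
    using ab by (auto intro: mult_left_mono)
  then have "2 * ((fst Z - fst c) * x + (snd Z - snd c) * y) \<ge> (a + b) * (x\<^sup>2 + y\<^sup>2)"
    unfolding Z by (simp add: algebra_simps)
  moreover have "(a + b) * (x\<^sup>2 + y\<^sup>2) \<ge> 1 * (x\<^sup>2 + y\<^sup>2)"
    using ab(3) by (intro mult_right_mono) auto
  ultimately have "sqdist Z k \<le> 1" using e[of Z] assms(4) by argo
  then show "sqdist k Z \<le> 1" by (simp add: sqdist_commute)
qed

text \<open>The midpoint of two dual points works, by the parallelogram law. A hull inside an open
  unit disk contains no two points at distance two.\<close>

lemma bdual_strict_center:
  assumes "k1 \<in> K" "k2 \<in> K" "k1 \<noteq> k2"
  obtains c0 where "\<And>p. p \<in> bdual K \<Longrightarrow> sqdist p c0 < 1"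
proof
  fix p assume "p \<in> bdual K"
  then have "sqdist p k1 \<le> 1" "sqdist p k2 \<le> 1"
    using assms by (auto simp: bdual_def sqdist_commute)
  moreover have "(fst k1 - fst k2)\<^sup>2 + (snd k1 - snd k2)\<^sup>2 > 0"
    using assms(3) by (auto simp: prod_eq_iff sum_power2_gt_zero_iff)
  moreover have "sqdist p ((fst k1 + fst k2) / 2, (snd k1 + snd k2) / 2)
    = (sqdist p k1 + sqdist p k2) / 2 - ((fst k1 - fst k2)\<^sup>2 + (snd k1 - snd k2)\<^sup>2) / 4"
    unfolding sqdist_def by (simp add: power2_eq_square field_simps)
  ultimately show "sqdist p ((fst k1 + fst k2) / 2, (snd k1 + snd k2) / 2) < 1"
    by argo
qed

text \<open>Walking along the supporting circle from \<open>P\<close> towards the side \<open>\<sigma>\<close>, one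
  meets a contact point before the horizontal extreme of the circle, or that extreme itself
  belongs to the hull.\<close>
lemma contact_or_extreme:
  assumes C: "compact C" and K: "K = bdual C"
    and c0: "\<And>p. p \<in> bdual K \<Longrightarrow> sqdist p c0 < 1"
    and P: "P \<in> bdual K" and c: "c \<in> K" "sqdist P c = 1"
    and s: "\<sigma> = 1 \<or> \<sigma> = - 1" "\<tau> = 1 \<or> \<tau> = - 1" and up: "\<tau> * snd c \<le> \<tau> * snd P"
  obtains u where "u \<in> C" "sqdist u c = 1" "\<tau> * snd c \<le> \<tau> * snd u" "\<sigma> * fst u \<le> \<sigma> * fst P"
    | "(fst c - \<sigma>, snd c) \<in> bdual K"
proof -
  \<comment> \<open>In these coordinates \<open>c\<close> is the origin, \<open>P\<close> lies on
    the upper half of the circle and the extreme in question is \<open>(-1, 0)\<close>.\<close>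
  define p1 p2 where "p1 = \<sigma> * (fst P - fst c)" and "p2 = \<tau> * (snd P - snd c)"
  have ss: "\<sigma> * \<sigma> = 1" "\<tau> * \<tau> = 1" using s by auto
  have ss2: "\<sigma>\<^sup>2 = 1" "\<tau>\<^sup>2 = 1" using s by auto
  have P1: "p1\<^sup>2 + p2\<^sup>2 = 1" using c(2) ss2 unfolding p1_def p2_def sqdist_def
    by (simp add: power_mult_distrib)
  have p2: "p2 \<ge> 0" using up unfolding p2_def by (simp add: algebra_simps)
  \<comment> \<open>A tangent direction at \<open>P\<close>: moving the centre along it leaves the
    unit disk about \<open>P\<close> at once. The blocking contact then lies counterclockwise from
    \<open>P\<close>, by at most half a turn.\<close>
  define d1 d2 where "d1 = \<sigma> * p2" and "d2 = - \<tau> * p1"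
  obtain u where u: "u \<in> C" "sqdist u c = 1"
    "(fst u - fst c) * d1 + (snd u - snd c) * d2 \<le> 0"
  proof (rule bdual_blocking_point[OF C])
    show "c \<in> bdual C" using c K by simp
    fix \<epsilon> :: real assume e: "\<epsilon> > 0"
    have "sqdist P (fst c + \<epsilon> * d1, snd c + \<epsilon> * d2)
      = sqdist P c + \<epsilon>\<^sup>2 * (d1\<^sup>2 + d2\<^sup>2) - 2 * \<epsilon> * ((fst P - fst c) * d1 + (snd P - snd c) * d2)"
      unfolding sqdist_def by (simp add: power2_eq_square algebra_simps)
    also have "(fst P - fst c) * d1 + (snd P - snd c) * d2 = 0"
      unfolding d1_def d2_def p1_def p2_def by (simp add: algebra_simps)
    also have "d1\<^sup>2 + d2\<^sup>2 = 1" using P1 ss2 unfolding d1_def d2_def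
      by (simp add: power_mult_distrib)
    finally have "sqdist P (fst c + \<epsilon> * d1, snd c + \<epsilon> * d2) > 1" using e c(2) by simp
    then show "(fst c + \<epsilon> * d1, snd c + \<epsilon> * d2) \<notin> bdual C"
      using P K bdualD by (metis sqdist_commute not_le)
  qed auto
  define u1 u2 where "u1 = \<sigma> * (fst u - fst c)" and "u2 = \<tau> * (snd u - snd c)"
  have U1: "u1\<^sup>2 + u2\<^sup>2 = 1" using u(2) ss2 unfolding u1_def u2_def sqdist_def
    by (simp add: power_mult_distrib)
  have cr: "p1 * u2 - p2 * u1 \<ge> 0"
    using u(3) unfolding d1_def d2_def u1_def u2_def by (simp add: algebra_simps)
  have uK: "u \<in> bdual K" using u(1) K subset_bdual_bdual by blast
  \<comment> \<open>The vector to the strict centre has positive inner product with every point of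
    the hull on this circle, so \<open>u\<close> is not antipodal to \<open>P\<close>.\<close>
  define w1 w2 where "w1 = \<sigma> * (fst c0 - fst c)" and "w2 = \<tau> * (snd c0 - snd c)"
  have w: "\<sigma> * (fst q - fst c) * w1 + \<tau> * (snd q - snd c) * w2 > 0"
    if "q \<in> bdual K" "sqdist q c = 1" for q
  proof -
    have "sqdist q c0 = sqdist q c - 2 * (\<sigma> * (fst q - fst c) * w1 + \<tau> * (snd q - snd c) * w2) + (w1\<^sup>2 + w2\<^sup>2)"
    proof -
      have "\<sigma> * (fst q - fst c) * w1 = (fst q - fst c) * (fst c0 - fst c)"
        "\<tau> * (snd q - snd c) * w2 = (snd q - snd c) * (snd c0 - snd c)"
        using ss unfolding w1_def w2_def by algebra+
      moreover have "w1\<^sup>2 = (fst c0 - fst c)\<^sup>2" "w2\<^sup>2 = (snd c0 - snd c)\<^sup>2"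
        using ss2 unfolding w1_def w2_def by (simp_all add: power_mult_distrib)
      ultimately show ?thesis
        unfolding sqdist_def by (simp add: power2_eq_square algebra_simps)
    qed
    moreover have "w1\<^sup>2 + w2\<^sup>2 \<ge> 0" by simp
    ultimately show ?thesis using c0[OF that(1)] that(2) by argo
  qed
  have wP: "p1 * w1 + p2 * w2 > 0" using w[OF P c(2)] unfolding p1_def p2_def .
  have wu: "u1 * w1 + u2 * w2 > 0" using w[OF uK u(2)] unfolding u1_def u2_def .
  show thesis
  proof (cases "u2 \<ge> 0")
    case True
    have "u1 \<le> p1"
    proof (rule ccontr)
      assume a: "\<not> u1 \<le> p1"
      have "p2 \<noteq> 0"
      proof
        assume "p2 = 0"
        then have p: "p1 = 1 \<or> p1 = -1" using P1 by (simp add: power2_eq_1_iff)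
        have "u1\<^sup>2 \<le> 1" using U1 by (smt (verit) zero_le_power2)
        then have "u1 \<le> 1" by (simp add: abs_square_le_1 abs_le_iff)
        then have "p1 = -1" using p a by auto
        then have "u2 = 0" using cr True \<open>p2 = 0\<close> by simp
        then have "u1 = 1 \<or> u1 = -1" using U1 by (simp add: power2_eq_1_iff)
        then show False using wP wu \<open>p1 = -1\<close> \<open>p2 = 0\<close> \<open>u2 = 0\<close> a by auto
      qed
      then have p2p: "p2 > 0" using p2 by simp
      show False
      proof (cases "p1 \<ge> 0")
        case True
        have "u1\<^sup>2 > p1\<^sup>2" using a True by (intro power_strict_mono) auto
        then have "u2\<^sup>2 < p2\<^sup>2" using P1 U1 by linarith
        then have "u2 < p2" using p2 power2_less_imp_less by blast
        then have "p1 * u2 \<le> p1 * p2" using True by (intro mult_left_mono) auto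
        moreover have "p2 * p1 < p2 * u1" using a p2p by simp
        ultimately show False using cr by (simp add: mult.commute)
      next
        case False
        have "u1 < 0"
        proof (rule ccontr)
          assume "\<not> u1 < 0"
          then have "p2 * u1 \<ge> 0" "p1 * u2 \<le> 0" using p2p False True
            by (auto simp: mult_nonpos_nonneg)
          then have z: "p1 * u2 = 0" "p2 * u1 = 0" using cr by linarith+
          then have "u2 = 0" "u1 = 0" using False p2p by auto
          then show False using U1 by simp
        qed
        then have "(- u1)\<^sup>2 < (- p1)\<^sup>2" using a False by (intro power_strict_mono) auto
        then have "u1\<^sup>2 < p1\<^sup>2" by simp
        then have "u2\<^sup>2 > p2\<^sup>2" using P1 U1 by linarith
        then have "u2 > p2" using True power2_less_imp_less by blast
        then have "p1 * u2 < p1 * p2" using False by (simp add: mult_less_cancel_left)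
        moreover have "p2 * p1 < p2 * u1" using a p2p by simp
        ultimately show False using cr by (simp add: mult.commute)
      qed
    qed
    then have "\<sigma> * fst u \<le> \<sigma> * fst P" unfolding u1_def p1_def by (simp add: algebra_simps)
    moreover have "\<tau> * snd c \<le> \<tau> * snd u" using True unfolding u2_def by (simp add: algebra_simps)
    ultimately show thesis using that(1) u by blast
  next
    case False
    have "p1 * u2 - p2 * u1 \<noteq> 0"
    proof
      assume z: "p1 * u2 - p2 * u1 = 0"
      define k where "k = p1 * u1 + p2 * u2"
      have uk: "u1 = k * p1" "u2 = k * p2"
        using z P1 unfolding k_def by algebra+
      have "k * (p1 * w1 + p2 * w2) > 0" using wu uk by (simp add: algebra_simps)
      then have "k > 0" using wP by (simp add: zero_less_mult_iff)
      then show False using uk(2) False p2 by auto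
    qed
    then have crp: "p1 * u2 - p2 * u1 > 0" using cr by simp
    define k where "k = p1 * u2 - p2 * u1"
    \<comment> \<open>Now \<open>u\<close> is on the lower half, so the minor arc from
      \<open>P\<close> to \<open>u\<close> passes through \<open>(-1, 0)\<close>. The coefficients
      come from Cramer's rule with determinant \<open>k\<close>.\<close>
    have "(fst c - \<sigma>, snd c) \<in> bdual K"
    proof (rule bdual_arc[of K P u c _ "- u2 / k" "p2 / k"])
      show "K \<subseteq> bdual {P, u}"
        using P uK by (auto simp: bdual_def sqdist_commute)
      show "sqdist P c = 1" "sqdist u c = 1" by fact+
      show "sqdist (fst c - \<sigma>, snd c) c \<le> 1" using ss2 by (simp add: sqdist_def)
      show "0 \<le> - u2 / k" "0 \<le> p2 / k" using crp False p2 unfolding k_def by (auto intro: divide_nonneg_pos divide_nonpos_pos)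
      have kp: "k > 0" using crp unfolding k_def .
      have eq1: "(- u2 / k) * p1 + (p2 / k) * u1 = -1"
      proof -
        have "(- u2 / k) * p1 + (p2 / k) * u1 = (- u2 * p1 + p2 * u1) / k"
          by (simp add: diff_divide_distrib)
        also have "- u2 * p1 + p2 * u1 = - k" unfolding k_def by simp
        finally show ?thesis using kp by simp
      qed
      have eq2: "(- u2 / k) * p2 + (p2 / k) * u2 = 0" by (simp add: field_simps)
      have "fst P - fst c = \<sigma> * p1" "fst u - fst c = \<sigma> * u1" "snd P - snd c = \<tau> * p2" "snd u - snd c = \<tau> * u2"
        using ss unfolding p1_def u1_def p2_def u2_def by algebra+
      note e4 = this
      have "\<sigma> * ((- u2 / k) * p1 + (p2 / k) * u1) = - \<sigma>" unfolding eq1 by simp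
      then show "fst (fst c - \<sigma>, snd c) - fst c = - u2 / k * (fst P - fst c) + p2 / k * (fst u - fst c)"
        unfolding e4 by (simp add: algebra_simps)
      have "\<tau> * ((- u2 / k) * p2 + (p2 / k) * u2) = 0" unfolding eq2 by simp
      then show "snd (fst c - \<sigma>, snd c) - snd c = - u2 / k * (snd P - snd c) + p2 / k * (snd u - snd c)"
        unfolding e4 by (simp add: algebra_simps)
      \<comment> \<open>Since \<open>p1\<close> and \<open>u1\<close> are at least -1, the
        determinant \<open>k\<close> is at most \<open>p2 - u2\<close>; hence the coefficients sum
        to at least one.\<close>
      have "p1\<^sup>2 \<le> 1" "u1\<^sup>2 \<le> 1" using P1 U1 by (smt (verit) zero_le_power2)+
      then have "\<bar>p1\<bar> \<le> 1" "\<bar>u1\<bar> \<le> 1" by (simp_all add: abs_square_le_1)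
      then have "(- u2) * (- p1) \<le> (- u2) * 1" "p2 * (- u1) \<le> p2 * 1"
        using False p2 by (intro mult_left_mono; linarith)+
      then have "k \<le> - u2 + p2" unfolding k_def by (simp add: algebra_simps)
      then show "1 \<le> - u2 / k + p2 / k" using kp
        by (simp add: divide_simps add_divide_distrib[symmetric])
    qed
    then show thesis by (rule that(2))
  qed
qed

section \<open>Averages of semicircles\<close>

lemma semicircle_has_real_derivative:
  fixes a z :: real
  assumes "(z - a)\<^sup>2 < 1"
  shows "((\<lambda>z. sqrt (1 - (z - a)\<^sup>2)) has_real_derivative - ((z - a) / sqrt (1 - (z - a)\<^sup>2))) (at z)"
  using assms by (auto intro!: derivative_eq_intros simp: field_simps)

text \<open>The differential equation of curvature one, for the slope with reversed sign.\<close>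

lemma semicircle_slope_has_real_derivative:
  fixes a z :: real
  assumes "(z - a)\<^sup>2 < 1"
  shows "((\<lambda>z. (z - a) / sqrt (1 - (z - a)\<^sup>2)) has_real_derivative
    (sqrt (1 + ((z - a) / sqrt (1 - (z - a)\<^sup>2))\<^sup>2)) ^ 3) (at z)"
proof -
  define s where "s = sqrt (1 - (z - a)\<^sup>2)"
  have s: "s > 0" "s\<^sup>2 = 1 - (z - a)\<^sup>2" using assms unfolding s_def by auto
  have "1 + ((z - a) / s)\<^sup>2 = (1 / s)\<^sup>2"
    using s by (simp add: power_divide field_simps)
  then have e: "sqrt (1 + ((z - a) / s)\<^sup>2) = 1 / s" using s(1) by (simp only: real_sqrt_unique) simp
  have "((\<lambda>z. (z - a) / sqrt (1 - (z - a)\<^sup>2)) has_real_derivative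
    (1 * s - (z - a) * (- ((z - a) / s))) / (s * s)) (at z)"
    unfolding s_def
    by (intro DERIV_divide semicircle_has_real_derivative[OF assms])
      (use assms in \<open>auto intro!: derivative_eq_intros\<close>)
  moreover have "(1 * s - (z - a) * (- ((z - a) / s))) / (s * s) = (s\<^sup>2 + (z - a)\<^sup>2) / s ^ 3"
    using s(1) by (simp add: field_simps power2_eq_square power3_eq_cube)
  moreover have "\<dots> = (1 / s) ^ 3" using s by (simp add: power_one_over power_divide)
  ultimately show ?thesis unfolding s_def[symmetric] e by simp
qed

text \<open>\<open>p / sqrt (1 + p^2)\<close> is the sine of the angle with slope \<open>p\<close>.
  Its derivative is the reciprocal of the weight in the curvature equation, so along a graph this
  sine changes at the rate of the curvature.\<close>

lemma sine_of_slope_has_real_derivative: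
  "((\<lambda>p::real. p / sqrt (1 + p\<^sup>2)) has_real_derivative 1 / (sqrt (1 + p\<^sup>2)) ^ 3) (at p)"
proof -
  define s where "s = sqrt (1 + p\<^sup>2)"
  have pp: "1 + p\<^sup>2 > 0" by (rule add_pos_nonneg) auto
  have s: "s > 0" "s\<^sup>2 = 1 + p\<^sup>2" using pp unfolding s_def by (auto simp: add_nonneg_nonneg)
  have "((\<lambda>p. sqrt (1 + p\<^sup>2)) has_real_derivative p / s) (at p)"
    unfolding s_def using pp by (auto intro!: derivative_eq_intros simp: field_simps)
  then have "((\<lambda>p. p / sqrt (1 + p\<^sup>2)) has_real_derivative (1 * s - p * (p / s)) / (s * s)) (at p)"
    unfolding s_def by (intro DERIV_divide DERIV_ident) (use pp in auto)
  moreover have "(1 * s - p * (p / s)) / (s * s) = (s\<^sup>2 - p\<^sup>2) / s ^ 3"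
    using s(1) by (simp add: field_simps power2_eq_square power3_eq_cube)
  moreover have "\<dots> = 1 / s ^ 3" using s by simp
  ultimately show ?thesis unfolding s_def by simp
qed

lemma sine_of_slope_strict_mono:
  fixes p q :: real assumes "p < q" shows "p / sqrt (1 + p\<^sup>2) < q / sqrt (1 + q\<^sup>2)"
proof (rule DERIV_pos_imp_increasing[OF assms])
  fix x :: real
  have "1 + x\<^sup>2 > 0" by (rule add_pos_nonneg) auto
  then have "0 < 1 / (sqrt (1 + x\<^sup>2)) ^ 3" by simp
  then show "\<exists>y. ((\<lambda>p. p / sqrt (1 + p\<^sup>2)) has_real_derivative y) (at x) \<and> 0 < y"
    using sine_of_slope_has_real_derivative[of x] by blast
qed

lemma sine_of_slope_semicircle:
  fixes s :: real assumes "s\<^sup>2 < 1"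
  shows "(s / sqrt (1 - s\<^sup>2)) / sqrt (1 + (s / sqrt (1 - s\<^sup>2))\<^sup>2) = s"
proof -
  define t where "t = sqrt (1 - s\<^sup>2)"
  have t: "t > 0" "t\<^sup>2 = 1 - s\<^sup>2" using assms unfolding t_def by auto
  have "1 + (s / t)\<^sup>2 = (1 / t)\<^sup>2"
    using t by (simp add: power_divide field_simps)
  then have e: "sqrt (1 + (s / t)\<^sup>2) = 1 / t" using t(1) by (simp only: real_sqrt_unique) simp
  show ?thesis unfolding t_def[symmetric] e using t by simp
qed

text \<open>This convexity of \<open>p \<mapsto> (1 + p\<^sup>2)\<^sup>3\<^sup>/\<^sup>2\<close> is what makes
  the condition ``curvature at least one'' stable under averaging graphs.\<close>
lemma curvature_weight_convex:
  fixes p q u :: real assumes u: "0 \<le> u" "u \<le> 1"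
  shows "(sqrt (1 + ((1 - u) * p + u * q)\<^sup>2)) ^ 3
    \<le> (1 - u) * (sqrt (1 + p\<^sup>2)) ^ 3 + u * (sqrt (1 + q\<^sup>2)) ^ 3"
proof -
  define a b m where "a = sqrt (1 + p\<^sup>2)" and "b = sqrt (1 + q\<^sup>2)" and "m = (1 - u) * a + u * b"
  have ab: "a \<ge> 0" "b \<ge> 0" "a\<^sup>2 = 1 + p\<^sup>2" "b\<^sup>2 = 1 + q\<^sup>2"
    unfolding a_def b_def by (simp_all add: add_nonneg_nonneg)
  have m: "m \<ge> 0" unfolding m_def using ab u by simp
  \<comment> \<open>Cauchy-Schwarz for the vectors \<open>(1, p)\<close> and \<open>(1, q)\<close>;
    it bounds the norm of their average by the average \<open>m\<close> of their norms.\<close>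
  have "(a * b)\<^sup>2 - (1 + p * q)\<^sup>2 = (p - q)\<^sup>2"
    unfolding power_mult_distrib ab(3,4) by (simp add: power2_eq_square algebra_simps)
  then have "(1 + p * q)\<^sup>2 \<le> (a * b)\<^sup>2" by (smt (verit) zero_le_power2)
  then have "1 + p * q \<le> a * b"
    by (rule power2_le_imp_le) (use ab(1,2) in simp)
  then have "2 * u * (1 - u) * (1 + p * q) \<le> 2 * u * (1 - u) * (a * b)"
    using u by (intro mult_left_mono) auto
  moreover have "m\<^sup>2 = (1 - u)\<^sup>2 * a\<^sup>2 + u\<^sup>2 * b\<^sup>2 + 2 * u * (1 - u) * (a * b)"
    unfolding m_def by (simp add: power2_eq_square algebra_simps)
  moreover have "1 + ((1 - u) * p + u * q)\<^sup>2 = (1 - u)\<^sup>2 * (1 + p\<^sup>2) + u\<^sup>2 * (1 + q\<^sup>2) + 2 * u * (1 - u) * (1 + p * q)"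
    by (simp add: power2_eq_square algebra_simps)
  ultimately have "1 + ((1 - u) * p + u * q)\<^sup>2 \<le> m\<^sup>2" using ab by simp
  then have "sqrt (1 + ((1 - u) * p + u * q)\<^sup>2) \<le> m"
    using m by (simp add: real_le_lsqrt)
  then have "(sqrt (1 + ((1 - u) * p + u * q)\<^sup>2)) ^ 3 \<le> m ^ 3"
    by (intro power_mono) (simp_all add: add_nonneg_nonneg)
  also have "m ^ 3 \<le> (1 - u) * a ^ 3 + u * b ^ 3"
  proof -
    \<comment> \<open>On the nonnegative half line the cube lies above its tangent at
      \<open>m\<close>.\<close>
    have t: "x ^ 3 \<ge> m ^ 3 + 3 * m\<^sup>2 * (x - m)" if "x \<ge> 0" for x
    proof -
      have "x ^ 3 - (m ^ 3 + 3 * m\<^sup>2 * (x - m)) = (x - m)\<^sup>2 * (x + 2 * m)"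
        by (simp add: power2_eq_square power3_eq_cube algebra_simps)
      moreover have "(x - m)\<^sup>2 * (x + 2 * m) \<ge> 0" using that m by simp
      ultimately show ?thesis by linarith
    qed
    have "(1 - u) * (m ^ 3 + 3 * m\<^sup>2 * (a - m)) \<le> (1 - u) * a ^ 3"
      "u * (m ^ 3 + 3 * m\<^sup>2 * (b - m)) \<le> u * b ^ 3"
      using t ab u by (auto intro: mult_left_mono)
    moreover have "(1 - u) * (m ^ 3 + 3 * m\<^sup>2 * (a - m)) + u * (m ^ 3 + 3 * m\<^sup>2 * (b - m))
      = m ^ 3 + 3 * m\<^sup>2 * ((1 - u) * a + u * b - m)"
      by (simp add: algebra_simps)
    ultimately show ?thesis by (simp add: m_def[symmetric])
  qed
  finally show ?thesis unfolding a_def b_def .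
qed

lemma open_interval_sq_less_1:
  fixes l r z a :: real
  assumes "(l - a)\<^sup>2 \<le> 1" "(r - a)\<^sup>2 \<le> 1" "l < z" "z < r"
  shows "(z - a)\<^sup>2 < 1"
proof -
  have "\<bar>l - a\<bar> \<le> 1" "\<bar>r - a\<bar> \<le> 1" using assms(1,2) by (simp_all add: abs_square_le_1)
  then have "\<bar>z - a\<bar> < 1" using assms(3,4) by linarith
  then show ?thesis by (simp add: abs_square_less_1)
qed

text \<open>The sine of the slope angle of the averaged graph decreases at rate at least one, whereas
  along the unit circle it decreases at rate exactly one; hence the difference of the graphs
  cannot have an interior positive bump.\<close>
lemma semicircle_le_average:
  fixes a b a0 b0 a1 b1 u l r x :: real
  assumes u: "0 \<le> u" "u \<le> 1" and x: "l \<le> x" "x \<le> r"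
    and dom: "\<And>c. c \<in> {a, a0, a1} \<Longrightarrow> (l - c)\<^sup>2 \<le> 1 \<and> (r - c)\<^sup>2 \<le> 1"
    and W: "\<And>z. W z = (1 - u) * (b0 + sqrt (1 - (z - a0)\<^sup>2)) + u * (b1 + sqrt (1 - (z - a1)\<^sup>2))"
    and l: "b + sqrt (1 - (l - a)\<^sup>2) \<le> W l" and r: "b + sqrt (1 - (r - a)\<^sup>2) \<le> W r"
  shows "b + sqrt (1 - (x - a)\<^sup>2) \<le> W x"
proof (rule ccontr)
  assume neg: "\<not> ?thesis"
  then have lxr: "l < x" "x < r" using l r x by (auto simp: less_le)
  define D where "D z = b + sqrt (1 - (z - a)\<^sup>2) - W z" for z
  define slope where "slope c z = (z - c) / sqrt (1 - (z - c)\<^sup>2)" for c z :: real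
  define P where "P z = (1 - u) * slope a0 z + u * slope a1 z" for z
  have ins: "(z - c)\<^sup>2 < 1" if "c \<in> {a, a0, a1}" "l < z" "z < r" for c z
    using open_interval_sq_less_1 dom[OF that(1)] that by blast
  have D': "(D has_real_derivative P z - slope a z) (at z)" if "l < z" "z < r" for z
  proof -
    have "(D has_real_derivative 0 + - slope a z - ((1 - u) * (0 + - slope a0 z) + u * (0 + - slope a1 z))) (at z)"
      unfolding D_def W slope_def
      by (intro derivative_intros DERIV_cmult semicircle_has_real_derivative ins that) auto
    then show ?thesis unfolding P_def by (simp add: algebra_simps)
  qed
  have diff: "D differentiable at z" if "l < z" "z < r" for z
    using D'[OF that] real_differentiable_def by blast
  have cont: "continuous_on A D" for A
    unfolding D_def W by (intro continuous_intros)
  \<comment> \<open>A positive value of \<open>D\<close> at \<open>x\<close> between nonpositive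
    values at the ends forces a positive derivative somewhere before \<open>x\<close> and a negative
    one after it.\<close>
  have "\<exists>q z. l < z \<and> z < x \<and> (D has_real_derivative q) (at z) \<and> D x - D l = (x - l) * q"
    using lxr by (intro MVT cont) (auto intro!: diff)
  then obtain q1 z1 where z1: "l < z1" "z1 < x" "(D has_real_derivative q1) (at z1)" "D x - D l = (x - l) * q1"
    by blast
  have "\<exists>q z. x < z \<and> z < r \<and> (D has_real_derivative q) (at z) \<and> D r - D x = (r - x) * q"
    using lxr by (intro MVT cont) (auto intro!: diff)
  then obtain q2 z2 where z2: "x < z2" "z2 < r" "(D has_real_derivative q2) (at z2)" "D r - D x = (r - x) * q2"
    by blast
  have "D x > 0" "D l \<le> 0" "D r \<le> 0" using neg l r unfolding D_def by auto
  then have "(x - l) * q1 > 0" "(r - x) * q2 < 0" using z1(4) z2(4) by linarith+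
  then have "q1 > 0" "q2 < 0" using lxr by (auto simp: zero_less_mult_iff mult_less_0_iff)
  moreover have "q1 = P z1 - slope a z1" "q2 = P z2 - slope a z2"
    using DERIV_unique[OF z1(3) D'] DERIV_unique[OF z2(3) D'] z1 z2 lxr by auto
  ultimately have q: "slope a z1 < P z1" "P z2 < slope a z2" by auto
  \<comment> \<open>\<open>P\<close> and \<open>slope\<close> are slopes with reversed sign. The
    sine belonging to \<open>P\<close> lies above that of the circle, \<open>z - a\<close>, at
    \<open>z1\<close> and below it at \<open>z2\<close>, whereas \<open>S\<close> cannot
    decrease.\<close>
  define S where "S z = P z / sqrt (1 + (P z)\<^sup>2) - z" for z
  have "z1 - a < P z1 / sqrt (1 + (P z1)\<^sup>2)"
    using sine_of_slope_strict_mono[OF q(1)] sine_of_slope_semicircle[OF ins[of a z1]] z1 lxr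
    unfolding slope_def by simp
  moreover have "P z2 / sqrt (1 + (P z2)\<^sup>2) < z2 - a"
    using sine_of_slope_strict_mono[OF q(2)] sine_of_slope_semicircle[OF ins[of a z2]] z2 lxr
    unfolding slope_def by simp
  moreover have "S z1 \<le> S z2"
  proof (rule DERIV_nonneg_imp_nondecreasing[where f = S])
    show "z1 \<le> z2" using z1 z2 by simp
    fix z assume "z1 \<le> z" and "z \<le> z2"
    then have z: "l < z" "z < r" using z1 z2 by auto
    let ?w = "\<lambda>p::real. (sqrt (1 + p\<^sup>2)) ^ 3"
    have "(P has_real_derivative (1 - u) * ?w (slope a0 z) + u * ?w (slope a1 z)) (at z)"
      unfolding P_def slope_def
      by (intro derivative_intros DERIV_cmult semicircle_slope_has_real_derivative ins z) auto
    from DERIV_chain2[OF sine_of_slope_has_real_derivative this]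
    have "(S has_real_derivative 1 / ?w (P z) * ((1 - u) * ?w (slope a0 z) + u * ?w (slope a1 z)) - 1) (at z)"
      unfolding S_def by (intro derivative_intros)
    moreover have "?w (P z) \<le> (1 - u) * ?w (slope a0 z) + u * ?w (slope a1 z)"
      unfolding P_def by (rule curvature_weight_convex[OF u])
    moreover have "?w (P z) > 0" by (simp add: add_pos_nonneg)
    ultimately show "\<exists>y. (S has_real_derivative y) (at z) \<and> 0 \<le> y"
      by (intro exI conjI) (auto simp: field_simps)
  qed
  ultimately show False unfolding S_def by linarith
qed

section \<open>Circular segments\<close>

text \<open>The smaller segment cut from a unit disk by a chord of half length \<open>r\<close>: a
  sector of angle \<open>2 arcsin r\<close> minus a triangle.\<close>

definition seg_area :: "real \<Rightarrow> real" where
  "seg_area r = arcsin r - r * sqrt (1 - r\<^sup>2)"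

lemma seg_area_0 [simp]: "seg_area 0 = 0"
  by (simp add: seg_area_def)

text \<open>As a function of the squared half length, the area has derivative
  \<open>x / sqrt (1 - x^2)\<close>, which is increasing. So it is convex and lies above its tangent
  at \<open>s\<close>; at \<open>s = 1\<close> that tangent would be vertical.\<close>

lemma seg_area_tangent:
  assumes s: "0 \<le> s" "s < 1" and r: "0 \<le> r" "r \<le> 1"
  shows "seg_area s + s / sqrt (1 - s\<^sup>2) * (r\<^sup>2 - s\<^sup>2) \<le> seg_area r"
proof -
  define K where "K = s / sqrt (1 - s\<^sup>2)"
  define D where "D x = seg_area x - K * x\<^sup>2" for x
  have cont: "continuous_on {x..y} D" if "0 \<le> x" "y \<le> 1" for x y
    unfolding D_def seg_area_def using that by (intro continuous_intros) auto
  have D': "(D has_real_derivative 2 * x * (x / sqrt (1 - x\<^sup>2) - K)) (at x)" if "0 < x" "x < 1" for x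
  proof -
    have x: "x\<^sup>2 < 1" using that by (simp add: power_less_one_iff abs_square_less_1)
    define t where "t = sqrt (1 - x\<^sup>2)"
    have t: "t > 0" "t\<^sup>2 = 1 - x\<^sup>2" using x unfolding t_def by auto
    have d1: "((\<lambda>x. sqrt (1 - x\<^sup>2)) has_real_derivative - (x / t)) (at x)"
      using semicircle_has_real_derivative[of x 0] x unfolding t_def by simp
    have d2: "(arcsin has_real_derivative inverse t) (at x)"
      using DERIV_arcsin[of x] that unfolding t_def by simp
    have d3: "((\<lambda>x. x\<^sup>2) has_real_derivative 2 * x) (at x)"
      by (auto intro!: derivative_eq_intros)
    have D1: "(D has_real_derivative
      inverse t - (1 * sqrt (1 - x\<^sup>2) + - (x / t) * x) - K * (2 * x)) (at x)"
      unfolding D_def seg_area_def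
      by (intro DERIV_diff DERIV_mult DERIV_ident DERIV_cmult d1 d2 d3)
    have "inverse t - (1 * t + - (x / t) * x) = (1 + x\<^sup>2 - t\<^sup>2) / t"
      using t(1) by (simp add: field_simps power2_eq_square)
    also have "\<dots> = 2 * x * (x / t)" unfolding t(2) by (simp add: power2_eq_square)
    finally have e: "inverse t - (1 * sqrt (1 - x\<^sup>2) + - (x / t) * x) = 2 * x * (x / t)"
      unfolding t_def[symmetric] .
    have "(D has_real_derivative 2 * x * (x / t) - K * (2 * x)) (at x)"
      using D1 unfolding e .
    then show ?thesis unfolding t_def[symmetric] by (simp add: algebra_simps)
  qed
  have diff: "D differentiable at z" if "0 < z" "z < 1" for z
    using D'[OF that] real_differentiable_def by blast
  have mono: "x / sqrt (1 - x\<^sup>2) \<le> y / sqrt (1 - y\<^sup>2)" if "0 \<le> x" "x \<le> y" "y < 1" for x y :: real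
  proof (intro frac_le)
    have "x\<^sup>2 \<le> y\<^sup>2" "y\<^sup>2 < 1" using that by (auto simp: power_mono power_less_one_iff abs_square_less_1)
    then show "sqrt (1 - y\<^sup>2) \<le> sqrt (1 - x\<^sup>2)" "0 < sqrt (1 - y\<^sup>2)" by auto
  qed (use that in auto)
  have "D s \<le> D r"
  proof (cases r s rule: linorder_cases)
    case less
    have "\<exists>q z. r < z \<and> z < s \<and> (D has_real_derivative q) (at z) \<and> D s - D r = (s - r) * q"
      using less s r by (intro MVT cont) (auto intro!: diff)
    then obtain q z where z: "r < z" "z < s" "(D has_real_derivative q) (at z)" "D s - D r = (s - r) * q"
      by blast
    have "q = 2 * z * (z / sqrt (1 - z\<^sup>2) - K)" using DERIV_unique[OF z(3) D'] z s r by auto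
    then have "q \<le> 0" using mono[of z s] z s r unfolding K_def by (simp add: mult_nonneg_nonpos)
    then have "(s - r) * q \<le> 0" using less by (simp add: mult_nonneg_nonpos)
    then show ?thesis using z(4) by linarith
  next
    case greater
    have "\<exists>q z. s < z \<and> z < r \<and> (D has_real_derivative q) (at z) \<and> D r - D s = (r - s) * q"
      using greater s r by (intro MVT cont) (auto intro!: diff)
    then obtain q z where z: "s < z" "z < r" "(D has_real_derivative q) (at z)" "D r - D s = (r - s) * q"
      by blast
    have "q = 2 * z * (z / sqrt (1 - z\<^sup>2) - K)" using DERIV_unique[OF z(3) D'] z s r by auto
    then have "q \<ge> 0" using mono[of s z] z s r unfolding K_def by simp
    then have "(r - s) * q \<ge> 0" using greater by simp
    then show ?thesis using z(4) by linarith
  qed simp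
  then show ?thesis unfolding D_def K_def by (simp add: algebra_simps)
qed

text \<open>Three chords share the horizontal offset \<open>d\<close> and have vertical extents
  \<open>\<delta>\<close>, \<open>\<delta>0\<close>, \<open>\<delta>1\<close>. The second assumption
  on \<open>\<delta>\<close> makes the growth rate of the segment, \<open>K \<delta> / 2\<close> per
  unit of extent, at least \<open>|d| / 2\<close>; this pays for the last term, the change of the
  trapezoid when the chord ends move by \<open>a\<close> upwards and by \<open>b\<close>
  downwards.\<close>

lemma seg_area_chord_convex:
  fixes d \<delta> \<delta>0 \<delta>1 u a b :: real
  assumes u: "0 \<le> u" "u \<le> 1"
    and len: "d\<^sup>2 + \<delta>0\<^sup>2 \<le> 4" "d\<^sup>2 + \<delta>1\<^sup>2 \<le> 4" "d\<^sup>2 + \<delta>\<^sup>2 < 4"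
    and \<delta>: "\<delta> \<ge> 0" "\<bar>d\<bar> * sqrt (1 - (d\<^sup>2 + \<delta>\<^sup>2) / 4) \<le> \<delta> * (sqrt (d\<^sup>2 + \<delta>\<^sup>2) / 2)"
    and ab: "a \<ge> 0" "b \<ge> 0" "(1 - u) * \<delta>0 + u * \<delta>1 = \<delta> + a + b"
  shows "seg_area (sqrt (d\<^sup>2 + \<delta>\<^sup>2) / 2)
    \<le> (1 - u) * seg_area (sqrt (d\<^sup>2 + \<delta>0\<^sup>2) / 2) + u * seg_area (sqrt (d\<^sup>2 + \<delta>1\<^sup>2) / 2)
      + d * (a - b) / 2"
proof -
  define s where "s = sqrt (d\<^sup>2 + \<delta>\<^sup>2) / 2"
  have s2: "s\<^sup>2 = (d\<^sup>2 + \<delta>\<^sup>2) / 4" unfolding s_def by (simp add: power_divide)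
  have s: "0 \<le> s" "s < 1" unfolding s_def using len(3) real_sqrt_less_mono[OF len(3)] by auto
  define K where "K = s / sqrt (1 - s\<^sup>2)"
  have "s\<^sup>2 < 1" using s2 len(3) by simp
  then have t: "sqrt (1 - s\<^sup>2) > 0" by simp
  have K0: "K \<ge> 0" unfolding K_def using s t by simp
  have "\<bar>d\<bar> * sqrt (1 - s\<^sup>2) \<le> \<delta> * s" using \<delta>(2) by (simp only: s2) (simp add: s_def)
  then have Kd: "\<bar>d\<bar> \<le> K * \<delta>" unfolding K_def using t by (simp add: pos_le_divide_eq mult.commute)
  have tan: "seg_area s + K * \<delta> / 2 * (e - \<delta>) \<le> seg_area (sqrt (d\<^sup>2 + e\<^sup>2) / 2)" if "d\<^sup>2 + e\<^sup>2 \<le> 4" for e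
  proof -
    have r: "0 \<le> sqrt (d\<^sup>2 + e\<^sup>2) / 2" "sqrt (d\<^sup>2 + e\<^sup>2) / 2 \<le> 1"
      using that real_sqrt_le_mono[OF that] by auto
    have "(sqrt (d\<^sup>2 + e\<^sup>2) / 2)\<^sup>2 - s\<^sup>2 = (e\<^sup>2 - \<delta>\<^sup>2) / 4"
      unfolding s2 by (simp add: power_divide diff_divide_distrib add_divide_distrib)
    then have "seg_area s + K * ((e\<^sup>2 - \<delta>\<^sup>2) / 4) \<le> seg_area (sqrt (d\<^sup>2 + e\<^sup>2) / 2)"
      using seg_area_tangent[OF s r] by (simp only: K_def)
    moreover have "2 * \<delta> * (e - \<delta>) \<le> e\<^sup>2 - \<delta>\<^sup>2"
      using zero_le_power2[of "e - \<delta>"] by (simp add: power2_eq_square algebra_simps)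
    then have "K * ((2 * \<delta> * (e - \<delta>)) / 4) \<le> K * ((e\<^sup>2 - \<delta>\<^sup>2) / 4)"
      using K0 by (intro mult_left_mono) auto
    ultimately show ?thesis by (simp add: field_simps)
  qed
  have "(1 - u) * (seg_area s + K * \<delta> / 2 * (\<delta>0 - \<delta>)) + u * (seg_area s + K * \<delta> / 2 * (\<delta>1 - \<delta>))
    \<le> (1 - u) * seg_area (sqrt (d\<^sup>2 + \<delta>0\<^sup>2) / 2) + u * seg_area (sqrt (d\<^sup>2 + \<delta>1\<^sup>2) / 2)"
    using u tan[OF len(1)] tan[OF len(2)] by (intro add_mono mult_left_mono) auto
  moreover have "(1 - u) * (seg_area s + K * \<delta> / 2 * (\<delta>0 - \<delta>)) + u * (seg_area s + K * \<delta> / 2 * (\<delta>1 - \<delta>))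
    = seg_area s + K * \<delta> / 2 * ((1 - u) * \<delta>0 + u * \<delta>1 - \<delta>)"
    by (simp add: field_simps)
  moreover have "K * \<delta> * (a + b) \<ge> \<bar>d\<bar> * (a + b)" using Kd ab by (intro mult_right_mono) auto
  moreover have "\<bar>d\<bar> * (a + b) \<ge> - d * (a - b)"
  proof -
    have "\<bar>d * (a - b)\<bar> \<le> \<bar>d\<bar> * (a + b)" unfolding abs_mult using ab by (intro mult_left_mono) auto
    then show ?thesis by linarith
  qed
  ultimately show ?thesis unfolding s_def[symmetric] ab(3) by (simp add: field_simps)
qed

section \<open>Area of a circular segment by integration over fibres\<close>

lemma emeasure_lborel_fibres:
  fixes S :: "(real \<times> real) set"
  assumes "S \<in> sets borel"
  shows "emeasure lborel S = (\<integral>\<^sup>+x. emeasure lborel (Pair x -` S) \<partial>lborel)"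
proof -
  have "S \<in> sets (lborel \<Otimes>\<^sub>M lborel)" using assms unfolding lborel_prod by simp
  from lborel.emeasure_pair_measure_alt[OF this] show ?thesis by (simp add: lborel_prod)
qed

lemma emeasure_disk_segment:
  assumes r: "0 \<le> r" "r \<le> 1"
  shows "emeasure lborel {p::real \<times> real. sqrt (1 - r\<^sup>2) < snd p \<and> (fst p)\<^sup>2 + (snd p)\<^sup>2 \<le> 1}
    = ennreal (seg_area r)" (is "emeasure lborel ?S = _")
proof -
  define h where "h = sqrt (1 - r\<^sup>2)"
  have r2: "r\<^sup>2 \<le> 1" using r by (simp add: power_le_one)
  have h: "0 \<le> h" "h\<^sup>2 = 1 - r\<^sup>2" unfolding h_def using r2 by auto
  have "?S = {p. sqrt (1 - r\<^sup>2) < snd p} \<inter> {p. (fst p)\<^sup>2 + (snd p)\<^sup>2 \<le> 1}" by auto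
  moreover have "{p :: real \<times> real. sqrt (1 - r\<^sup>2) < snd p} \<in> sets borel"
    by (intro borel_open open_Collect_less continuous_intros)
  moreover have "{p :: real \<times> real. (fst p)\<^sup>2 + (snd p)\<^sup>2 \<le> 1} \<in> sets borel"
    by (intro borel_closed closed_Collect_le continuous_intros)
  ultimately have "?S \<in> sets (borel :: (real \<times> real) measure)" by auto
  then have "emeasure lborel ?S = (\<integral>\<^sup>+x. emeasure lborel (Pair x -` ?S) \<partial>lborel)"
    by (rule emeasure_lborel_fibres)
  also have "\<dots> = (\<integral>\<^sup>+x. ennreal (sqrt (1 - x\<^sup>2) - h) * indicator {-r..r} x \<partial>lborel)"
  proof (intro nn_integral_cong)
    fix x :: real
    show "emeasure lborel (Pair x -` ?S) = ennreal (sqrt (1 - x\<^sup>2) - h) * indicator {-r..r} x"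
    proof (cases "x \<in> {-r..r}")
      case True
      then have x: "x\<^sup>2 \<le> r\<^sup>2" by (simp add: abs_le_square_iff[symmetric] abs_le_iff)
      have "Pair x -` ?S = {h<..sqrt (1 - x\<^sup>2)}"
      proof (intro set_eqI iffI)
        fix y assume "y \<in> Pair x -` ?S"
        then have "h < y" "y\<^sup>2 \<le> 1 - x\<^sup>2" by (auto simp: h_def)
        then show "y \<in> {h<..sqrt (1 - x\<^sup>2)}" using real_le_rsqrt by auto
      next
        fix y assume "y \<in> {h<..sqrt (1 - x\<^sup>2)}"
        then have y: "h < y" "y \<le> sqrt (1 - x\<^sup>2)" by auto
        then have "y\<^sup>2 \<le> (sqrt (1 - x\<^sup>2))\<^sup>2" using h by (intro power_mono) auto
        then have "y\<^sup>2 \<le> 1 - x\<^sup>2" using x r2 by simp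
        then show "y \<in> Pair x -` ?S" using y by (simp add: h_def)
      qed
      moreover have "h \<le> sqrt (1 - x\<^sup>2)" unfolding h_def using x by simp
      ultimately show ?thesis using True by simp
    next
      case False
      have "Pair x -` ?S = {}"
      proof (rule ccontr)
        assume "Pair x -` ?S \<noteq> {}"
        then obtain y where y: "h < y" "x\<^sup>2 + y\<^sup>2 \<le> 1" by (auto simp: h_def)
        then have "h\<^sup>2 < y\<^sup>2" using h by (intro power_strict_mono) auto
        then have "x\<^sup>2 < r\<^sup>2" using h y by linarith
        then have "\<bar>x\<bar> < r" using r power2_less_imp_less[of "\<bar>x\<bar>" r] by simp
        then show False using False by auto
      qed
      then have "emeasure lborel (Pair x -` ?S) = 0" by (simp only: emeasure_empty)
      moreover have "indicator {-r..r} x = (0 :: ennreal)" using False by simp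
      ultimately show ?thesis by (simp only: mult_zero_right)
    qed
  qed
  also have "\<dots> = ennreal (seg_area r)"
  proof -
    \<comment> \<open>An antiderivative of \<open>sqrt (1 - x^2) - h\<close>. The interior version
      of the fundamental theorem covers \<open>r = 1\<close>, where \<open>arcsin\<close> is not
      differentiable at the ends.\<close>
    define F where "F x = (x * sqrt (1 - x\<^sup>2) + arcsin x) / 2 - h * x" for x
    have "((\<lambda>x. sqrt (1 - x\<^sup>2) - h) has_integral (F r - F (- r))) {-r..r}"
    proof (rule fundamental_theorem_of_calculus_interior)
      show "continuous_on {-r..r} F"
        unfolding F_def using r by (intro continuous_intros) auto
      fix x assume "x \<in> {-r<..<r}"
      then have x: "-1 < x" "x < 1" using r by auto
      then have x2: "x\<^sup>2 < 1" by (simp add: abs_square_less_1)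
      define t where "t = sqrt (1 - x\<^sup>2)"
      have t: "t > 0" "t\<^sup>2 = 1 - x\<^sup>2" using x2 unfolding t_def by auto
      have d1: "((\<lambda>x. sqrt (1 - x\<^sup>2)) has_real_derivative - (x / t)) (at x)"
        using semicircle_has_real_derivative[of x 0] x2 unfolding t_def by simp
      have d2: "(arcsin has_real_derivative inverse t) (at x)"
        using DERIV_arcsin[OF x] unfolding t_def .
      have F1: "(F has_real_derivative
        (1 * sqrt (1 - x\<^sup>2) + - (x / t) * x + inverse t) / 2 - h * 1) (at x)"
        unfolding F_def
        by (intro DERIV_diff DERIV_cdivide DERIV_add DERIV_mult DERIV_ident DERIV_cmult d1 d2)
      have e: "(1 * sqrt (1 - x\<^sup>2) + - (x / t) * x + inverse t) / 2 = t"
      proof -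
        have "1 * t + - (x / t) * x + inverse t = (1 - x\<^sup>2 + t\<^sup>2) / t"
          using t(1) by (simp add: field_simps power2_eq_square)
        also have "\<dots> = 2 * t" unfolding t(2)[symmetric] using t(1)
          by (simp add: power2_eq_square)
        finally show ?thesis unfolding t_def[symmetric] by simp
      qed
      have "(F has_real_derivative t - h) (at x)" using F1 unfolding e by simp
      then show "(F has_vector_derivative sqrt (1 - x\<^sup>2) - h) (at x)"
        unfolding t_def has_real_derivative_iff_has_vector_derivative .
    qed (use r in simp)
    moreover have "F r - F (- r) = seg_area r"
      unfolding F_def seg_area_def using r by (simp add: h_def arcsin_minus field_simps)
    ultimately have I: "((\<lambda>x. sqrt (1 - x\<^sup>2) - h) has_integral seg_area r) {-r..r}" by simp
    have nn: "0 \<le> sqrt (1 - x\<^sup>2) - h" if "x \<in> {-r..r}" for x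
    proof -
      have "x\<^sup>2 \<le> r\<^sup>2" using that by (simp add: abs_le_square_iff[symmetric] abs_le_iff)
      then show ?thesis unfolding h_def by simp
    qed
    show ?thesis
      using nn I by (intro nn_integral_has_integral_lebesgue') auto
  qed
  finally show ?thesis .
qed

section \<open>Caps between a chord and a unit arc\<close>

definition left_of :: "real \<times> real \<Rightarrow> real \<times> real \<Rightarrow> (real \<times> real) set" where
  "left_of p q = {z. (fst q - fst p) * (snd z - snd p) - (snd q - snd p) * (fst z - fst p) > 0}"

lemma left_of_measurable: "left_of p q \<in> sets borel"
  unfolding left_of_def by (intro borel_open open_Collect_less continuous_intros)

text \<open>Strictness in the definition gives degenerate chords an empty side, so a single-point
  end has no cap.\<close>

lemma left_of_same [simp]: "left_of p p = {}"
  by (auto simp: left_of_def)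

definition unit_disk :: "real \<times> real \<Rightarrow> (real \<times> real) set" where
  "unit_disk c = {z. sqdist z c \<le> 1}"

lemma unit_disk_eq_cball: "unit_disk c = cball c 1"
  by (auto simp: unit_disk_def dist_le_1_iff_sqdist sqdist_commute)

locale chord =
  fixes p q :: "real \<times> real"
  assumes neq: "p \<noteq> q" and len: "sqdist p q \<le> 4"
begin

definition "r = sqrt (sqdist p q) / 2"
definition "h = sqrt (1 - r\<^sup>2)"
definition "e1 = (fst q - fst p) / (2 * r)"
definition "e2 = (snd q - snd p) / (2 * r)"
text \<open>Of the unit circles through \<open>p\<close> and \<open>q\<close>, the one whose centre
  is not to the left of the directed chord; the part of its disk to the left is thus at most a half
  disk. In the frame used below, \<open>s\<close> runs along the chord and \<open>t\<close> along
  its left normal, starting at this centre.\<close>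

definition "center = ((fst p + fst q) / 2 + h * e2, (snd p + snd q) / 2 - h * e1)"

lemma r: "0 < r" "r \<le> 1" "4 * r\<^sup>2 = sqdist p q"
proof -
  have pos: "sqdist p q > 0" using neq
    by (auto simp: sqdist_def prod_eq_iff sum_power2_gt_zero_iff)
  then show "0 < r" by (simp add: r_def)
  have "sqrt (sqdist p q) \<le> sqrt 4" using len by (simp only: real_sqrt_le_iff)
  then show "r \<le> 1" by (simp add: r_def)
  show "4 * r\<^sup>2 = sqdist p q" using pos by (simp add: r_def power_divide)
qed

lemma h: "0 \<le> h" "h\<^sup>2 = 1 - r\<^sup>2"
  using r(1,2) by (auto simp: h_def power_le_one abs_square_le_1)

lemma e: "e1\<^sup>2 + e2\<^sup>2 = 1"
proof -
  have "e1\<^sup>2 + e2\<^sup>2 = sqdist p q / (4 * r\<^sup>2)"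
    by (simp add: e1_def e2_def sqdist_def power_divide power_mult_distrib add_divide_distrib power2_commute)
  moreover have "4 * r\<^sup>2 > 0" using r(1) by simp
  ultimately show ?thesis using r(3) by simp
qed

lemma diffs: "fst q - fst p = 2 * r * e1" "snd q - snd p = 2 * r * e2"
  using r(1) by (simp_all add: e1_def e2_def)

lemma center_frame:
  "fst z = fst center + s * e1 - t * e2 \<Longrightarrow> snd z = snd center + s * e2 + t * e1 \<Longrightarrow>
    sqdist z center = s\<^sup>2 + t\<^sup>2"
  using e by (simp add: sqdist_def) algebra

lemma frame_p: "fst p = fst center + (- r) * e1 - h * e2" "snd p = snd center + (- r) * e2 + h * e1"
  unfolding center_def using diffs by (simp_all add: field_simps)

lemma frame_q: "fst q = fst center + r * e1 - h * e2" "snd q = snd center + r * e2 + h * e1"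
  unfolding center_def using diffs by (simp_all add: field_simps)

lemma left_of_frame:
  assumes "fst z = fst center + s * e1 - t * e2" "snd z = snd center + s * e2 + t * e1"
  shows "z \<in> left_of p q \<longleftrightarrow> h < t"
proof -
  have eq: "(fst q - fst p) * (snd z - snd p) - (snd q - snd p) * (fst z - fst p)
    = 2 * r * (t - h)"
    unfolding diffs unfolding assms frame_p using e by algebra
  show ?thesis unfolding left_of_def mem_Collect_eq eq using r(1) by (simp add: zero_less_mult_iff)
qed

lemma cap_eq_image:
  "unit_disk center \<inter> left_of p q =
    (\<lambda>z. (fst center + fst z * e1 - snd z * e2, snd center + fst z * e2 + snd z * e1)) `
      {z. sqrt (1 - r\<^sup>2) < snd z \<and> (fst z)\<^sup>2 + (snd z)\<^sup>2 \<le> 1}" (is "_ = ?f ` ?S")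
proof (intro set_eqI iffI)
  fix z assume z: "z \<in> unit_disk center \<inter> left_of p q"
  define s t where "s = (fst z - fst center) * e1 + (snd z - snd center) * e2"
    and "t = (snd z - snd center) * e1 - (fst z - fst center) * e2"
  have st: "fst z = fst center + s * e1 - t * e2" "snd z = snd center + s * e2 + t * e1"
    unfolding s_def t_def using e by algebra+
  have "(s, t) \<in> ?S"
    using z left_of_frame[OF st] center_frame[OF st] by (auto simp: unit_disk_def h_def)
  moreover have "z = ?f (s, t)" using st by (simp add: prod_eq_iff)
  ultimately show "z \<in> ?f ` ?S" by blast
next
  fix z assume "z \<in> ?f ` ?S"
  then obtain w where w: "w \<in> ?S" "z = ?f w" by blast
  have st: "fst z = fst center + fst w * e1 - snd w * e2" "snd z = snd center + fst w * e2 + snd w * e1"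
    using w by auto
  show "z \<in> unit_disk center \<inter> left_of p q"
    using w(1) left_of_frame[OF st] center_frame[OF st] by (auto simp: unit_disk_def h_def)
qed

lemma emeasure_cap: "emeasure lborel (unit_disk center \<inter> left_of p q) = ennreal (seg_area r)"
proof -
  let ?S = "{z :: real \<times> real. sqrt (1 - r\<^sup>2) < snd z \<and> (fst z)\<^sup>2 + (snd z)\<^sup>2 \<le> 1}"
  have "?S = {z. sqrt (1 - r\<^sup>2) < snd z} \<inter> {z. (fst z)\<^sup>2 + (snd z)\<^sup>2 \<le> 1}" by auto
  moreover have "{z :: real \<times> real. sqrt (1 - r\<^sup>2) < snd z} \<in> sets borel"
    by (intro borel_open open_Collect_less continuous_intros)
  moreover have "{z :: real \<times> real. (fst z)\<^sup>2 + (snd z)\<^sup>2 \<le> 1} \<in> sets borel"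
    by (intro borel_closed closed_Collect_le continuous_intros)
  ultimately have m: "?S \<in> sets borel" by auto
  have "?S \<subseteq> unit_disk (0, 0)" by (auto simp: unit_disk_def sqdist_def)
  then have b: "bounded ?S" unfolding unit_disk_eq_cball by (rule bounded_subset[OF bounded_cball])
  have r': "0 \<le> r" using r by simp
  show ?thesis
    unfolding cap_eq_image emeasure_planar_isometry_image[OF e m b] emeasure_disk_segment[OF r' r(2)] ..
qed

text \<open>Every unit disk containing \<open>p\<close> and \<open>q\<close> contains the smaller
  segment over their chord. In the frame, a centre \<open>(x, y)\<close> of such a disk satisfies
  \<open>x^2 + (h - y)^2 + 2 r |x| <= h^2\<close>, hence \<open>y >= 0\<close>, and a cap point
  satisfies \<open>|s| <= r\<close>. Together these absorb the cross terms of the squared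
  distance.\<close>

lemma cap_subset_bdual:
  assumes "K \<subseteq> bdual {p, q}"
  shows "unit_disk center \<inter> left_of p q \<subseteq> bdual K"
proof
  fix z assume "z \<in> unit_disk center \<inter> left_of p q"
  then obtain s t where st: "fst z = fst center + s * e1 - t * e2" "snd z = snd center + s * e2 + t * e1"
    and S: "h < t" "s\<^sup>2 + t\<^sup>2 \<le> 1"
    unfolding cap_eq_image h_def by auto
  show "z \<in> bdual K"
    unfolding bdual_def
  proof (intro CollectI ballI)
    fix k assume "k \<in> K"
    then have k: "sqdist p k \<le> 1" "sqdist q k \<le> 1" using assms by (auto simp: bdual_def)
    define x y where "x = (fst k - fst center) * e1 + (snd k - snd center) * e2"
      and "y = (snd k - snd center) * e1 - (fst k - fst center) * e2"
    have xy: "fst k = fst center + x * e1 - y * e2" "snd k = snd center + x * e2 + y * e1"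
      unfolding x_def y_def using e by algebra+
    have d: "sqdist w k = (a - x)\<^sup>2 + (b - y)\<^sup>2"
      if "fst w = fst center + a * e1 - b * e2" "snd w = snd center + a * e2 + b * e1" for w a b
      unfolding sqdist_def that xy using e by algebra
    have "(- r - x)\<^sup>2 + (h - y)\<^sup>2 \<le> 1" "(r - x)\<^sup>2 + (h - y)\<^sup>2 \<le> 1"
      using k d[OF frame_p] d[OF frame_q] by auto
    then have "x\<^sup>2 + (h - y)\<^sup>2 + 2 * r * x \<le> h\<^sup>2" "x\<^sup>2 + (h - y)\<^sup>2 - 2 * r * x \<le> h\<^sup>2"
      using h(2) by (simp_all add: power2_eq_square algebra_simps)
    then have A: "x\<^sup>2 + (h - y)\<^sup>2 + 2 * (r * \<bar>x\<bar>) \<le> h\<^sup>2" by (cases "x \<ge> 0") auto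
    have rx: "0 \<le> r * \<bar>x\<bar>" using r(1) by simp
    have "(h - y)\<^sup>2 \<le> h\<^sup>2" using A rx zero_le_power2[of x] by linarith
    then have hy: "y \<ge> 0" using h(1) abs_le_square_iff[of "h - y" h] by linarith
    have "t\<^sup>2 > h\<^sup>2" using S(1) h(1) by (intro power_strict_mono) auto
    then have "s\<^sup>2 \<le> r\<^sup>2" using S(2) h(2) by linarith
    then have "\<bar>s\<bar> \<le> r" using r(1) abs_le_square_iff[of s r] by simp
    then have "\<bar>s\<bar> * \<bar>x\<bar> \<le> r * \<bar>x\<bar>" by (intro mult_right_mono) auto
    then have "\<bar>s * x\<bar> \<le> r * \<bar>x\<bar>" by (simp add: abs_mult)
    then have "- (s * x) \<le> r * \<bar>x\<bar>" by linarith
    moreover have "(t - h) * y \<ge> 0" using S(1) hy by simp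
    moreover have "sqdist z k = s\<^sup>2 + t\<^sup>2 + (x\<^sup>2 + (h - y)\<^sup>2 - h\<^sup>2) - 2 * (s * x) - 2 * ((t - h) * y)"
      unfolding d[OF st] by (simp add: power2_eq_square algebra_simps)
    ultimately have "sqdist z k \<le> 1" using A S(2) by linarith
    then show "sqdist k z \<le> 1" by (simp add: sqdist_commute)
  qed
qed

lemma center_unique:
  assumes "sqdist p c = 1" "sqdist q c = 1" "c \<notin> left_of p q"
  shows "c = center"
proof -
  define x y where "x = (fst c - fst center) * e1 + (snd c - snd center) * e2"
    and "y = (snd c - snd center) * e1 - (fst c - fst center) * e2"
  have xy: "fst c = fst center + x * e1 - y * e2" "snd c = snd center + x * e2 + y * e1"
    unfolding x_def y_def using e by algebra+
  have d: "sqdist w c = (a - x)\<^sup>2 + (b - y)\<^sup>2"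
    if "fst w = fst center + a * e1 - b * e2" "snd w = snd center + a * e2 + b * e1" for w a b
    unfolding sqdist_def that xy using e by algebra
  have A: "(- r - x)\<^sup>2 + (h - y)\<^sup>2 = 1" "(r - x)\<^sup>2 + (h - y)\<^sup>2 = 1"
    using assms(1,2) d[OF frame_p] d[OF frame_q] by auto
  then have "4 * r * x = 0" by algebra
  then have x: "x = 0" using r(1) by simp
  then have "(h - y)\<^sup>2 = h\<^sup>2" using A h(2) by simp
  \<comment> \<open>The value \<open>2 * h\<close> belongs to the mirror-image centre, which lies to
    the left of the chord unless both centres coincide.\<close>
  then have "y = 0 \<or> y = 2 * h" by algebra
  moreover have "y \<le> h" using left_of_frame[OF xy] assms(3) by simp
  ultimately have "y = 0" using h(1) by auto
  then show ?thesis using x xy by (simp add: prod_eq_iff)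
qed

end

section \<open>Upper and lower boundary of a planar convex body\<close>

definition upper :: "(real \<times> real) set \<Rightarrow> real \<Rightarrow> real" where
  "upper M x = Sup {y. (x, y) \<in> M}"

definition lower :: "(real \<times> real) set \<Rightarrow> real \<Rightarrow> real" where
  "lower M x = Inf {y. (x, y) \<in> M}"

lemma fibre_compact:
  fixes M :: "(real \<times> real) set"
  assumes "compact M" shows "compact {y. (x, y) \<in> M}"
proof -
  have "{y. (x, y) \<in> M} = snd ` (M \<inter> {p. fst p = x})" by force
  moreover have "compact (M \<inter> {p. fst p = x})"
    by (intro compact_Int_closed assms closed_Collect_eq continuous_intros)
  ultimately show ?thesis by (simp add: compact_continuous_image continuous_on_snd)
qed

lemma upper_mem:
  assumes "compact M" "x \<in> fst ` M" shows "(x, upper M x) \<in> M"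
proof -
  have "{y. (x, y) \<in> M} \<noteq> {}" using assms(2) by force
  then have "upper M x \<in> {y. (x, y) \<in> M}" unfolding upper_def
    using fibre_compact[OF assms(1), of x]
    by (intro closed_contains_Sup) (auto intro: compact_imp_closed bounded_imp_bdd_above compact_imp_bounded)
  then show ?thesis by simp
qed

lemma lower_mem:
  assumes "compact M" "x \<in> fst ` M" shows "(x, lower M x) \<in> M"
proof -
  have "{y. (x, y) \<in> M} \<noteq> {}" using assms(2) by force
  then have "lower M x \<in> {y. (x, y) \<in> M}" unfolding lower_def
    using fibre_compact[OF assms(1), of x]
    by (intro closed_contains_Inf) (auto intro: compact_imp_closed bounded_imp_bdd_below compact_imp_bounded)
  then show ?thesis by simp
qed

lemma le_upper: "compact M \<Longrightarrow> (x, y) \<in> M \<Longrightarrow> y \<le> upper M x"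
  unfolding upper_def using fibre_compact[of M x]
  by (intro cSup_upper) (auto intro: bounded_imp_bdd_above compact_imp_bounded)

lemma lower_le: "compact M \<Longrightarrow> (x, y) \<in> M \<Longrightarrow> lower M x \<le> y"
  unfolding lower_def using fibre_compact[of M x]
  by (intro cInf_lower) (auto intro: bounded_imp_bdd_below compact_imp_bounded)

lemma fst_image_interval:
  fixes M :: "(real \<times> real) set"
  assumes "convex M" "a \<in> fst ` M" "b \<in> fst ` M" "a \<le> x" "x \<le> b"
  shows "x \<in> fst ` M"
proof -
  have "convex (fst ` M)" using assms(1) by (intro convex_linear_image linear_fst)
  then show ?thesis using assms(2-5) by (meson is_interval_1 is_interval_convex_1)
qed

text \<open>Superlevel sets of \<open>upper\<close> and sublevel sets of \<open>lower\<close> are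
  projections of compact pieces of \<open>M\<close>, hence closed, which gives measurability.
  Restriction to \<open>{a..b}\<close> keeps away from empty fibres, where \<open>Sup\<close> and
  \<open>Inf\<close> carry no meaning.\<close>

lemma upper_lower_integrable:
  fixes M :: "(real \<times> real) set"
  assumes M: "compact M" "convex M" and ab: "a \<in> fst ` M" "b \<in> fst ` M"
  shows "integrable lborel (\<lambda>x. indicator {a..b} x * upper M x)"
    and "integrable lborel (\<lambda>x. indicator {a..b} x * lower M x)"
proof -
  have I: "x \<in> fst ` M" if "x \<in> {a..b}" for x
    using fst_image_interval[OF M(2) ab] that by auto
  have proj: "closed (fst ` (M \<inter> {p. P p}))" if "closed {p :: real \<times> real. P p}" for P
    using compact_continuous_image[OF continuous_on_fst[OF continuous_on_id] compact_Int_closed[OF M(1) that]]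
    by (auto intro: compact_imp_closed)
  have mu: "upper M \<in> borel_measurable (restrict_space borel {a..b})"
  proof (rule borel_measurable_iff_ge[THEN iffD2], rule allI)
    fix t
    have "{x \<in> space (restrict_space borel {a..b}). t \<le> upper M x}
      = {a..b} \<inter> fst ` (M \<inter> {p. t \<le> snd p})"
    proof (intro set_eqI iffI)
      fix x assume "x \<in> {x \<in> space (restrict_space borel {a..b}). t \<le> upper M x}"
      then have x: "x \<in> {a..b}" "t \<le> upper M x" by (auto simp: space_restrict_space)
      then have "(x, upper M x) \<in> M \<inter> {p. t \<le> snd p}" using upper_mem[OF M(1) I] by auto
      then show "x \<in> {a..b} \<inter> fst ` (M \<inter> {p. t \<le> snd p})" using x by force
    next
      fix x assume "x \<in> {a..b} \<inter> fst ` (M \<inter> {p. t \<le> snd p})"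
      then obtain y where "x \<in> {a..b}" "(x, y) \<in> M" "t \<le> y" by auto
      then show "x \<in> {x \<in> space (restrict_space borel {a..b}). t \<le> upper M x}"
        using le_upper[OF M(1)] by (force simp: space_restrict_space)
    qed
    moreover have "closed (fst ` (M \<inter> {p. t \<le> snd p}))"
      by (intro proj closed_Collect_le continuous_intros)
    ultimately show "{x \<in> space (restrict_space borel {a..b}). t \<le> upper M x} \<in> sets (restrict_space borel {a..b})"
      by (auto simp: sets_restrict_space intro!: borel_closed)
  qed
  have ml: "lower M \<in> borel_measurable (restrict_space borel {a..b})"
  proof (rule borel_measurable_iff_le[THEN iffD2], rule allI)
    fix t
    have "{x \<in> space (restrict_space borel {a..b}). lower M x \<le> t}
      = {a..b} \<inter> fst ` (M \<inter> {p. snd p \<le> t})"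
    proof (intro set_eqI iffI)
      fix x assume "x \<in> {x \<in> space (restrict_space borel {a..b}). lower M x \<le> t}"
      then have x: "x \<in> {a..b}" "lower M x \<le> t" by (auto simp: space_restrict_space)
      then have "(x, lower M x) \<in> M \<inter> {p. snd p \<le> t}" using lower_mem[OF M(1) I] by auto
      then show "x \<in> {a..b} \<inter> fst ` (M \<inter> {p. snd p \<le> t})" using x by force
    next
      fix x assume "x \<in> {a..b} \<inter> fst ` (M \<inter> {p. snd p \<le> t})"
      then obtain y where "x \<in> {a..b}" "(x, y) \<in> M" "y \<le> t" by auto
      then show "x \<in> {x \<in> space (restrict_space borel {a..b}). lower M x \<le> t}"
        using lower_le[OF M(1)] by (force simp: space_restrict_space)
    qed
    moreover have "closed (fst ` (M \<inter> {p. snd p \<le> t}))"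
      by (intro proj closed_Collect_le continuous_intros)
    ultimately show "{x \<in> space (restrict_space borel {a..b}). lower M x \<le> t} \<in> sets (restrict_space borel {a..b})"
      by (auto simp: sets_restrict_space intro!: borel_closed)
  qed
  obtain C where C: "\<And>p. p \<in> M \<Longrightarrow> norm p \<le> C"
    using compact_imp_bounded[OF M(1)] by (auto simp: bounded_iff)
  have bd: "\<bar>y\<bar> \<le> C" if "(x, y) \<in> M" for x y
    using C[OF that] norm_snd_le[of y x] by auto
  have gen: "integrable lborel (\<lambda>x. indicator {a..b} x * f x)"
    if m: "f \<in> borel_measurable (restrict_space borel {a..b})" and f: "\<And>x. x \<in> {a..b} \<Longrightarrow> \<bar>f x\<bar> \<le> C"
    for f :: "real \<Rightarrow> real"
  proof -
    have m': "(\<lambda>x. indicator {a..b} x *\<^sub>R f x) \<in> borel_measurable borel"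
      using m by (subst (asm) borel_measurable_restrict_space_iff) auto
    have "integrable lborel (\<lambda>x. indicator {a..b} x *\<^sub>R (indicator {a..b} x *\<^sub>R f x))"
    proof (rule integrableI_bounded_set_indicator[where B = C])
      show "AE x in lborel. x \<in> {a..b} \<longrightarrow> norm (indicator {a..b} x *\<^sub>R f x) \<le> C"
        using f by (auto simp: indicator_def)
    qed (use m' in \<open>auto simp: emeasure_lborel_Icc_eq\<close>)
    moreover have "(\<lambda>x. indicator {a..b} x *\<^sub>R (indicator {a..b} x *\<^sub>R f x)) = (\<lambda>x. indicator {a..b} x * f x)"
      by (auto simp: indicator_def)
    ultimately show ?thesis by simp
  qed
  show "integrable lborel (\<lambda>x. indicator {a..b} x * upper M x)"
    using bd upper_mem[OF M(1) I] by (intro gen mu) auto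
  show "integrable lborel (\<lambda>x. indicator {a..b} x * lower M x)"
    using bd lower_mem[OF M(1) I] by (intro gen ml) auto
qed

text \<open>\<open>S\<close> may contain or omit each endpoint, as the half-open pieces of the
  chains do; endpoints are null. The value is the trapezoid rule.\<close>

lemma affine_integral:
  fixes a b \<alpha> \<beta> :: real
  assumes S: "{a<..<b} \<subseteq> S" "S \<subseteq> {a..b}" "S \<in> sets borel" and "a \<le> b"
  shows "integrable lborel (\<lambda>x. indicator S x * (\<alpha> + \<beta> * x))"
    and "(\<integral>x. indicator S x * (\<alpha> + \<beta> * x) \<partial>lborel) = (b - a) * ((\<alpha> + \<beta> * a) + (\<alpha> + \<beta> * b)) / 2"
proof -
  have "has_bochner_integral lborel (\<lambda>x. indicator {a..b} x *\<^sub>R (\<alpha> + \<beta> * x))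
    ((\<alpha> * b + \<beta> * b\<^sup>2 / 2) - (\<alpha> * a + \<beta> * a\<^sup>2 / 2))"
    by (intro has_bochner_integral_FTC_Icc assms continuous_intros)
      (auto intro!: derivative_eq_intros simp: has_real_derivative_iff_has_vector_derivative[symmetric])
  then have I: "has_bochner_integral lborel (\<lambda>x. indicator {a..b} x * (\<alpha> + \<beta> * x))
    ((\<alpha> * b + \<beta> * b\<^sup>2 / 2) - (\<alpha> * a + \<beta> * a\<^sup>2 / 2))" by simp
  have ae: "AE x in lborel. indicator {a..b} x * (\<alpha> + \<beta> * x) = indicator S x * (\<alpha> + \<beta> * x)"
    using AE_lborel_singleton[of a] AE_lborel_singleton[of b]
  proof eventually_elim
    case (elim x)
    then have "x \<in> {a..b} \<longleftrightarrow> x \<in> S" using S by force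
    then show ?case by (simp add: indicator_def)
  qed
  have m: "(\<lambda>x. indicator S x * (\<alpha> + \<beta> * x)) \<in> borel_measurable lborel" using S(3) by simp
  have I': "has_bochner_integral lborel (\<lambda>x. indicator S x * (\<alpha> + \<beta> * x))
    ((\<alpha> * b + \<beta> * b\<^sup>2 / 2) - (\<alpha> * a + \<beta> * a\<^sup>2 / 2))"
    using has_bochner_integral_cong_AE[OF borel_measurable_has_bochner_integral[OF I] m ae] I by blast
  then show "integrable lborel (\<lambda>x. indicator S x * (\<alpha> + \<beta> * x))" by (simp add: has_bochner_integral_iff)
  have "(\<integral>x. indicator S x * (\<alpha> + \<beta> * x) \<partial>lborel) = (\<alpha> * b + \<beta> * b\<^sup>2 / 2) - (\<alpha> * a + \<beta> * a\<^sup>2 / 2)"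
    using I' by (rule has_bochner_integral_integral_eq)
  also have "\<dots> = (b - a) * ((\<alpha> + \<beta> * a) + (\<alpha> + \<beta> * b)) / 2"
    by (simp add: field_simps power2_eq_square)
  finally show "(\<integral>x. indicator S x * (\<alpha> + \<beta> * x) \<partial>lborel) = (b - a) * ((\<alpha> + \<beta> * a) + (\<alpha> + \<beta> * b)) / 2" .
qed

section \<open>Cutting a convex body along two chords\<close>

lemma convex_point_between:
  fixes M :: "(real \<times> real) set"
  assumes "convex M" "(a, ya) \<in> M" "(x, y) \<in> M" "a < b \<and> b \<le> x \<or> x \<le> b \<and> b < a"
  shows "(b, ya + (y - ya) * ((b - a) / (x - a))) \<in> M"
proof -
  define t where "t = (b - a) / (x - a)"
  have t: "0 \<le> t" "t \<le> 1" using assms(4) unfolding t_def by (auto simp: divide_simps)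
  have tx: "t * (x - a) = b - a" using assms(4) unfolding t_def by auto
  have "(1 - t) *\<^sub>R (a, ya) + t *\<^sub>R (x, y) \<in> M"
    using assms(1-3) t unfolding convex_alt by blast
  moreover have "(1 - t) *\<^sub>R (a, ya) + t *\<^sub>R (x, y) = (b, ya + (y - ya) * t)"
    using tx by (simp add: algebra_simps)
  ultimately show ?thesis unfolding t_def by simp
qed

text \<open>To be used for \<open>L\<close>, \<open>M0\<close> and \<open>M1\<close> alike: fixing
  abscissas instead of points cuts all three at the same places. \<open>x1\<close>,
  \<open>x3\<close> refer to the upper and \<open>x2\<close>, \<open>x4\<close> to the lower
  boundary.\<close>

locale chain =
  fixes M :: "(real \<times> real) set" and x1 x2 x3 x4 :: real
  assumes M: "compact M" "convex M"
    and mem: "x1 \<in> fst ` M" "x2 \<in> fst ` M" "x3 \<in> fst ` M" "x4 \<in> fst ` M"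
    and le: "x1 \<le> x3" "x2 \<le> x4"
begin

abbreviation "g \<equiv> upper M"
abbreviation "f \<equiv> lower M"

definition "Q1 = (x1, g x1)"
definition "Q2 = (x2, f x2)"
definition "Q3 = (x3, g x3)"
definition "Q4 = (x4, f x4)"

text \<open>For \<open>x1 = x2\<close> the quotient is 0 by convention, but the chains then use
  \<open>lineL\<close> only on an empty interval; likewise \<open>lineR\<close>.\<close>

definition "lineL x = f x2 + (g x1 - f x2) * ((x - x2) / (x1 - x2))"
definition "lineR x = g x3 + (f x4 - g x3) * ((x - x3) / (x4 - x3))"

definition "xl = min x1 x2"
definition "xr = max x3 x4"

text \<open>On their intended ranges, \<open>top_chain\<close> and \<open>bottom_chain\<close> bound the part of \<open>M\<close>
  between the chords from \<open>Q2\<close> to \<open>Q1\<close> and from \<open>Q3\<close> to \<open>Q4\<close>. The chord \<open>Q2 Q1\<close>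
  belongs to the upper boundary if \<open>x2 < x1\<close> and to the lower one if \<open>x1 < x2\<close>.\<close>
definition "top_chain x = indicator {xl..<x1} x * lineL x + indicator {x1..x3} x * g x
  + indicator {x3<..xr} x * lineR x"
definition "bottom_chain x = indicator {xl..<x2} x * lineL x + indicator {x2..x4} x * f x
  + indicator {x4<..xr} x * lineR x"

definition "mid = {z. xl \<le> fst z \<and> fst z \<le> xr \<and> bottom_chain (fst z) \<le> snd z \<and> snd z \<le> top_chain (fst z)}"

text \<open>The trapezoids carry a sign: a chord on the top adds its trapezoid and one on the bottom
  subtracts it. This keeps the expression linear in the boundary functions, whatever the order of
  the abscissas.\<close>

definition "mid_area = (\<integral>x. indicator {x1..x3} x * g x \<partial>lborel) - (\<integral>x. indicator {x2..x4} x * f x \<partial>lborel)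
  + (x1 - x2) * (g x1 + f x2) / 2 + (x4 - x3) * (g x3 + f x4) / 2"

lemma Q_mem: "Q1 \<in> M" "Q2 \<in> M" "Q3 \<in> M" "Q4 \<in> M"
  unfolding Q1_def Q2_def Q3_def Q4_def using upper_mem lower_mem M(1) mem by auto

lemma f_le_g: "x \<in> fst ` M \<Longrightarrow> f x \<le> g x"
  using le_upper[OF M(1) lower_mem[OF M(1)]] .

lemma top_chain_cases:
  assumes "xl \<le> x" "x \<le> xr"
  shows "top_chain x = (if x < x1 then lineL x else if x \<le> x3 then g x else lineR x)"
  unfolding top_chain_def using assms le by (auto simp: indicator_def)

lemma bottom_chain_cases:
  assumes "xl \<le> x" "x \<le> xr"
  shows "bottom_chain x = (if x < x2 then lineL x else if x \<le> x4 then f x else lineR x)"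
  unfolding bottom_chain_def using assms le by (auto simp: indicator_def)

lemma lineL_ends: "x1 \<noteq> x2 \<Longrightarrow> lineL x1 = g x1" "lineL x2 = f x2"
  by (auto simp: lineL_def)

lemma lineR_ends: "x3 \<noteq> x4 \<Longrightarrow> lineR x4 = f x4" "lineR x3 = g x3"
  by (auto simp: lineR_def)

lemma lineL_mem:
  assumes "x2 < x \<and> x \<le> x1 \<or> x1 \<le> x \<and> x < x2" shows "(x, lineL x) \<in> M"
  using convex_point_between[OF M(2), of x2 "f x2" x1 "g x1" x] assms Q_mem
  unfolding Q1_def Q2_def lineL_def by auto

lemma lineR_mem:
  assumes "x3 < x \<and> x \<le> x4 \<or> x4 \<le> x \<and> x < x3" shows "(x, lineR x) \<in> M"
  using convex_point_between[OF M(2), of x3 "g x3" x4 "f x4" x] assms Q_mem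
  unfolding Q3_def Q4_def lineR_def by auto

lemma in_range: "xl \<le> x \<Longrightarrow> x \<le> xr \<Longrightarrow> x \<in> fst ` M"
  unfolding xl_def xr_def using fst_image_interval[OF M(2)] mem by (metis max_def min_def)

lemma lineL_affine: "lineL x = (f x2 - (g x1 - f x2) / (x1 - x2) * x2) + (g x1 - f x2) / (x1 - x2) * x"
  unfolding lineL_def by (simp add: algebra_simps diff_divide_distrib)

lemma lineR_affine: "lineR x = (g x3 - (f x4 - g x3) / (x4 - x3) * x3) + (f x4 - g x3) / (x4 - x3) * x"
  unfolding lineR_def by (simp add: algebra_simps diff_divide_distrib)

lemma left_chord_iff:
  "z \<in> left_of Q2 Q1 \<longleftrightarrow> (x1 - x2) * (snd z - f x2) - (g x1 - f x2) * (fst z - x2) > 0"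
  "x2 < x1 \<Longrightarrow> z \<in> left_of Q2 Q1 \<longleftrightarrow> lineL (fst z) < snd z"
  "x1 < x2 \<Longrightarrow> z \<in> left_of Q2 Q1 \<longleftrightarrow> snd z < lineL (fst z)"
proof -
  show *: "z \<in> left_of Q2 Q1 \<longleftrightarrow> (x1 - x2) * (snd z - f x2) - (g x1 - f x2) * (fst z - x2) > 0"
    by (simp add: left_of_def Q1_def Q2_def)
  have "(x1 - x2) * (snd z - f x2) - (g x1 - f x2) * (fst z - x2) = (x1 - x2) * (snd z - lineL (fst z))"
    if "x1 \<noteq> x2" using that by (simp add: lineL_def field_simps)
  then have eq: "z \<in> left_of Q2 Q1 \<longleftrightarrow> (x1 - x2) * (snd z - lineL (fst z)) > 0" if "x1 \<noteq> x2"
    using * that by presburger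
  show "z \<in> left_of Q2 Q1 \<longleftrightarrow> lineL (fst z) < snd z" if "x2 < x1"
    using eq that by (auto simp: zero_less_mult_iff)
  show "z \<in> left_of Q2 Q1 \<longleftrightarrow> snd z < lineL (fst z)" if "x1 < x2"
    using eq that by (auto simp: zero_less_mult_iff)
qed

lemma right_chord_iff:
  "z \<in> left_of Q3 Q4 \<longleftrightarrow> (x4 - x3) * (snd z - g x3) - (f x4 - g x3) * (fst z - x3) > 0"
  "x3 < x4 \<Longrightarrow> z \<in> left_of Q3 Q4 \<longleftrightarrow> lineR (fst z) < snd z"
  "x4 < x3 \<Longrightarrow> z \<in> left_of Q3 Q4 \<longleftrightarrow> snd z < lineR (fst z)"
proof -
  show *: "z \<in> left_of Q3 Q4 \<longleftrightarrow> (x4 - x3) * (snd z - g x3) - (f x4 - g x3) * (fst z - x3) > 0"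
    by (simp add: left_of_def Q3_def Q4_def)
  have "(x4 - x3) * (snd z - g x3) - (f x4 - g x3) * (fst z - x3) = (x4 - x3) * (snd z - lineR (fst z))"
    if "x4 \<noteq> x3" using that by (simp add: lineR_def field_simps)
  then have eq: "z \<in> left_of Q3 Q4 \<longleftrightarrow> (x4 - x3) * (snd z - lineR (fst z)) > 0" if "x4 \<noteq> x3"
    using * that by presburger
  show "z \<in> left_of Q3 Q4 \<longleftrightarrow> lineR (fst z) < snd z" if "x3 < x4"
    using eq that by (auto simp: zero_less_mult_iff)
  show "z \<in> left_of Q3 Q4 \<longleftrightarrow> snd z < lineR (fst z)" if "x4 < x3"
    using eq that by (auto simp: zero_less_mult_iff)
qed

text \<open>Suppose a point of \<open>M\<close> beyond both abscissas lay on the outer side. The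
  segment joining it to \<open>Q2\<close> would then pass above the top at \<open>x1\<close>, or the
  one joining it to \<open>Q1\<close> below the bottom at \<open>x2\<close>; for a vertical chord
  the sign is immediate.\<close>

lemma left_chord_bound:
  assumes z: "z \<in> M" "z \<in> left_of Q2 Q1" shows "fst z < max x1 x2"
proof (rule ccontr)
  assume "\<not> ?thesis"
  then have x: "x1 \<le> fst z" "x2 \<le> fst z" by auto
  have zM: "(fst z, snd z) \<in> M" using z by simp
  consider "x1 = x2" | "x2 < x1" | "x1 < x2" by linarith
  then show False
  proof cases
    case 1
    have "(g x1 - f x2) * (fst z - x2) \<ge> 0" using f_le_g[OF mem(1)] x 1 by simp
    then show False using z(2) 1 unfolding left_chord_iff(1) by simp
  next
    case 2
    have "(x1, f x2 + (snd z - f x2) * ((x1 - x2) / (fst z - x2))) \<in> M"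
      using Q_mem(2) 2 x zM unfolding Q2_def by (intro convex_point_between[OF M(2)]) auto
    from le_upper[OF M(1) this] have "(snd z - f x2) * (x1 - x2) / (fst z - x2) \<le> g x1 - f x2" by simp
    then have "(snd z - f x2) * (x1 - x2) \<le> (g x1 - f x2) * (fst z - x2)"
      using 2 x by (simp add: pos_divide_le_eq)
    then show False using z(2) unfolding left_chord_iff(1) by (simp add: mult.commute)
  next
    case 3
    have "(x2, g x1 + (snd z - g x1) * ((x2 - x1) / (fst z - x1))) \<in> M"
      using Q_mem(1) 3 x zM unfolding Q1_def by (intro convex_point_between[OF M(2)]) auto
    from lower_le[OF M(1) this] have "f x2 - g x1 \<le> (snd z - g x1) * (x2 - x1) / (fst z - x1)" by simp
    then have "(f x2 - g x1) * (fst z - x1) \<le> (snd z - g x1) * (x2 - x1)"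
      using 3 x by (simp add: pos_le_divide_eq)
    moreover have "(x1 - x2) * (snd z - f x2) - (g x1 - f x2) * (fst z - x2)
      = (f x2 - g x1) * (fst z - x1) - (snd z - g x1) * (x2 - x1)" by algebra
    ultimately show False using z(2) unfolding left_chord_iff(1) by linarith
  qed
qed

lemma right_chord_bound:
  assumes z: "z \<in> M" "z \<in> left_of Q3 Q4" shows "min x3 x4 < fst z"
proof (rule ccontr)
  assume "\<not> ?thesis"
  then have x: "fst z \<le> x3" "fst z \<le> x4" by auto
  have zM: "(fst z, snd z) \<in> M" using z by simp
  consider "x3 = x4" | "x3 < x4" | "x4 < x3" by linarith
  then show False
  proof cases
    case 1
    have "(g x3 - f x4) * (x3 - fst z) \<ge> 0" using f_le_g[OF mem(3)] x 1 by simp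
    moreover have "(f x4 - g x3) * (fst z - x3) = (g x3 - f x4) * (x3 - fst z)" by algebra
    ultimately show False using z(2) 1 unfolding right_chord_iff(1) by simp
  next
    case 2
    have "(x3, f x4 + (snd z - f x4) * ((x3 - x4) / (fst z - x4))) \<in> M"
      using Q_mem(4) 2 x zM unfolding Q4_def by (intro convex_point_between[OF M(2)]) auto
    from le_upper[OF M(1) this] have "(snd z - f x4) * ((x3 - x4) / (fst z - x4)) \<le> g x3 - f x4" by simp
    moreover have "(x3 - x4) / (fst z - x4) = (x4 - x3) / (x4 - fst z)"
      by (metis minus_diff_eq minus_divide_divide)
    ultimately have "(snd z - f x4) * (x4 - x3) / (x4 - fst z) \<le> g x3 - f x4" by simp
    then have "(snd z - f x4) * (x4 - x3) \<le> (g x3 - f x4) * (x4 - fst z)"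
      using 2 x by (simp add: pos_divide_le_eq)
    moreover have "(x4 - x3) * (snd z - g x3) - (f x4 - g x3) * (fst z - x3)
      = (snd z - f x4) * (x4 - x3) - (g x3 - f x4) * (x4 - fst z)" by algebra
    ultimately show False using z(2) unfolding right_chord_iff(1) by linarith
  next
    case 3
    have "(x4, g x3 + (snd z - g x3) * ((x4 - x3) / (fst z - x3))) \<in> M"
      using Q_mem(3) 3 x zM unfolding Q3_def by (intro convex_point_between[OF M(2)]) auto
    from lower_le[OF M(1) this] have "f x4 - g x3 \<le> (snd z - g x3) * ((x4 - x3) / (fst z - x3))" by simp
    moreover have "(x4 - x3) / (fst z - x3) = (x3 - x4) / (x3 - fst z)"
      by (metis minus_diff_eq minus_divide_divide)
    ultimately have "f x4 - g x3 \<le> (snd z - g x3) * (x3 - x4) / (x3 - fst z)" by simp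
    then have "(f x4 - g x3) * (x3 - fst z) \<le> (snd z - g x3) * (x3 - x4)"
      using 3 x by (simp add: pos_le_divide_eq)
    moreover have "(x4 - x3) * (snd z - g x3) - (f x4 - g x3) * (fst z - x3)
      = (f x4 - g x3) * (x3 - fst z) - (snd z - g x3) * (x3 - x4)" by algebra
    ultimately show False using z(2) unfolding right_chord_iff(1) by linarith
  qed
qed

text \<open>If the abscissa ranges of the chords overlap, one chord bounds the middle part from
  above and the other from below. Both lines are affine, so they need comparing only at the ends of
  the overlap, where one of them takes a boundary value of \<open>M\<close> and the other the
  ordinate of a point of \<open>M\<close>.\<close>

lemma lines_compare:
  "x4 < x1 \<Longrightarrow> x4 \<le> x \<Longrightarrow> x \<le> x1 \<Longrightarrow> lineR x \<le> lineL x"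
  "x3 < x2 \<Longrightarrow> x3 \<le> x \<Longrightarrow> x \<le> x2 \<Longrightarrow> lineL x \<le> lineR x"
proof -
  have aff: "(b - a) * (A + B * x) \<le> (b - a) * (C + D * x)"
    if "a \<le> x" "x \<le> b" "A + B * a \<le> C + D * a" "A + B * b \<le> C + D * b" for a b A B C D x :: real
  proof -
    have "(b - x) * (A + B * a) \<le> (b - x) * (C + D * a)" "(x - a) * (A + B * b) \<le> (x - a) * (C + D * b)"
      using that by (auto intro: mult_left_mono)
    moreover have "(b - a) * (A + B * x) = (b - x) * (A + B * a) + (x - a) * (A + B * b)"
      "(b - a) * (C + D * x) = (b - x) * (C + D * a) + (x - a) * (C + D * b)"
      by algebra+
    ultimately show ?thesis by linarith
  qed
  show "lineR x \<le> lineL x" if a: "x4 < x1" "x4 \<le> x" "x \<le> x1"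
  proof -
    have "lineR x4 \<le> lineL x4"
    proof (cases "x4 = x2")
      case False
      then have "(x4, lineL x4) \<in> M" using a le by (intro lineL_mem) auto
      then show ?thesis using lower_le[OF M(1)] lineR_ends a le by auto
    qed (use lineL_ends lineR_ends a le in auto)
    moreover have "lineR x1 \<le> lineL x1"
    proof (cases "x1 = x3")
      case False
      then have "(x1, lineR x1) \<in> M" using a le by (intro lineR_mem) auto
      then show ?thesis using le_upper[OF M(1)] lineL_ends a le by auto
    qed (use lineL_ends lineR_ends a le in auto)
    ultimately have "(x1 - x4) * lineR x \<le> (x1 - x4) * lineL x"
      using a unfolding lineL_affine lineR_affine by (intro aff) auto
    then show ?thesis using a by simp
  qed
  show "lineL x \<le> lineR x" if a: "x3 < x2" "x3 \<le> x" "x \<le> x2"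
  proof -
    have "lineL x3 \<le> lineR x3"
    proof (cases "x3 = x1")
      case False
      then have "(x3, lineL x3) \<in> M" using a le by (intro lineL_mem) auto
      then show ?thesis using le_upper[OF M(1)] lineR_ends a le by auto
    qed (use lineL_ends lineR_ends a le in auto)
    moreover have "lineL x2 \<le> lineR x2"
    proof (cases "x2 = x4")
      case False
      then have "(x2, lineR x2) \<in> M" using a le by (intro lineR_mem) auto
      then show ?thesis using lower_le[OF M(1)] lineL_ends a le by auto
    qed (use lineL_ends lineR_ends a le in auto)
    ultimately have "(x2 - x3) * lineL x \<le> (x2 - x3) * lineR x"
      using a unfolding lineL_affine lineR_affine by (intro aff) auto
    then show ?thesis using a by simp
  qed
qed

lemma lineL_between:
  assumes "xl \<le> x" "x < max x1 x2" shows "f x \<le> lineL x" "lineL x \<le> g x"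
proof -
  have "f x \<le> lineL x \<and> lineL x \<le> g x"
  proof (cases "x = x2")
    case True
    then show ?thesis using lineL_ends(2) f_le_g[OF mem(2)] by simp
  next
    case False
    then have "(x, lineL x) \<in> M" using assms unfolding xl_def by (intro lineL_mem) auto
    then show ?thesis using le_upper[OF M(1)] lower_le[OF M(1)] by auto
  qed
  then show "f x \<le> lineL x" "lineL x \<le> g x" by auto
qed

lemma lineR_between:
  assumes "min x3 x4 < x" "x \<le> xr" shows "f x \<le> lineR x" "lineR x \<le> g x"
proof -
  have "f x \<le> lineR x \<and> lineR x \<le> g x"
  proof (cases "x = x3")
    case True
    then show ?thesis using lineR_ends(2) f_le_g[OF mem(3)] by simp
  next
    case False
    then have "(x, lineR x) \<in> M" using assms unfolding xr_def by (intro lineR_mem) auto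
    then show ?thesis using le_upper[OF M(1)] lower_le[OF M(1)] by auto
  qed
  then show "f x \<le> lineR x" "lineR x \<le> g x" by auto
qed

lemma chain_bounds:
  assumes x: "xl \<le> x" "x \<le> xr"
  shows "top_chain x \<le> g x" "f x \<le> bottom_chain x" "bottom_chain x \<le> top_chain x"
proof -
  have m: "min x3 x4 < x" if "x3 < x \<or> x4 < x" using that by auto
  have m': "x < max x1 x2" if "x < x1 \<or> x < x2" using that by auto
  note L = lineL_between[OF x(1) m'] and R = lineR_between[OF m x(2)]
  show "top_chain x \<le> g x" using L R unfolding top_chain_cases[OF x] by auto
  show "f x \<le> bottom_chain x" using L R unfolding bottom_chain_cases[OF x] by auto
  show "bottom_chain x \<le> top_chain x"
    unfolding top_chain_cases[OF x] bottom_chain_cases[OF x]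
    using L R lines_compare[of x] le x f_le_g[OF in_range[OF x]] unfolding xl_def xr_def
    by (auto simp: min_def max_def split: if_splits)
qed

lemma mid_subset: "mid \<subseteq> M"
proof
  fix z assume "z \<in> mid"
  then have z: "xl \<le> fst z" "fst z \<le> xr" "bottom_chain (fst z) \<le> snd z" "snd z \<le> top_chain (fst z)"
    by (auto simp: mid_def)
  have x: "fst z \<in> fst ` M" using in_range z by simp
  have y: "f (fst z) \<le> snd z" "snd z \<le> g (fst z)" using chain_bounds[OF z(1,2)] z(3,4) by linarith+
  have "snd z \<in> closed_segment (f (fst z)) (g (fst z))"
    using y by (simp add: closed_segment_eq_real_ivl)
  then obtain t where t: "0 \<le> t" "t \<le> 1" "snd z = (1 - t) * f (fst z) + t * g (fst z)"
    by (auto simp: in_segment)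
  have "(1 - t) *\<^sub>R (fst z, f (fst z)) + t *\<^sub>R (fst z, g (fst z)) \<in> M"
    using lower_mem[OF M(1) x] upper_mem[OF M(1) x] M(2) t(1,2) unfolding convex_alt by blast
  moreover have "(1 - t) *\<^sub>R (fst z, f (fst z)) + t *\<^sub>R (fst z, g (fst z)) = z"
    using t(3) by (simp add: prod_eq_iff algebra_simps)
  ultimately show "z \<in> M" by simp
qed

lemma mid_disjoint: "mid \<inter> left_of Q2 Q1 = {}" "mid \<inter> left_of Q3 Q4 = {}"
proof -
  have "False" if z: "z \<in> mid" "z \<in> left_of Q2 Q1" for z
  proof -
    have zm: "xl \<le> fst z" "fst z \<le> xr" "bottom_chain (fst z) \<le> snd z" "snd z \<le> top_chain (fst z)"
      using z(1) by (auto simp: mid_def)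
    have "fst z < max x1 x2" using left_chord_bound[OF subsetD[OF mid_subset z(1)] z(2)] .
    then show False
      using zm(3,4) left_chord_iff(2,3)[of z] z(2) zm(1) top_chain_cases[OF zm(1,2)] bottom_chain_cases[OF zm(1,2)]
      unfolding xl_def by (cases x1 x2 rule: linorder_cases) auto
  qed
  then show "mid \<inter> left_of Q2 Q1 = {}" by blast
  have "False" if z: "z \<in> mid" "z \<in> left_of Q3 Q4" for z
  proof -
    have zm: "xl \<le> fst z" "fst z \<le> xr" "bottom_chain (fst z) \<le> snd z" "snd z \<le> top_chain (fst z)"
      using z(1) by (auto simp: mid_def)
    have "min x3 x4 < fst z" using right_chord_bound[OF subsetD[OF mid_subset z(1)] z(2)] .
    then show False
      using zm(3,4) right_chord_iff(2,3)[of z] z(2) zm(2) top_chain_cases[OF zm(1,2)] bottom_chain_cases[OF zm(1,2)] le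
      unfolding xr_def by (cases x3 x4 rule: linorder_cases) (auto split: if_splits)
  qed
  then show "mid \<inter> left_of Q3 Q4 = {}" by blast
qed

lemma chords_disjoint: "M \<inter> left_of Q2 Q1 \<inter> left_of Q3 Q4 = {}"
proof -
  have False if z: "z \<in> M" "z \<in> left_of Q2 Q1" "z \<in> left_of Q3 Q4" for z
  proof -
    note b = left_chord_bound[OF z(1,2)] right_chord_bound[OF z(1,3)]
    consider "x1 = x2" | "x2 < x1" | "x1 < x2" by linarith
    then show False
    proof cases
      case 1 then show False using b le by auto
    next
      case 2
      then have s: "lineL (fst z) < snd z" using left_chord_iff(2) z(2) by simp
      from 2 have a: "x4 < x3" "x4 < fst z" "fst z < x1" using b le by (auto simp: min_def split: if_splits)
      then have "snd z < lineR (fst z)" using right_chord_iff(3) z(3) by simp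
      then show False using lines_compare(1)[of "fst z"] a s by linarith
    next
      case 3
      then have s: "snd z < lineL (fst z)" using left_chord_iff(3) z(2) by simp
      from 3 have a: "x3 < x4" "x3 < fst z" "fst z < x2" using b le by (auto simp: min_def split: if_splits)
      then have "lineR (fst z) < snd z" using right_chord_iff(2) z(3) by simp
      then show False using lines_compare(2)[of "fst z"] a s by linarith
    qed
  qed
  then show ?thesis by blast
qed

lemma chain_integrals:
  "integrable lborel top_chain" "integrable lborel bottom_chain"
  "(\<integral>x. top_chain x \<partial>lborel) - (\<integral>x. bottom_chain x \<partial>lborel) = mid_area"
proof -
  have l: "integrable lborel (\<lambda>x. indicator {xl..<b} x * lineL x) \<and>
    (\<integral>x. indicator {xl..<b} x * lineL x \<partial>lborel) = (b - xl) * (g x1 + f x2) / 2" if "b \<in> {x1, x2}" for b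
  proof (cases "b = xl")
    case False
    then have ne: "x1 \<noteq> x2" "xl \<le> b" using that unfolding xl_def by auto
    then have e: "lineL xl + lineL b = g x1 + f x2"
      using lineL_ends that False unfolding xl_def by (auto simp: min_def split: if_splits)
    have "integrable lborel (\<lambda>x. indicator {xl..<b} x * lineL x) \<and>
      (\<integral>x. indicator {xl..<b} x * lineL x \<partial>lborel) = (b - xl) * (lineL xl + lineL b) / 2"
      unfolding lineL_affine using ne by (intro conjI affine_integral) auto
    then show ?thesis unfolding e .
  qed simp
  have r: "integrable lborel (\<lambda>x. indicator {b<..xr} x * lineR x) \<and>
    (\<integral>x. indicator {b<..xr} x * lineR x \<partial>lborel) = (xr - b) * (g x3 + f x4) / 2" if "b \<in> {x3, x4}" for b
  proof (cases "b = xr")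
    case False
    then have ne: "x3 \<noteq> x4" "b \<le> xr" using that unfolding xr_def by auto
    then have e: "lineR b + lineR xr = g x3 + f x4"
      using lineR_ends that False unfolding xr_def by (auto simp: max_def split: if_splits)
    have "integrable lborel (\<lambda>x. indicator {b<..xr} x * lineR x) \<and>
      (\<integral>x. indicator {b<..xr} x * lineR x \<partial>lborel) = (xr - b) * (lineR b + lineR xr) / 2"
      unfolding lineR_affine using ne by (intro conjI affine_integral) auto
    then show ?thesis unfolding e .
  qed simp
  have l1: "integrable lborel (\<lambda>x. indicator {xl..<x1} x * lineL x)"
    "(\<integral>x. indicator {xl..<x1} x * lineL x \<partial>lborel) = (x1 - xl) * (g x1 + f x2) / 2"
    and l2: "integrable lborel (\<lambda>x. indicator {xl..<x2} x * lineL x)"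
    "(\<integral>x. indicator {xl..<x2} x * lineL x \<partial>lborel) = (x2 - xl) * (g x1 + f x2) / 2"
    and r3: "integrable lborel (\<lambda>x. indicator {x3<..xr} x * lineR x)"
    "(\<integral>x. indicator {x3<..xr} x * lineR x \<partial>lborel) = (xr - x3) * (g x3 + f x4) / 2"
    and r4: "integrable lborel (\<lambda>x. indicator {x4<..xr} x * lineR x)"
    "(\<integral>x. indicator {x4<..xr} x * lineR x \<partial>lborel) = (xr - x4) * (g x3 + f x4) / 2"
    using l r by simp_all
  note u = upper_lower_integrable(1)[OF M mem(1,3)] and v = upper_lower_integrable(2)[OF M mem(2,4)]
  show "integrable lborel top_chain" unfolding top_chain_def[abs_def]
    by (intro Bochner_Integration.integrable_add l1 u r3)
  show "integrable lborel bottom_chain" unfolding bottom_chain_def[abs_def]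
    by (intro Bochner_Integration.integrable_add l2 v r4)
  have "(\<integral>x. top_chain x \<partial>lborel) = (x1 - xl) * (g x1 + f x2) / 2
    + (\<integral>x. indicator {x1..x3} x * g x \<partial>lborel) + (xr - x3) * (g x3 + f x4) / 2"
    unfolding top_chain_def
    by (subst Bochner_Integration.integral_add, (intro Bochner_Integration.integrable_add l1 u r3)+)+
      (simp add: l1 r3)
  moreover have "(\<integral>x. bottom_chain x \<partial>lborel) = (x2 - xl) * (g x1 + f x2) / 2
    + (\<integral>x. indicator {x2..x4} x * f x \<partial>lborel) + (xr - x4) * (g x3 + f x4) / 2"
    unfolding bottom_chain_def
    by (subst Bochner_Integration.integral_add, (intro Bochner_Integration.integrable_add l2 v r4)+)+
      (simp add: l2 r4)
  ultimately show "(\<integral>x. top_chain x \<partial>lborel) - (\<integral>x. bottom_chain x \<partial>lborel) = mid_area"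
    unfolding mid_area_def by (simp add: field_simps)
qed

lemma mid_measurable: "mid \<in> sets borel"
proof -
  have m: "top_chain \<in> borel_measurable borel" "bottom_chain \<in> borel_measurable borel"
    using borel_measurable_integrable[OF chain_integrals(1)] borel_measurable_integrable[OF chain_integrals(2)]
    by simp_all
  have f: "(fst :: real \<times> real \<Rightarrow> real) \<in> borel_measurable borel" "(snd :: real \<times> real \<Rightarrow> real) \<in> borel_measurable borel"
    by (intro borel_measurable_continuous_onI continuous_intros)+
  have "{z \<in> space borel. xl \<le> fst z \<and> fst z \<le> xr \<and> bottom_chain (fst z) \<le> snd z \<and> snd z \<le> top_chain (fst z)} \<in> sets borel"
    by (intro sets.sets_Collect borel_measurable_le f measurable_compose[OF f(1) m(1)] measurable_compose[OF f(1) m(2)]) auto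
  then show ?thesis by (simp add: mid_def)
qed

lemma emeasure_mid: "emeasure lborel mid = ennreal mid_area" "0 \<le> mid_area"
proof -
  have nn: "0 \<le> top_chain x - bottom_chain x" for x
  proof (cases "xl \<le> x \<and> x \<le> xr")
    case True then show ?thesis using chain_bounds(3) by simp
  next
    case False
    then have "top_chain x = 0" "bottom_chain x = 0"
      using le unfolding top_chain_def bottom_chain_def xl_def xr_def
      by (auto simp: indicator_def min_def max_def split: if_splits)
    then show ?thesis by simp
  qed
  have "emeasure lborel mid = (\<integral>\<^sup>+x. emeasure lborel (Pair x -` mid) \<partial>lborel)"
    by (rule emeasure_lborel_fibres[OF mid_measurable])
  also have "\<dots> = (\<integral>\<^sup>+x. ennreal (top_chain x - bottom_chain x) \<partial>lborel)"
  proof (rule nn_integral_cong)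
    fix x
    show "emeasure lborel (Pair x -` mid) = ennreal (top_chain x - bottom_chain x)"
    proof (cases "xl \<le> x \<and> x \<le> xr")
      case True
      then have "Pair x -` mid = {bottom_chain x..top_chain x}" by (auto simp: mid_def)
      then show ?thesis using nn[of x] by simp
    next
      case False
      then have "top_chain x = 0" "bottom_chain x = 0"
        using le unfolding top_chain_def bottom_chain_def xl_def xr_def
        by (auto simp: indicator_def min_def max_def split: if_splits)
      moreover have "Pair x -` mid = {}" using False by (auto simp: mid_def)
      ultimately show ?thesis by simp
    qed
  qed
  also have "\<dots> = ennreal (\<integral>x. top_chain x - bottom_chain x \<partial>lborel)"
    using nn by (intro nn_integral_eq_integral Bochner_Integration.integrable_diff chain_integrals) auto
  also have I: "(\<integral>x. top_chain x - bottom_chain x \<partial>lborel) = mid_area"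
    using chain_integrals by simp
  finally show "emeasure lborel mid = ennreal mid_area" .
  show "0 \<le> mid_area" unfolding I[symmetric] using nn by (intro integral_nonneg_AE) auto
qed

end

section \<open>Areas of hulls cut along two chords\<close>

lemma seg_area_nonneg: "0 \<le> r \<Longrightarrow> r \<le> 1 \<Longrightarrow> 0 \<le> seg_area r"
  using seg_area_tangent[of 0 r] by simp

lemma sqdist_le_4:
  assumes "sqdist p c \<le> 1" "sqdist q c \<le> 1" shows "sqdist p q \<le> 4"
proof -
  have "sqdist p q + (fst p + fst q - 2 * fst c)\<^sup>2 + (snd p + snd q - 2 * snd c)\<^sup>2
    = 2 * sqdist p c + 2 * sqdist q c"
    unfolding sqdist_def by algebra
  moreover have "0 \<le> (fst p + fst q - 2 * fst c)\<^sup>2" "0 \<le> (snd p + snd q - 2 * snd c)\<^sup>2" by simp_all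
  ultimately show ?thesis using assms by linarith
qed

lemma half_chord_le_1: "sqdist p q \<le> 4 \<Longrightarrow> sqrt (sqdist p q) / 2 \<le> 1"
  using real_sqrt_le_mono[of "sqdist p q" 4] by simp

lemma sqdist_nonneg [simp]: "0 \<le> sqdist p q"
  by (simp add: sqdist_def)

lemma sqdist_same [simp]: "sqdist p p = 0"
  by (simp add: sqdist_def)

definition chord_seg :: "real \<times> real \<Rightarrow> real \<times> real \<Rightarrow> real" where
  "chord_seg p q = seg_area (sqrt (sqdist p q) / 2)"

lemma chord_seg_nonneg: "sqdist p q \<le> 4 \<Longrightarrow> 0 \<le> chord_seg p q"
  unfolding chord_seg_def by (intro seg_area_nonneg half_chord_le_1) auto

lemma unit_disk_measurable: "unit_disk c \<in> sets borel"
  unfolding unit_disk_eq_cball by simp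

text \<open>Valid for any two points of any hull; only the matching upper bound depends on the shape
  of the end.\<close>

lemma emeasure_left_of_ge:
  assumes M: "M = bdual K" and k: "k \<in> K" and pq: "p \<in> M" "q \<in> M"
  shows "ennreal (chord_seg p q) \<le> emeasure lborel (M \<inter> left_of p q)"
proof (cases "p = q")
  case True
  then show ?thesis by (simp add: chord_seg_def)
next
  case False
  have "sqdist p k \<le> 1" "sqdist q k \<le> 1" using pq k M by (auto simp: bdual_def sqdist_commute)
  then interpret chord p q by unfold_locales (use False sqdist_le_4 in auto)
  have "K \<subseteq> bdual {p, q}" using pq M by (auto simp: bdual_def sqdist_commute)
  then have "unit_disk center \<inter> left_of p q \<subseteq> M \<inter> left_of p q"
    using cap_subset_bdual M by blast
  then have "emeasure lborel (unit_disk center \<inter> left_of p q) \<le> emeasure lborel (M \<inter> left_of p q)"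
    by (intro emeasure_mono) (auto simp: M left_of_measurable closed_bdual borel_closed)
  then show ?thesis unfolding emeasure_cap by (simp add: chord_seg_def r_def)
qed

lemma emeasure_left_of_le:
  assumes L: "L \<subseteq> unit_disk c" and c: "sqdist p c = 1" "sqdist q c = 1" "c \<notin> left_of p q"
    and "p \<noteq> q"
  shows "emeasure lborel (L \<inter> left_of p q) \<le> ennreal (chord_seg p q)"
proof -
  interpret chord p q by unfold_locales (use assms sqdist_le_4[of p c q] in auto)
  have "L \<inter> left_of p q \<subseteq> unit_disk center \<inter> left_of p q"
    using L center_unique[OF c] by auto
  then have "emeasure lborel (L \<inter> left_of p q) \<le> emeasure lborel (unit_disk center \<inter> left_of p q)"
    by (intro emeasure_mono) (auto simp: unit_disk_measurable left_of_measurable)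
  then show ?thesis unfolding emeasure_cap by (simp add: chord_seg_def r_def)
qed

text \<open>For \<open>\<sigma> = 1\<close> (\<open>\<sigma> = - 1\<close>), the left (right) end of \<open>L\<close> is either a single point, or an
  arc of a unit circle around \<open>c\<close>, at most a half circle, from \<open>q'\<close> on the lower half to \<open>q\<close> on
  the upper half.\<close>
definition end_data :: "real \<Rightarrow> (real \<times> real) set \<Rightarrow> real \<times> real \<Rightarrow> real \<times> real \<Rightarrow> bool" where
  "end_data \<sigma> L q q' \<longleftrightarrow> q = q' \<and> (\<forall>z\<in>L. \<sigma> * fst q \<le> \<sigma> * fst z) \<or>
    (\<exists>c. L \<subseteq> unit_disk c \<and> sqdist q c = 1 \<and> sqdist q' c = 1 \<and> snd q' \<le> snd c \<and> snd c \<le> snd q \<and>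
      \<sigma> * ((fst q - fst c) * (snd q' - snd c) - (snd q - snd c) * (fst q' - fst c)) > 0 \<and>
      (fst c - \<sigma>, snd c) \<in> L)"

lemma end_data_sqdist_le_4: "end_data \<sigma> L q q' \<Longrightarrow> sqdist q q' \<le> 4"
  unfolding end_data_def by (metis order_refl sqdist_le_4 sqdist_same zero_le_numeral)

section \<open>Geometry of arc-shaped ends\<close>

lemma end_data_chord:
  assumes "end_data 1 L q q' \<and> s = q' \<and> t = q \<or> end_data (- 1) L q q' \<and> s = q \<and> t = q'" "q \<noteq> q'"
  obtains c where "L \<subseteq> unit_disk c" "sqdist s c = 1" "sqdist t c = 1" "c \<notin> left_of s t"
    "snd q' \<le> snd c" "snd c \<le> snd q"
proof -
  obtain c \<sigma> where c: "L \<subseteq> unit_disk c" "sqdist q c = 1" "sqdist q' c = 1" "snd q' \<le> snd c" "snd c \<le> snd q"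
    "\<sigma> * ((fst q - fst c) * (snd q' - snd c) - (snd q - snd c) * (fst q' - fst c)) > 0"
    "\<sigma> = 1 \<and> s = q' \<and> t = q \<or> \<sigma> = - 1 \<and> s = q \<and> t = q'"
    using assms unfolding end_data_def by metis
  have "(fst q - fst q') * (snd c - snd q') - (snd q - snd q') * (fst c - fst q')
    = - ((fst q - fst c) * (snd q' - snd c) - (snd q - snd c) * (fst q' - fst c))"
    "(fst q' - fst q) * (snd c - snd q) - (snd q' - snd q) * (fst c - fst q)
    = (fst q - fst c) * (snd q' - snd c) - (snd q - snd c) * (fst q' - fst c)"
    by algebra+
  then have "c \<notin> left_of s t" using c(6,7) unfolding left_of_def by auto
  then show thesis using that[OF c(1)] c by auto
qed

lemma emeasure_end_cap_le:
  assumes "end_data 1 L q q' \<and> s = q' \<and> t = q \<or> end_data (- 1) L q q' \<and> s = q \<and> t = q'"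
  shows "emeasure lborel (L \<inter> left_of s t) \<le> ennreal (chord_seg s t)"
proof (cases "q = q'")
  case True
  then have "s = t" using assms by auto
  then show ?thesis by simp
next
  case False
  then have "s \<noteq> t" using assms by auto
  obtain c where "L \<subseteq> unit_disk c" "sqdist s c = 1" "sqdist t c = 1" "c \<notin> left_of s t"
    using end_data_chord[OF assms False] by metis
  then show ?thesis by (rule emeasure_left_of_le) fact
qed

text \<open>The arc runs counterclockwise from an upper point to a lower one, over the left extreme.
  If a point to the right of the chord had smaller abscissa than both ends, the slant of the chord
  would push it past one end in height as well; that end has negative abscissa by the cross product
  condition, so the point would exceed it in both absolute coordinates and leave the disk.\<close>

lemma arc_extreme:
  fixes a b a1 b1 a2 b2 :: real
  assumes u: "a1\<^sup>2 + b1\<^sup>2 = 1" "a2\<^sup>2 + b2\<^sup>2 = 1" "b1 \<ge> 0" "b2 \<le> 0" "a1 * b2 - b1 * a2 > 0"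
    and z: "a\<^sup>2 + b\<^sup>2 \<le> 1" "(a1 - a2) * (b - b2) - (b1 - b2) * (a - a2) \<le> 0"
  shows "min a1 a2 \<le> a"
proof (rule ccontr)
  assume "\<not> ?thesis"
  then have a: "a < a1" "a < a2" by auto
  have out: False if "\<bar>v\<bar> < \<bar>a\<bar>" "\<bar>w\<bar> < \<bar>b\<bar>" "v\<^sup>2 + w\<^sup>2 = 1" for v w
  proof -
    have "v\<^sup>2 < a\<^sup>2" "w\<^sup>2 < b\<^sup>2" 
      using that(1,2) power_strict_mono[of "\<bar>v\<bar>" "\<bar>a\<bar>" 2] power_strict_mono[of "\<bar>w\<bar>" "\<bar>b\<bar>" 2]
      by simp_all
    then show False using z(1) that(3) by linarith
  qed
  have "b1 \<noteq> b2"
  proof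
    assume "b1 = b2"
    then have "b1 = 0" "b2 = 0" using u by auto
    then show False using u(5) by simp
  qed
  then have b: "b1 - b2 > 0" using u by linarith
  consider "a1 = a2" | "a2 < a1" | "a1 < a2" by linarith
  then show False
  proof cases
    case 1
    have "(b1 - b2) * (a2 - a) > 0" using b a by simp
    then show False using z(2) 1 by (simp add: algebra_simps)
  next
    case 2
    have "(b1 - b2) * a2 < (a1 - a2) * b2" using u(5) by (simp add: algebra_simps)
    also have "\<dots> \<le> 0" using 2 u by (simp add: mult_nonneg_nonpos)
    finally have "a2 < 0" using b by (simp add: mult_less_0_iff)
    moreover have "(b1 - b2) * (a2 - a) > 0" using b a by simp
    then have "(a1 - a2) * (b2 - b) > 0" using z(2) by (simp add: algebra_simps)
    then have "b < b2" using 2 by (simp add: zero_less_mult_iff)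
    ultimately show False using out[of a2 b2] u a by auto
  next
    case 3
    have "(b1 - b2) * a1 < (a1 - a2) * b1" using u(5) by (simp add: algebra_simps)
    also have "\<dots> \<le> 0" using 3 u by (simp add: mult_nonpos_nonneg)
    finally have "a1 < 0" using b by (simp add: mult_less_0_iff)
    moreover have "(b1 - b2) * (a1 - a) > 0" using b a by simp
    then have "(a2 - a1) * (b - b1) > 0" using z(2) by (simp add: algebra_simps)
    then have "b1 < b" using 3 by (simp add: zero_less_mult_iff)
    ultimately show False using out[of a1 b1] u a by auto
  qed
qed

lemma end_data_extreme:
  assumes z: "z \<in> L"
  shows "end_data 1 L q q' \<Longrightarrow> z \<notin> left_of q' q \<Longrightarrow> min (fst q) (fst q') \<le> fst z"
    and "end_data (- 1) L q q' \<Longrightarrow> z \<notin> left_of q q' \<Longrightarrow> fst z \<le> max (fst q) (fst q')"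
proof -
  assume e: "end_data 1 L q q'" and nl: "z \<notin> left_of q' q"
  show "min (fst q) (fst q') \<le> fst z"
  proof (cases "q = q' \<and> (\<forall>z\<in>L. 1 * fst q \<le> 1 * fst z)")
    case True then show ?thesis using z by auto
  next
    case False
    then obtain c where c: "L \<subseteq> unit_disk c" "sqdist q c = 1" "sqdist q' c = 1" "snd q' \<le> snd c" "snd c \<le> snd q"
      "1 * ((fst q - fst c) * (snd q' - snd c) - (snd q - snd c) * (fst q' - fst c)) > 0"
      using e unfolding end_data_def by metis
    have "sqdist z c \<le> 1" using c(1) z by (auto simp: unit_disk_def)
    moreover have "(fst q - fst c - (fst q' - fst c)) * (snd z - snd c - (snd q' - snd c))
      - (snd q - snd c - (snd q' - snd c)) * (fst z - fst c - (fst q' - fst c)) \<le> 0"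
      using nl by (simp add: left_of_def)
    ultimately have "min (fst q - fst c) (fst q' - fst c) \<le> fst z - fst c"
      using c by (intro arc_extreme[of "fst q - fst c" "snd q - snd c" "fst q' - fst c" "snd q' - snd c" "fst z - fst c" "snd z - snd c"])
        (auto simp: sqdist_def)
    then show ?thesis by (auto simp: min_def split: if_splits)
  qed
next
  assume e: "end_data (- 1) L q q'" and nl: "z \<notin> left_of q q'"
  show "fst z \<le> max (fst q) (fst q')"
  proof (cases "q = q' \<and> (\<forall>z\<in>L. - 1 * fst q \<le> - 1 * fst z)")
    case True then show ?thesis using z by auto
  next
    case False
    then obtain c where c: "L \<subseteq> unit_disk c" "sqdist q c = 1" "sqdist q' c = 1" "snd q' \<le> snd c" "snd c \<le> snd q"
      "- 1 * ((fst q - fst c) * (snd q' - snd c) - (snd q - snd c) * (fst q' - fst c)) > 0"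
      using e unfolding end_data_def by metis
    have d: "sqdist w c = (fst c - fst w)\<^sup>2 + (snd w - snd c)\<^sup>2" for w
      by (simp add: sqdist_def power2_commute)
    have "sqdist z c \<le> 1" using c(1) z by (auto simp: unit_disk_def)
    moreover have "(fst c - fst q - (fst c - fst q')) * (snd z - snd c - (snd q' - snd c))
      - (snd q - snd c - (snd q' - snd c)) * (fst c - fst z - (fst c - fst q'))
      = (fst q' - fst q) * (snd z - snd q) - (snd q' - snd q) * (fst z - fst q)" by algebra
    then have "(fst c - fst q - (fst c - fst q')) * (snd z - snd c - (snd q' - snd c))
      - (snd q - snd c - (snd q' - snd c)) * (fst c - fst z - (fst c - fst q')) \<le> 0"
      using nl by (simp add: left_of_def)
    moreover have "(fst c - fst q) * (snd q' - snd c) - (snd q - snd c) * (fst c - fst q')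
      = - 1 * ((fst q - fst c) * (snd q' - snd c) - (snd q - snd c) * (fst q' - fst c))" by algebra
    ultimately have "min (fst c - fst q) (fst c - fst q') \<le> fst c - fst z"
      using c(2-6) unfolding d
      by (intro arc_extreme[of "fst c - fst q" "snd q - snd c" "fst c - fst q'" "snd q' - snd c" "fst c - fst z" "snd z - snd c"])
        auto
    then show ?thesis by (auto simp: min_def max_def split: if_splits)
  qed
qed

text \<open>The centre is the chord midpoint moved by \<open>h\<close> along the normal, a vertical
  shift of size \<open>|h * e1|\<close>. Since its height lies between those of \<open>q'\<close>
  and \<open>q\<close>, the shift is at most half the vertical extent. This is the growth condition
  of \<open>seg_area_chord_convex\<close>.\<close>

lemma end_data_slope:
  assumes "end_data 1 L q q' \<and> s = q' \<and> t = q \<or> end_data (- 1) L q q' \<and> s = q \<and> t = q'"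
  shows "snd q' \<le> snd q"
    and "\<bar>fst t - fst s\<bar> * sqrt (1 - sqdist s t / 4) \<le> (snd q - snd q') * (sqrt (sqdist s t) / 2)"
proof -
  have "snd q' \<le> snd q \<and>
    \<bar>fst t - fst s\<bar> * sqrt (1 - sqdist s t / 4) \<le> (snd q - snd q') * (sqrt (sqdist s t) / 2)"
  proof (cases "q = q'")
    case True
    then have "s = t" using assms by auto
    then show ?thesis using True by simp
  next
    case False
    then have "s \<noteq> t" using assms by auto
    obtain c where c: "L \<subseteq> unit_disk c" "sqdist s c = 1" "sqdist t c = 1" "c \<notin> left_of s t"
      "snd q' \<le> snd c" "snd c \<le> snd q"
      using end_data_chord[OF assms False] by metis
    interpret chord s t by unfold_locales (use \<open>s \<noteq> t\<close> c sqdist_le_4[of s c t] in auto)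
    have cc: "c = center" using center_unique c by blast
    have "r\<^sup>2 = sqdist s t / 4" using r(3) by simp
    then have hh: "sqrt (1 - sqdist s t / 4) = h" by (simp add: h_def)
    have "snd c = (snd s + snd t) / 2 - h * e1" unfolding cc center_def by simp
    then have "\<bar>h * e1\<bar> \<le> (snd q - snd q') / 2" using c(5,6) assms by (auto simp: field_simps abs_le_iff)
    then have "\<bar>h * e1\<bar> * (2 * r) \<le> (snd q - snd q') / 2 * (2 * r)" using r(1) by (intro mult_right_mono) auto
    moreover have "\<bar>h * e1\<bar> * (2 * r) = \<bar>fst t - fst s\<bar> * h"
      unfolding diffs(1) abs_mult using h(1) r(1) by simp
    ultimately show ?thesis using c(5,6) unfolding hh by (simp add: r_def[symmetric])
  qed
  then show "snd q' \<le> snd q"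
    and "\<bar>fst t - fst s\<bar> * sqrt (1 - sqdist s t / 4) \<le> (snd q - snd q') * (sqrt (sqdist s t) / 2)" by auto
qed

section \<open>Area as a middle part plus two caps\<close>

context chain
begin

lemma area_lower_bound:
  assumes K: "M = bdual K" "k \<in> K"
  shows "ennreal (mid_area + chord_seg Q2 Q1 + chord_seg Q3 Q4) \<le> emeasure lborel M"
proof -
  have "sqdist p k \<le> 1" if "p \<in> M" for p using that K by (auto simp: bdual_def sqdist_commute)
  then have nn: "0 \<le> chord_seg Q2 Q1" "0 \<le> chord_seg Q3 Q4"
    using Q_mem by (intro chord_seg_nonneg sqdist_le_4[of _ k]; simp)+
  have Mm: "M \<in> sets borel" using M(1) by (simp add: borel_closed compact_imp_closed)
  have "ennreal (mid_area + chord_seg Q2 Q1 + chord_seg Q3 Q4)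
    = emeasure lborel mid + ennreal (chord_seg Q2 Q1) + ennreal (chord_seg Q3 Q4)"
    using nn emeasure_mid by simp
  also have "\<dots> \<le> emeasure lborel mid + emeasure lborel (M \<inter> left_of Q2 Q1) + emeasure lborel (M \<inter> left_of Q3 Q4)"
    using Q_mem by (intro add_mono order_refl emeasure_left_of_ge[OF K])
  also have "emeasure lborel mid + emeasure lborel (M \<inter> left_of Q2 Q1) = emeasure lborel (mid \<union> M \<inter> left_of Q2 Q1)"
    using mid_measurable Mm left_of_measurable mid_disjoint by (intro plus_emeasure) auto
  also have "\<dots> + emeasure lborel (M \<inter> left_of Q3 Q4)
    = emeasure lborel ((mid \<union> M \<inter> left_of Q2 Q1) \<union> M \<inter> left_of Q3 Q4)"
    using mid_measurable Mm left_of_measurable mid_disjoint chords_disjoint by (intro plus_emeasure) auto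
  also have "\<dots> \<le> emeasure lborel M"
    using mid_subset Mm by (intro emeasure_mono) auto
  finally show ?thesis .
qed

text \<open>\<open>end_data\<close> confines the points outside both caps to the abscissas between
  \<open>xl\<close> and \<open>xr\<close>, so they belong to \<open>mid\<close>, and it bounds each
  cap by a circular segment.\<close>

lemma area_upper_bound:
  assumes e: "end_data 1 M Q1 Q2" "end_data (- 1) M Q3 Q4"
  shows "emeasure lborel M \<le> ennreal (mid_area + chord_seg Q2 Q1 + chord_seg Q3 Q4)"
proof -
  have "sqdist Q2 Q1 \<le> 4" using end_data_sqdist_le_4[OF e(1)] by (simp add: sqdist_commute)
  moreover have "sqdist Q3 Q4 \<le> 4" using end_data_sqdist_le_4[OF e(2)] .
  ultimately have nn: "0 \<le> chord_seg Q2 Q1" "0 \<le> chord_seg Q3 Q4" by (auto intro: chord_seg_nonneg)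
  have Mm: "M \<in> sets borel" using M(1) by (simp add: borel_closed compact_imp_closed)
  have "M \<subseteq> (mid \<union> M \<inter> left_of Q2 Q1) \<union> M \<inter> left_of Q3 Q4"
  proof
    fix z assume z: "z \<in> M"
    show "z \<in> (mid \<union> M \<inter> left_of Q2 Q1) \<union> M \<inter> left_of Q3 Q4"
    proof (cases "z \<in> left_of Q2 Q1 \<or> z \<in> left_of Q3 Q4")
      case False
      then have x: "xl \<le> fst z" "fst z \<le> xr"
        using end_data_extreme(1)[OF z e(1)] end_data_extreme(2)[OF z e(2)]
        by (auto simp: Q1_def Q2_def Q3_def Q4_def xl_def xr_def)
      have fg: "f (fst z) \<le> snd z" "snd z \<le> g (fst z)"
        using z lower_le[OF M(1), of "fst z" "snd z"] le_upper[OF M(1), of "fst z" "snd z"] by auto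
      have "snd z \<le> top_chain (fst z)"
        using fg False left_chord_iff(2)[of z] right_chord_iff(2)[of z] x
        unfolding top_chain_cases[OF x] xl_def xr_def by (auto simp: min_def max_def split: if_splits)
      moreover have "bottom_chain (fst z) \<le> snd z"
        using fg False left_chord_iff(3)[of z] right_chord_iff(3)[of z] x
        unfolding bottom_chain_cases[OF x] xl_def xr_def by (auto simp: min_def max_def split: if_splits)
      ultimately show ?thesis using x by (simp add: mid_def)
    qed (use z in auto)
  qed
  then have "emeasure lborel M \<le> emeasure lborel ((mid \<union> M \<inter> left_of Q2 Q1) \<union> M \<inter> left_of Q3 Q4)"
    using mid_measurable Mm left_of_measurable by (intro emeasure_mono) auto
  also have "\<dots> \<le> emeasure lborel (mid \<union> M \<inter> left_of Q2 Q1) + emeasure lborel (M \<inter> left_of Q3 Q4)"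
    using mid_measurable Mm left_of_measurable by (intro emeasure_subadditive) auto
  also have "\<dots> \<le> (emeasure lborel mid + emeasure lborel (M \<inter> left_of Q2 Q1)) + emeasure lborel (M \<inter> left_of Q3 Q4)"
    using mid_measurable Mm left_of_measurable by (intro add_right_mono emeasure_subadditive) auto
  also have "\<dots> \<le> (ennreal mid_area + ennreal (chord_seg Q2 Q1)) + ennreal (chord_seg Q3 Q4)"
    unfolding emeasure_mid
    using e emeasure_end_cap_le[of M Q1 Q2 Q2 Q1] emeasure_end_cap_le[of M Q3 Q4 Q3 Q4]
    by (intro add_mono order_refl) blast+
  also have "\<dots> = ennreal (mid_area + chord_seg Q2 Q1 + chord_seg Q3 Q4)"
    using nn emeasure_mid by simp
  finally show ?thesis .
qed

end

section \<open>Ends of a hull\<close>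

lemma slope_strict_mono:
  fixes a b :: real assumes "- 1 < a" "a < b" "b < 1"
  shows "a / sqrt (1 - a\<^sup>2) < b / sqrt (1 - b\<^sup>2)"
proof -
  have "(\<lambda>z. (z - 0) / sqrt (1 - (z - 0)\<^sup>2)) a < (\<lambda>z. (z - 0) / sqrt (1 - (z - 0)\<^sup>2)) b"
  proof (rule DERIV_pos_imp_increasing[OF assms(2)])
    fix x assume "a \<le> x" "x \<le> b"
    then have "(x - 0)\<^sup>2 < 1" using assms by (simp add: abs_square_less_1)
    from semicircle_slope_has_real_derivative[OF this]
    show "\<exists>y. ((\<lambda>z. (z - 0) / sqrt (1 - (z - 0)\<^sup>2)) has_real_derivative y) (at x) \<and> 0 < y"
      by (intro exI conjI) (auto intro!: zero_less_power add_pos_nonneg)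
  qed
  then show ?thesis by simp
qed

text \<open>Consequently two unit semicircles with different abscissas of their centres cross at
  most once, whatever their heights.\<close>

lemma semicircle_difference_increasing:
  fixes l r x y :: real
  assumes "r < l" "x < y" "(x - l)\<^sup>2 \<le> 1" "(y - l)\<^sup>2 \<le> 1" "(x - r)\<^sup>2 \<le> 1" "(y - r)\<^sup>2 \<le> 1"
  shows "sqrt (1 - (x - l)\<^sup>2) - sqrt (1 - (x - r)\<^sup>2) < sqrt (1 - (y - l)\<^sup>2) - sqrt (1 - (y - r)\<^sup>2)"
proof (rule DERIV_pos_imp_increasing_open[OF assms(2), where f = "\<lambda>z. sqrt (1 - (z - l)\<^sup>2) - sqrt (1 - (z - r)\<^sup>2)"])
  fix z assume z: "x < z" "z < y"
  have b: "(z - l)\<^sup>2 < 1" "(z - r)\<^sup>2 < 1" using open_interval_sq_less_1 assms z by blast+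
  then have "\<bar>z - l\<bar> < 1" "\<bar>z - r\<bar> < 1" by (simp_all add: abs_square_less_1)
  then have "(z - l) / sqrt (1 - (z - l)\<^sup>2) < (z - r) / sqrt (1 - (z - r)\<^sup>2)"
    using assms(1) by (intro slope_strict_mono) auto
  moreover have "((\<lambda>z. sqrt (1 - (z - l)\<^sup>2) - sqrt (1 - (z - r)\<^sup>2)) has_real_derivative
    - ((z - l) / sqrt (1 - (z - l)\<^sup>2)) - - ((z - r) / sqrt (1 - (z - r)\<^sup>2))) (at z)"
    by (intro DERIV_diff semicircle_has_real_derivative b)
  ultimately show "\<exists>d. ((\<lambda>z. sqrt (1 - (z - l)\<^sup>2) - sqrt (1 - (z - r)\<^sup>2)) has_real_derivative d) (at z) \<and> 0 < d"
    by (intro exI conjI) auto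
qed (intro continuous_intros)

lemma half_circle_eq:
  assumes t: "\<tau> = 1 \<or> \<tau> = - 1" and "sqdist p c = 1" "\<tau> * snd c \<le> \<tau> * snd p"
  shows "\<tau> * snd p = \<tau> * snd c + sqrt (1 - (fst p - fst c)\<^sup>2)"
proof -
  have "(\<tau> * snd p - \<tau> * snd c)\<^sup>2 = 1 - (fst p - fst c)\<^sup>2"
    using t assms(2) by (auto simp: sqdist_def power2_commute)
  then have "sqrt (1 - (fst p - fst c)\<^sup>2) = \<tau> * snd p - \<tau> * snd c"
    using assms(3) by (intro real_sqrt_unique) auto
  then show ?thesis by simp
qed

lemma half_circle_le:
  assumes t: "\<tau> = 1 \<or> \<tau> = - 1" and "sqdist p c \<le> 1"
  shows "\<tau> * snd p \<le> \<tau> * snd c + sqrt (1 - (fst p - fst c)\<^sup>2)"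
proof -
  have "(\<tau> * snd p - \<tau> * snd c)\<^sup>2 \<le> 1 - (fst p - fst c)\<^sup>2"
    using t assms(2) by (auto simp: sqdist_def power2_commute)
  then have "\<tau> * snd p - \<tau> * snd c \<le> sqrt (1 - (fst p - fst c)\<^sup>2)"
    by (rule real_le_rsqrt)
  then show ?thesis by simp
qed

lemma sqdist_le_1_fst: "sqdist p c \<le> 1 \<Longrightarrow> (fst p - fst c)\<^sup>2 \<le> 1"
  using zero_le_power2[of "snd p - snd c"] unfolding sqdist_def by linarith

text \<open>At \<open>p\<close> the arc about \<open>c\<close> is not above the arc about
  \<open>c'\<close>, and at \<open>q\<close> the reverse holds; their height difference is strictly
  increasing. The sign \<open>\<tau>\<close> treats upper and lower arcs together.\<close>

lemma opposite_arcs_ordered: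
  assumes t: "\<tau> = 1 \<or> \<tau> = - 1" and "fst c' < fst c"
    and p: "sqdist p c = 1" "\<tau> * snd c \<le> \<tau> * snd p" "sqdist p c' \<le> 1"
    and q: "sqdist q c' = 1" "\<tau> * snd c' \<le> \<tau> * snd q" "sqdist q c \<le> 1"
  shows "fst p \<le> fst q"
proof (rule ccontr)
  assume "\<not> ?thesis"
  then have "sqrt (1 - (fst q - fst c)\<^sup>2) - sqrt (1 - (fst q - fst c')\<^sup>2)
    < sqrt (1 - (fst p - fst c)\<^sup>2) - sqrt (1 - (fst p - fst c')\<^sup>2)"
    using assms by (intro semicircle_difference_increasing sqdist_le_1_fst) auto
  then show False
    using half_circle_eq[OF t p(1,2)] half_circle_le[OF t p(3)] half_circle_eq[OF t q(1,2)] half_circle_le[OF t q(3)]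
    by linarith
qed

section \<open>Hulls contained in an open unit disk\<close>

locale strict_hull =
  fixes E K L :: "(real \<times> real) set" and c0 :: "real \<times> real"
  assumes E: "compact E" "E \<noteq> {}" and K: "K = bdual E" and L: "L = bdual K"
    and K_ne: "K \<noteq> {}"
    and strict: "\<And>p. p \<in> L \<Longrightarrow> sqdist p c0 < 1"
begin

lemma E_subset_L: "E \<subseteq> L"
  unfolding L K by (rule subset_bdual_bdual)

lemma compact_K: "compact K" unfolding K using E by (intro compact_bdual)

lemma compact_L: "compact L" unfolding L using K_ne by (intro compact_bdual)

lemma L_disk: "c \<in> K \<Longrightarrow> p \<in> L \<Longrightarrow> sqdist p c \<le> 1"
  unfolding L by (simp add: bdual_def sqdist_commute)

text \<open>All points of \<open>L\<close> on a unit circle lie in the open half plane towards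
  \<open>c0\<close>, so no two of them are antipodal.\<close>

lemma strict_dot:
  assumes "p \<in> L" "sqdist p c = 1"
  shows "(fst p - fst c) * (fst c0 - fst c) + (snd p - snd c) * (snd c0 - snd c) > 0"
proof -
  have "sqdist p c0 = sqdist p c - 2 * ((fst p - fst c) * (fst c0 - fst c) + (snd p - snd c) * (snd c0 - snd c))
    + sqdist c0 c"
    unfolding sqdist_def by algebra
  then show ?thesis using strict[OF assms(1)] assms(2) sqdist_nonneg[of c0 c] by argo
qed

lemma support_disk:
  assumes "P \<in> L" "\<And>\<epsilon>. \<epsilon> > 0 \<Longrightarrow> (fst P + \<epsilon> * d1, snd P + \<epsilon> * d2) \<notin> L"
  obtains c where "c \<in> K" "sqdist P c = 1" "(fst c - fst P) * d1 + (snd c - snd P) * d2 \<le> 0"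
proof (rule bdual_blocking_point[OF compact_K, of P d1 d2])
  show "P \<in> bdual K" using assms(1) L by simp
  show "(fst P + \<epsilon> * d1, snd P + \<epsilon> * d2) \<notin> bdual K" if "\<epsilon> > 0" for \<epsilon>
    using assms(2)[OF that] L by simp
qed (use that in \<open>simp add: sqdist_commute\<close>)

text \<open>Otherwise the midpoint of a vertical segment in \<open>L\<close> would be on the
  boundary and have a supporting unit circle, but the midpoint of a proper chord is strictly inside
  the disk.\<close>

lemma extreme_point_unique:
  assumes s: "\<sigma> = 1 \<or> \<sigma> = - 1" and P: "P \<in> L" "Q \<in> L"
    and ext: "\<And>z. z \<in> L \<Longrightarrow> \<sigma> * fst P \<le> \<sigma> * fst z" and "fst P = fst Q"
  shows "P = Q"
proof (rule ccontr)
  assume "P \<noteq> Q"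
  define R where "R = (fst P, (snd P + snd Q) / 2)"
  have "R = (1 / 2) *\<^sub>R P + (1 / 2) *\<^sub>R Q"
    using assms(5) by (simp add: R_def prod_eq_iff field_simps)
  then have R: "R \<in> L"
    using convex_bdual[of K] P unfolding L convex_def by (metis add_divide_distrib field_sum_of_halves one_add_one divide_self_if zero_neq_numeral zero_le_divide_1_iff zero_le_numeral)
  obtain c where c: "c \<in> K" "sqdist R c = 1"
  proof (rule support_disk[OF R, of "- \<sigma>" 0])
    fix \<epsilon> :: real assume "\<epsilon> > 0"
    then show "(fst R + \<epsilon> * - \<sigma>, snd R + \<epsilon> * 0) \<notin> L"
      using ext[of "(fst R + \<epsilon> * - \<sigma>, snd R + \<epsilon> * 0)"] s by (auto simp: R_def)
  qed auto
  have "sqdist R c = (sqdist P c + sqdist Q c) / 2 - ((snd P - snd Q) / 2)\<^sup>2"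
    using assms(5) unfolding R_def sqdist_def by (simp add: power2_eq_square field_simps)
  moreover have "((snd P - snd Q) / 2)\<^sup>2 > 0" using \<open>P \<noteq> Q\<close> assms(5) by (auto simp: prod_eq_iff)
  ultimately show False using L_disk[OF c(1) P(1)] L_disk[OF c(1) P(2)] c(2) by argo
qed

text \<open>Apply \<open>contact_or_extreme\<close> to a supporting circle at \<open>P\<close>. A
  contact on the same half, no farther inward, shares the abscissa of \<open>P\<close> and so equals
  it, contradicting \<open>P \<notin> E\<close>; in the other alternative the extreme of the circle
  belongs to \<open>L\<close> and must be \<open>P\<close>.\<close>

lemma extreme_on_supporting_circle:
  assumes s: "\<sigma> = 1 \<or> \<sigma> = - 1" and P: "P \<in> L" "P \<notin> E"
    and ext: "\<And>z. z \<in> L \<Longrightarrow> \<sigma> * fst P \<le> \<sigma> * fst z"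
  obtains c where "c \<in> K" "P = (fst c - \<sigma>, snd c)"
proof -
  obtain c where c: "c \<in> K" "sqdist P c = 1"
  proof (rule support_disk[OF P(1), of "- \<sigma>" 0])
    fix \<epsilon> :: real assume "\<epsilon> > 0"
    then show "(fst P + \<epsilon> * - \<sigma>, snd P + \<epsilon> * 0) \<notin> L"
      using ext[of "(fst P + \<epsilon> * - \<sigma>, snd P + \<epsilon> * 0)"] s by auto
  qed auto
  obtain \<tau> :: real where t: "\<tau> = 1 \<or> \<tau> = - 1" "\<tau> * snd c \<le> \<tau> * snd P"
    by (cases "snd c \<le> snd P") (use that[of 1] that[of "- 1"] in auto)
  have "P = (fst c - \<sigma>, snd c)"
  proof (rule contact_or_extreme[OF E(1) K strict[unfolded L] P(1)[unfolded L] c s t])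
    fix u assume u: "u \<in> E" "sqdist u c = 1" "\<tau> * snd c \<le> \<tau> * snd u" "\<sigma> * fst u \<le> \<sigma> * fst P"
    have f: "fst u = fst P" using ext[of u] u(1,4) E_subset_L s by auto
    then have "\<tau> * snd u = \<tau> * snd P"
      using half_circle_eq[OF t(1) u(2,3)] half_circle_eq[OF t(1) c(2) t(2)] by simp
    then have "u = P" using f t(1) by (auto simp: prod_eq_iff)
    then show ?thesis using u(1) P(2) by simp
  next
    assume "(fst c - \<sigma>, snd c) \<in> bdual K"
    then have "\<sigma> * fst P \<le> \<sigma> * (fst c - \<sigma>)" using ext[of "(fst c - \<sigma>, snd c)"] L by simp
    then have le: "1 \<le> \<sigma> * (fst c - fst P)" using s by auto
    have "(fst P - fst c)\<^sup>2 \<le> 1" using sqdist_le_1_fst[of P c] c(2) by simp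
    then have "\<bar>fst P - fst c\<bar> \<le> 1" by (simp add: abs_square_le_1)
    then have f: "fst P = fst c - \<sigma>" using le s by auto
    then have "(snd P - snd c)\<^sup>2 = 0" using c(2) s by (auto simp: sqdist_def)
    then show ?thesis using f by (simp add: prod_eq_iff)
  qed
  then show thesis using that c by blast
qed

lemma end_data_exists:
  assumes s: "\<sigma> = 1 \<or> \<sigma> = - 1"
  obtains q q' where "q \<in> E" "q' \<in> E" "end_data \<sigma> L q q'"
proof -
  have "continuous_on L (\<lambda>z. \<sigma> * fst z)" by (intro continuous_intros)
  moreover have "L \<noteq> {}" using E(2) E_subset_L by blast
  ultimately obtain P where P: "P \<in> L" and ext: "\<And>z. z \<in> L \<Longrightarrow> \<sigma> * fst P \<le> \<sigma> * fst z"
    using continuous_attains_inf[OF compact_L, of "\<lambda>z. \<sigma> * fst z"] by blast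
  show thesis
  proof (cases "P \<in> E")
    case True
    then show thesis using that[of P P] ext by (simp add: end_data_def)
  next
    case False
    obtain c where c: "c \<in> K" "P = (fst c - \<sigma>, snd c)"
      by (rule extreme_on_supporting_circle[OF s P False ext])
    have Pc: "sqdist P c = 1" using c(2) s by (auto simp: sqdist_def)
    \<comment> \<open>Moving the centre straight up or down takes it out of the unit disk about
      \<open>P\<close>; the blocking contact lies on the opposite half of the circle.\<close>
    have contact: "\<exists>u\<in>E. sqdist u c = 1 \<and> (snd u - snd c) * d \<le> 0" if d: "d = 1 \<or> d = - 1" for d :: real
    proof -
      obtain u where "u \<in> E" "sqdist u c = 1" "(fst u - fst c) * 0 + (snd u - snd c) * d \<le> 0"
      proof (rule bdual_blocking_point[OF E(1), of c 0 d])
        show "c \<in> bdual E" using c K by simp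
        fix \<epsilon> :: real assume "\<epsilon> > 0"
        then have "sqdist P (fst c + \<epsilon> * 0, snd c + \<epsilon> * d) > 1"
          using c(2) s d by (auto simp: sqdist_def)
        then show "(fst c + \<epsilon> * 0, snd c + \<epsilon> * d) \<notin> bdual E"
          using L_disk[OF _ P] unfolding K by force
      qed auto
      then show ?thesis by auto
    qed
    obtain q' where q': "q' \<in> E" "sqdist q' c = 1" "snd q' \<le> snd c" using contact[of 1] by auto
    obtain q where q: "q \<in> E" "sqdist q c = 1" "snd c \<le> snd q" using contact[of "- 1"] by auto
    define a1 b1 a2 b2 where "a1 = fst q - fst c" and "b1 = snd q - snd c"
      and "a2 = fst q' - fst c" and "b2 = snd q' - snd c"
    define w1 w2 where "w1 = fst c0 - fst c" and "w2 = snd c0 - snd c"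
    have dP: "- \<sigma> * w1 > 0" using strict_dot[OF P Pc] c(2) unfolding w1_def
      by (metis add.right_neutral diff_self fst_conv mult_zero_left snd_conv add_diff_cancel_left' diff_conv_add_uminus)
    have d1: "a1 * w1 + b1 * w2 > 0" and d2: "a2 * w1 + b2 * w2 > 0"
      using strict_dot[of q c] strict_dot[of q' c] q q' E_subset_L
      unfolding a1_def b1_def a2_def b2_def w1_def w2_def by auto
    have not_ext: False if "p \<in> E" "sqdist p c = 1" "snd p = snd c" for p
    proof -
      have "(fst p - fst c)\<^sup>2 = 1" using that by (simp add: sqdist_def)
      then have "fst p - fst c = \<sigma> \<or> fst p - fst c = - \<sigma>" using s by (auto simp: power2_eq_1_iff)
      moreover have "(fst p - fst c) * w1 > 0"
        using strict_dot[of p c] that E_subset_L unfolding w1_def by auto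
      ultimately have "fst p - fst c = - \<sigma>" using dP by auto
      then have "p = P" using that(3) c(2) by (simp add: prod_eq_iff)
      then show False using that False by simp
    qed
    have b: "b1 > 0" "b2 < 0" using not_ext[of q] not_ext[of q'] q q' unfolding b1_def b2_def by fastforce+
    \<comment> \<open>This positive combination of the two inner products eliminates
      \<open>w2\<close>, leaving \<open>w1\<close> times the cross product; the sign of
      \<open>w1\<close> is known from \<open>P\<close>.\<close>
    have "(- b2) * (a1 * w1 + b1 * w2) + b1 * (a2 * w1 + b2 * w2) > 0"
      by (rule add_pos_pos; rule mult_pos_pos) (use b d1 d2 in simp_all)
    moreover have "(- b2) * (a1 * w1 + b1 * w2) + b1 * (a2 * w1 + b2 * w2) = w1 * (b1 * a2 - a1 * b2)" by algebra
    ultimately have "w1 * (b1 * a2 - a1 * b2) > 0" by simp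
    then have "\<sigma> * (a1 * b2 - b1 * a2) > 0"
      using dP s by (auto simp: zero_less_mult_iff)
    moreover have "L \<subseteq> unit_disk c" using L_disk[OF c(1)] by (auto simp: unit_disk_def)
    moreover have "(fst c - \<sigma>, snd c) \<in> L" using P c(2) by simp
    ultimately have "end_data \<sigma> L q q'"
      using q q' unfolding end_data_def a1_def b1_def a2_def b2_def by blast
    then show thesis using that q q' by blast
  qed
qed

lemma end_data_fibres:
  assumes s: "\<sigma> = 1 \<or> \<sigma> = - 1" and e: "end_data \<sigma> L q q'" and "q \<in> L" "q' \<in> L" "z \<in> L"
  shows "fst z = fst q \<Longrightarrow> snd z \<le> snd q" "fst z = fst q' \<Longrightarrow> snd q' \<le> snd z"
proof -
  have *: "(fst z = fst q \<longrightarrow> snd z \<le> snd q) \<and> (fst z = fst q' \<longrightarrow> snd q' \<le> snd z)"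
  proof (cases "q = q' \<and> (\<forall>z\<in>L. \<sigma> * fst q \<le> \<sigma> * fst z)")
    case True
    then have u: "q = z" if "fst q = fst z" using extreme_point_unique[OF s, of q z] assms(3,5) that by blast
    show ?thesis
    proof (intro conjI impI)
      assume "fst z = fst q"
      then show "snd z \<le> snd q" using u by simp
    next
      assume "fst z = fst q'"
      then show "snd q' \<le> snd z" using u True by simp
    qed
  next
    case False
    then obtain c where c: "L \<subseteq> unit_disk c" "sqdist q c = 1" "sqdist q' c = 1" "snd q' \<le> snd c" "snd c \<le> snd q"
      using e unfolding end_data_def by metis
    have z: "sqdist z c \<le> 1" using c(1) assms(5) by (auto simp: unit_disk_def)
    have "snd z \<le> snd c + sqrt (1 - (fst z - fst c)\<^sup>2)" "snd q = snd c + sqrt (1 - (fst q - fst c)\<^sup>2)"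
      using half_circle_le[of 1 z c] half_circle_eq[of 1 q c] c z by simp_all
    moreover have "- snd z \<le> - snd c + sqrt (1 - (fst z - fst c)\<^sup>2)"
      "- snd q' = - snd c + sqrt (1 - (fst q' - fst c)\<^sup>2)"
      using half_circle_le[of "- 1" z c] half_circle_eq[of "- 1" q' c] c z by simp_all
    ultimately show ?thesis by auto
  qed
  show "fst z = fst q \<Longrightarrow> snd z \<le> snd q" "fst z = fst q' \<Longrightarrow> snd q' \<le> snd z" using * by auto
qed

text \<open>If the end is an arc about some \<open>c'\<close>, the horizontal extremes of both
  circles lie in \<open>L\<close>, hence in each other's disks. The two squared distances sum to
  twice the squared distance of the centres plus two, so the centres coincide.\<close>

lemma extreme_end:
  assumes s: "\<sigma> = 1 \<or> \<sigma> = - 1" and e: "end_data \<sigma> L q q'" and q: "q \<in> L"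
    and c: "c \<in> K" "(fst c - \<sigma>, snd c) \<in> L"
  shows "sqdist q c = 1 \<and> sqdist q' c = 1 \<and> snd q' \<le> snd c \<and> snd c \<le> snd q"
proof (cases "q = q' \<and> (\<forall>z\<in>L. \<sigma> * fst q \<le> \<sigma> * fst z)")
  case True
  then have "\<sigma> * fst q \<le> \<sigma> * (fst c - \<sigma>)" using c(2) by force
  then have le: "1 \<le> \<sigma> * (fst c - fst q)" using s by auto
  have qc: "sqdist q c \<le> 1" using L_disk c(1) q by blast
  then have "\<bar>fst q - fst c\<bar> \<le> 1" using sqdist_le_1_fst by (simp add: abs_square_le_1)
  then have f: "fst q = fst c - \<sigma>" using le s by auto
  then have "(snd q - snd c)\<^sup>2 \<le> 0" using qc s by (auto simp: sqdist_def)
  then have "snd q = snd c" by simp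
  then show ?thesis using f True s by (auto simp: sqdist_def)
next
  case False
  then obtain c' where c': "L \<subseteq> unit_disk c'" "sqdist q c' = 1" "sqdist q' c' = 1" "snd q' \<le> snd c'" "snd c' \<le> snd q"
    "(fst c' - \<sigma>, snd c') \<in> L"
    using e unfolding end_data_def by metis
  have "sqdist (fst c' - \<sigma>, snd c') c \<le> 1" using L_disk[OF c(1) c'(6)] .
  moreover have "sqdist (fst c - \<sigma>, snd c) c' \<le> 1" using c'(1) c(2) by (auto simp: unit_disk_def)
  moreover have "sqdist (fst c' - \<sigma>, snd c') c + sqdist (fst c - \<sigma>, snd c) c' = 2 * sqdist c c' + 2"
    using s unfolding sqdist_def by (auto simp: power2_eq_square algebra_simps)
  ultimately have "sqdist c c' \<le> 0" by linarith
  then have "c = c'" unfolding sqdist_def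
    by (metis (no_types, lifting) add_nonneg_eq_0_iff antisym eq_iff_diff_eq_0 add_nonneg_nonneg power2_eq_iff_nonneg prod_eq_iff zero_eq_power2 zero_le_power2)
  then show ?thesis using c' by simp
qed

text \<open>For two arc ends, the centre \<open>c\<close> of the left arc lies strictly to the right
  of the centre \<open>c'\<close> of the right arc: the extreme to the left of \<open>c\<close> lies
  in the disk about \<open>c'\<close>, and equal centres would put antipodal points into
  \<open>L\<close>. The arcs are then ordered by \<open>opposite_arcs_ordered\<close>.\<close>

lemma end_data_ordered:
  assumes e: "end_data 1 L q1 q2" "end_data (- 1) L q3 q4" and q: "q1 \<in> L" "q2 \<in> L" "q3 \<in> L" "q4 \<in> L"
  shows "fst q1 \<le> fst q3" "fst q2 \<le> fst q4"
proof -
  have "fst q1 \<le> fst q3 \<and> fst q2 \<le> fst q4"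
  proof (cases "(q1 = q2 \<and> (\<forall>z\<in>L. 1 * fst q1 \<le> 1 * fst z)) \<or> (q3 = q4 \<and> (\<forall>z\<in>L. - 1 * fst q3 \<le> - 1 * fst z))")
    case True
    then show ?thesis using q by auto
  next
    case False
    then obtain c where c: "L \<subseteq> unit_disk c" "sqdist q1 c = 1" "sqdist q2 c = 1" "snd q2 \<le> snd c" "snd c \<le> snd q1"
      "(fst c - 1, snd c) \<in> L"
      using e(1) unfolding end_data_def by metis
    from False obtain c' where c': "L \<subseteq> unit_disk c'" "sqdist q3 c' = 1" "sqdist q4 c' = 1" "snd q4 \<le> snd c'" "snd c' \<le> snd q3"
      "(fst c' - - 1, snd c') \<in> L"
      using e(2) unfolding end_data_def by metis
    have disk: "sqdist p c \<le> 1" "sqdist p c' \<le> 1" if "p \<in> L" for p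
      using that c(1) c'(1) by (auto simp: unit_disk_def)
    have "sqdist (fst c - 1, snd c) c' \<le> 1" using disk(2)[OF c(6)] .
    then have A: "(fst c - fst c' - 1)\<^sup>2 + (snd c - snd c')\<^sup>2 \<le> 1" by (simp add: sqdist_def algebra_simps)
    have "fst c' < fst c"
    proof (rule ccontr)
      assume "\<not> ?thesis"
      then have n: "fst c - fst c' \<le> 0" by simp
      have "(fst c - fst c' - 1)\<^sup>2 \<le> 1" using A zero_le_power2[of "snd c - snd c'"] by linarith
      then have "\<bar>fst c - fst c' - 1\<bar> \<le> 1" by (simp add: abs_square_le_1)
      then have f: "fst c = fst c'" using n by linarith
      then have "(snd c - snd c')\<^sup>2 \<le> 0" using A by simp
      then have "c = c'" using f by (simp add: prod_eq_iff)
      then have "(fst c - 1, snd c) \<in> L" "(fst c + 1, snd c) \<in> L" using c(6) c'(6) by auto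
      from strict[OF this(1)] strict[OF this(2)]
      have "(fst c - 1 - fst c0)\<^sup>2 + (snd c - snd c0)\<^sup>2 < 1" "(fst c + 1 - fst c0)\<^sup>2 + (snd c - snd c0)\<^sup>2 < 1"
        by (auto simp: sqdist_def)
      moreover have "(fst c - 1 - fst c0)\<^sup>2 + (fst c + 1 - fst c0)\<^sup>2 = 2 * (fst c - fst c0)\<^sup>2 + 2"
        by (simp add: power2_eq_square algebra_simps)
      moreover have "0 \<le> (snd c - snd c0)\<^sup>2" "0 \<le> (fst c - fst c0)\<^sup>2" by simp_all
      ultimately show False by linarith
    qed
    then show ?thesis
      using opposite_arcs_ordered[of 1 c' c q1 q3] opposite_arcs_ordered[of "- 1" c' c q2 q4] c c' disk q by auto
  qed
  then show "fst q1 \<le> fst q3" "fst q2 \<le> fst q4" by auto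
qed

end

section \<open>Fibrewise averages\<close>

lemma fst_memI: "(x, y) \<in> M \<Longrightarrow> x \<in> fst ` M"
  by force

lemma sqdist_average_le:
  assumes u: "0 \<le> u" "u \<le> 1"
  shows "sqdist ((1 - u) *\<^sub>R p + u *\<^sub>R p') ((1 - u) *\<^sub>R c + u *\<^sub>R c')
    \<le> (1 - u) * sqdist p c + u * sqdist p' c'"
proof -
  have sq: "((1 - u) * a + u * b)\<^sup>2 \<le> (1 - u) * a\<^sup>2 + u * b\<^sup>2" for a b :: real
  proof -
    have "(1 - u) * a\<^sup>2 + u * b\<^sup>2 - ((1 - u) * a + u * b)\<^sup>2 = u * (1 - u) * (a - b)\<^sup>2"
      by (simp add: power2_eq_square algebra_simps)
    moreover have "u * (1 - u) * (a - b)\<^sup>2 \<ge> 0" using u by simp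
    ultimately show ?thesis by linarith
  qed
  have "sqdist ((1 - u) *\<^sub>R p + u *\<^sub>R p') ((1 - u) *\<^sub>R c + u *\<^sub>R c')
    = ((1 - u) * (fst p - fst c) + u * (fst p' - fst c'))\<^sup>2 + ((1 - u) * (snd p - snd c) + u * (snd p' - snd c'))\<^sup>2"
    unfolding sqdist_def by (simp add: algebra_simps)
  also have "\<dots> \<le> ((1 - u) * (fst p - fst c)\<^sup>2 + u * (fst p' - fst c')\<^sup>2)
      + ((1 - u) * (snd p - snd c)\<^sup>2 + u * (snd p' - snd c')\<^sup>2)"
    by (intro add_mono sq)
  also have "\<dots> = (1 - u) * sqdist p c + u * sqdist p' c'"
    unfolding sqdist_def by (simp add: algebra_simps)
  finally show ?thesis .
qed

definition fibre_average :: "real \<Rightarrow> (real \<times> real) set \<Rightarrow> (real \<times> real) set \<Rightarrow> (real \<times> real) set" where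
  "fibre_average u M0 M1 = {(x, (1 - u) * y0 + u * y1) | x y0 y1. (x, y0) \<in> M0 \<and> (x, y1) \<in> M1}"

lemma compact_fibre_average:
  assumes "compact M0" "compact M1" shows "compact (fibre_average u M0 M1)"
proof -
  let ?D = "(M0 \<times> M1) \<inter> {z. fst (fst z) = fst (snd z)}"
  have "compact ?D"
    by (intro compact_Int_closed compact_Times assms closed_Collect_eq continuous_intros)
  moreover have "continuous_on ?D (\<lambda>z. (fst (fst z), (1 - u) * snd (fst z) + u * snd (snd z)))"
    by (intro continuous_intros)
  ultimately have "compact ((\<lambda>z. (fst (fst z), (1 - u) * snd (fst z) + u * snd (snd z))) ` ?D)"
    by (rule compact_continuous_image[rotated])
  moreover have "(\<lambda>z. (fst (fst z), (1 - u) * snd (fst z) + u * snd (snd z))) ` ?D = fibre_average u M0 M1"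
    by (force simp: fibre_average_def)
  ultimately show ?thesis by simp
qed

text \<open>Averaged centres give disks containing the averaged set. This keeps its hull finite and
  makes the dual of the average at least as rich as the two duals.\<close>

lemma bdual_fibre_average:
  assumes u: "0 \<le> u" "u \<le> 1" and c: "c0 \<in> bdual M0" "c1 \<in> bdual M1"
  shows "(1 - u) *\<^sub>R c0 + u *\<^sub>R c1 \<in> bdual (fibre_average u M0 M1)"
  unfolding bdual_def
proof (intro CollectI ballI)
  fix p assume "p \<in> fibre_average u M0 M1"
  then obtain x y0 y1 where p: "p = (x, (1 - u) * y0 + u * y1)" "(x, y0) \<in> M0" "(x, y1) \<in> M1"
    by (auto simp: fibre_average_def)
  then have pe: "p = (1 - u) *\<^sub>R (x, y0) + u *\<^sub>R (x, y1)" by (simp add: algebra_simps)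
  have "sqdist p ((1 - u) *\<^sub>R c0 + u *\<^sub>R c1) \<le> (1 - u) * sqdist (x, y0) c0 + u * sqdist (x, y1) c1"
    unfolding pe by (rule sqdist_average_le[OF u])
  also have "\<dots> \<le> (1 - u) * 1 + u * 1"
    using u bdualD[OF c(1) p(2)] bdualD[OF c(2) p(3)] by (intro add_mono mult_left_mono) auto
  finally show "sqdist p ((1 - u) *\<^sub>R c0 + u *\<^sub>R c1) \<le> 1" by simp
qed

lemma fibre_extreme:
  fixes M :: "(real \<times> real) set" and \<tau> :: real
  assumes M: "compact M" and x: "x \<in> fst ` M" and t: "\<tau> = 1 \<or> \<tau> = - 1"
  obtains y where "(x, y) \<in> M" "\<And>y'. (x, y') \<in> M \<Longrightarrow> \<tau> * y' \<le> \<tau> * y"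
  using t
proof
  assume "\<tau> = 1"
  then show thesis using that[of "upper M x"] upper_mem[OF M x] le_upper[OF M] by simp
next
  assume "\<tau> = - 1"
  then show thesis using that[of "lower M x"] lower_mem[OF M x] lower_le[OF M] by simp
qed

section \<open>The hull of the average against the average of the hulls\<close>

locale fibre_average_hull = strict_hull +
  fixes M0 M1 K0 K1 :: "(real \<times> real) set" and u :: real
  assumes M0: "M0 = bdual K0" and M1: "M1 = bdual K1" and K_nonempty: "K0 \<noteq> {}" "K1 \<noteq> {}"
    and closed_K: "compact K0" "compact K1"
    and u: "0 \<le> u" "u \<le> 1"
    and E_avg: "E = fibre_average u M0 M1"
begin

lemma support_circle:
  assumes M: "M = bdual Ki" and Ki: "compact Ki"
    and P: "P \<in> M" and ext: "\<And>\<epsilon>. \<epsilon> > 0 \<Longrightarrow> (fst P, snd P + \<epsilon> * \<tau>) \<notin> M"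
  obtains c where "c \<in> Ki" "sqdist P c = 1" "\<tau> * snd c \<le> \<tau> * snd P"
proof (rule bdual_blocking_point[OF Ki, of P 0 \<tau>])
  show "P \<in> bdual Ki" using P M by simp
  show "(fst P + \<epsilon> * 0, snd P + \<epsilon> * \<tau>) \<notin> bdual Ki" if "\<epsilon> > 0" for \<epsilon>
    using ext[OF that] M by simp
  fix c assume c: "c \<in> Ki" "sqdist c P = 1" "(fst c - fst P) * 0 + (snd c - snd P) * \<tau> \<le> 0"
  then have "\<tau> * snd c \<le> \<tau> * snd P" by (simp add: algebra_simps)
  then show thesis using that c by (simp add: sqdist_commute)
qed

text \<open>A supporting circle of \<open>L\<close> is followed to both sides. On each side it meets
  a contact, or its extreme is in \<open>L\<close>; in the latter case the corner of that end lies
  on the same circle by \<open>extreme_end\<close> and serves as contact. Between the contacts, the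
  arc is compared with averaged supporting arcs of \<open>M0\<close> and \<open>M1\<close>.\<close>

lemma fibrewise_comparison:
  assumes e: "end_data 1 L q1 q2" "end_data (- 1) L q3 q4"
    and q: "q1 \<in> E" "q2 \<in> E" "q3 \<in> E" "q4 \<in> E"
    and t: "\<tau> = 1 \<and> fst q1 \<le> x \<and> x \<le> fst q3 \<or> \<tau> = - 1 \<and> fst q2 \<le> x \<and> x \<le> fst q4"
    and P: "(x, y) \<in> L" and ext: "\<And>\<epsilon>. \<epsilon> > 0 \<Longrightarrow> (x, y + \<epsilon> * \<tau>) \<notin> L"
  obtains y0 y1 where "(x, y0) \<in> M0" "(x, y1) \<in> M1" "\<tau> * y \<le> (1 - u) * (\<tau> * y0) + u * (\<tau> * y1)"
proof -
  have t': "\<tau> = 1 \<or> \<tau> = - 1" using t by auto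
  obtain c where c: "c \<in> K" "sqdist (x, y) c = 1" "\<tau> * snd c \<le> \<tau> * snd (x, y)"
    by (rule support_circle[OF L compact_K P]) (use ext in auto)
  have side: "\<exists>v\<in>E. sqdist v c = 1 \<and> \<tau> * snd c \<le> \<tau> * snd v \<and> \<sigma> * fst v \<le> \<sigma> * x"
    if s: "\<sigma> = 1 \<or> \<sigma> = - 1" and ed: "end_data \<sigma> L p p'" and p: "p \<in> E" "p' \<in> E"
      and le: "\<tau> = 1 \<Longrightarrow> \<sigma> * fst p \<le> \<sigma> * x" "\<tau> = - 1 \<Longrightarrow> \<sigma> * fst p' \<le> \<sigma> * x" for \<sigma> p p'
  proof (rule contact_or_extreme[OF E(1) K strict[unfolded L] P[unfolded L] c(1,2) s t' c(3)])
    fix v assume "v \<in> E" "sqdist v c = 1" "\<tau> * snd c \<le> \<tau> * snd v" "\<sigma> * fst v \<le> \<sigma> * fst (x, y)"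
    then show ?thesis by auto
  next
    assume "(fst c - \<sigma>, snd c) \<in> bdual K"
    then have "(fst c - \<sigma>, snd c) \<in> L" using L by simp
    from extreme_end[OF s ed _ c(1) this] p E_subset_L
    have x: "sqdist p c = 1 \<and> sqdist p' c = 1 \<and> snd p' \<le> snd c \<and> snd c \<le> snd p" by blast
    show ?thesis
    proof (cases "\<tau> = 1")
      case True then show ?thesis using x p le by auto
    next
      case False then show ?thesis using x p le t' by auto
    qed
  qed
  obtain l where l: "l \<in> E" "sqdist l c = 1" "\<tau> * snd c \<le> \<tau> * snd l" "fst l \<le> x"
    using side[of 1 q1 q2] e(1) q t by auto
  obtain r where r: "r \<in> E" "sqdist r c = 1" "\<tau> * snd c \<le> \<tau> * snd r" "x \<le> fst r"
    using side[of "- 1" q3 q4] e(2) q t by auto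
  obtain yl0 yl1 where yl: "l = (fst l, (1 - u) * yl0 + u * yl1)" "(fst l, yl0) \<in> M0" "(fst l, yl1) \<in> M1"
    using l(1) unfolding E_avg fibre_average_def by auto
  obtain yr0 yr1 where yr: "r = (fst r, (1 - u) * yr0 + u * yr1)" "(fst r, yr0) \<in> M0" "(fst r, yr1) \<in> M1"
    using r(1) unfolding E_avg fibre_average_def by auto
  have cM: "compact M0" "compact M1" "convex M0" "convex M1"
    unfolding M0 M1 using K_nonempty by (auto intro: compact_bdual convex_bdual)
  have x: "x \<in> fst ` M0" "x \<in> fst ` M1"
    using fst_image_interval[OF cM(3) fst_memI[OF yl(2)] fst_memI[OF yr(2)] l(4) r(4)]
      fst_image_interval[OF cM(4) fst_memI[OF yl(3)] fst_memI[OF yr(3)] l(4) r(4)] .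
  obtain y0 where y0: "(x, y0) \<in> M0" "\<And>y'. (x, y') \<in> M0 \<Longrightarrow> \<tau> * y' \<le> \<tau> * y0"
    using fibre_extreme[OF cM(1) x(1) t'] by metis
  obtain y1 where y1: "(x, y1) \<in> M1" "\<And>y'. (x, y') \<in> M1 \<Longrightarrow> \<tau> * y' \<le> \<tau> * y1"
    using fibre_extreme[OF cM(2) x(2) t'] by metis
  have above: "\<not> \<tau> * (y' + \<epsilon> * \<tau>) \<le> \<tau> * y'" if "\<epsilon> > 0" for \<epsilon> y' using that t' by auto
  obtain c0 where c0: "c0 \<in> K0" "sqdist (x, y0) c0 = 1" "\<tau> * snd c0 \<le> \<tau> * snd (x, y0)"
  proof (rule support_circle[OF M0 closed_K(1) y0(1)])
    show "(fst (x, y0), snd (x, y0) + \<epsilon> * \<tau>) \<notin> M0" if "\<epsilon> > 0" for \<epsilon>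
      using y0(2)[of "y0 + \<epsilon> * \<tau>"] above[OF that, of y0] by auto
  qed
  obtain c1 where c1: "c1 \<in> K1" "sqdist (x, y1) c1 = 1" "\<tau> * snd c1 \<le> \<tau> * snd (x, y1)"
  proof (rule support_circle[OF M1 closed_K(2) y1(1)])
    show "(fst (x, y1), snd (x, y1) + \<epsilon> * \<tau>) \<notin> M1" if "\<epsilon> > 0" for \<epsilon>
      using y1(2)[of "y1 + \<epsilon> * \<tau>"] above[OF that, of y1] by auto
  qed
  have in0: "sqdist p c0 \<le> 1" if "p \<in> M0" for p using that c0(1) M0 by (auto simp: bdual_def sqdist_commute)
  have in1: "sqdist p c1 \<le> 1" if "p \<in> M1" for p using that c1(1) M1 by (auto simp: bdual_def sqdist_commute)
  \<comment> \<open>The average of the supporting semicircles at abscissa \<open>x\<close>: it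
    dominates \<open>E\<close> in direction \<open>\<tau>\<close>, in particular at the contacts
    \<open>l\<close> and \<open>r\<close>, and equals the averaged boundary at
    \<open>x\<close>.\<close>
  define W where "W z = (1 - u) * (\<tau> * snd c0 + sqrt (1 - (z - fst c0)\<^sup>2))
    + u * (\<tau> * snd c1 + sqrt (1 - (z - fst c1)\<^sup>2))" for z
  have W_ge: "\<tau> * snd p \<le> W (fst p)" if p: "p = (fst p, (1 - u) * a + u * b)" "(fst p, a) \<in> M0" "(fst p, b) \<in> M1" for p a b
  proof -
    have "(1 - u) * (\<tau> * a) + u * (\<tau> * b) \<le> W (fst p)"
      unfolding W_def using u half_circle_le[OF t' in0[OF p(2)]] half_circle_le[OF t' in1[OF p(3)]]
      by (intro add_mono mult_left_mono) auto
    moreover have "\<tau> * snd p = (1 - u) * (\<tau> * a) + u * (\<tau> * b)"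
      by (subst p(1)) (simp add: algebra_simps)
    ultimately show ?thesis by simp
  qed
  have "\<tau> * snd c + sqrt (1 - (x - fst c)\<^sup>2) \<le> W x"
  proof (rule semicircle_le_average[OF u l(4) r(4) _ W_def])
    show "\<tau> * snd c + sqrt (1 - (fst l - fst c)\<^sup>2) \<le> W (fst l)"
      using W_ge[OF yl] half_circle_eq[OF t' l(2,3)] by simp
    show "\<tau> * snd c + sqrt (1 - (fst r - fst c)\<^sup>2) \<le> W (fst r)"
      using W_ge[OF yr] half_circle_eq[OF t' r(2,3)] by simp
    fix d assume "d \<in> {fst c, fst c0, fst c1}"
    then show "(fst l - d)\<^sup>2 \<le> 1 \<and> (fst r - d)\<^sup>2 \<le> 1"
      using sqdist_le_1_fst[of l c] sqdist_le_1_fst[of r c] l(2) r(2)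
        sqdist_le_1_fst[OF in0[OF yl(2)]] sqdist_le_1_fst[OF in0[OF yr(2)]]
        sqdist_le_1_fst[OF in1[OF yl(3)]] sqdist_le_1_fst[OF in1[OF yr(3)]] by auto
  qed
  moreover have "W x = (1 - u) * (\<tau> * y0) + u * (\<tau> * y1)"
    unfolding W_def using half_circle_eq[OF t' c0(2,3)] half_circle_eq[OF t' c1(2,3)] by simp
  ultimately have "\<tau> * y \<le> (1 - u) * (\<tau> * y0) + u * (\<tau> * y1)"
    using half_circle_eq[OF t' c(2,3)] by simp
  then show thesis using that y0(1) y1(1) by blast
qed

text \<open>The chords in \<open>M0\<close> and \<open>M1\<close> stand over the same abscissas as
  that of \<open>L\<close>. Since \<open>q\<close> and \<open>q'\<close> are averages of points of
  \<open>M0\<close> and \<open>M1\<close>, the averaged boundaries leave nonnegative gaps above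
  \<open>q\<close> and below \<open>q'\<close>; these are the \<open>a\<close> and \<open>b\<close>
  of \<open>seg_area_chord_convex\<close>.\<close>

lemma chord_seg_convex:
  assumes "end_data 1 L q q' \<and> s = q' \<and> t = q \<or> end_data (- 1) L q q' \<and> s = q \<and> t = q'"
    and q: "q \<in> E" "q' \<in> E"
  shows "chord_seg s t \<le> (1 - u) * chord_seg (fst q, upper M0 (fst q)) (fst q', lower M0 (fst q'))
    + u * chord_seg (fst q, upper M1 (fst q)) (fst q', lower M1 (fst q'))
    + (fst t - fst s) * (((1 - u) * upper M0 (fst q) + u * upper M1 (fst q) - snd q)
        + ((1 - u) * lower M0 (fst q') + u * lower M1 (fst q') - snd q')) / 2"
proof -
  have cM: "compact M0" "compact M1"
    unfolding M0 M1 using K_nonempty by (auto intro: compact_bdual)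
  obtain a0 a1 where a: "q = (fst q, (1 - u) * a0 + u * a1)" "(fst q, a0) \<in> M0" "(fst q, a1) \<in> M1"
    using q(1) unfolding E_avg fibre_average_def by auto
  obtain b0 b1 where b: "q' = (fst q', (1 - u) * b0 + u * b1)" "(fst q', b0) \<in> M0" "(fst q', b1) \<in> M1"
    using q(2) unfolding E_avg fibre_average_def by auto
  have up: "snd q \<le> (1 - u) * upper M0 (fst q) + u * upper M1 (fst q)"
    by (subst a(1)) (use u le_upper[OF cM(1) a(2)] le_upper[OF cM(2) a(3)] in \<open>auto intro!: add_mono mult_left_mono\<close>)
  have lo: "(1 - u) * lower M0 (fst q') + u * lower M1 (fst q') \<le> snd q'"
    by (subst (3) b(1)) (use u lower_le[OF cM(1) b(2)] lower_le[OF cM(2) b(3)] in \<open>auto intro!: add_mono mult_left_mono\<close>)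
  define d where "d = fst t - fst s"
  have d2: "d\<^sup>2 = (fst q - fst q')\<^sup>2" using assms(1) unfolding d_def by (auto simp: power2_commute)
  have le4: "sqdist (fst q, upper M (fst q)) (fst q', lower M (fst q')) \<le> 4"
    if "M = bdual Ki" "Ki \<noteq> {}" "compact M" "fst q \<in> fst ` M" "fst q' \<in> fst ` M" for M Ki
  proof -
    from \<open>Ki \<noteq> {}\<close> obtain k where "k \<in> Ki" by blast
    then show ?thesis using upper_mem[OF that(3,4)] lower_mem[OF that(3,5)] that(1)
      by (intro sqdist_le_4[of _ k]) (auto simp: bdual_def sqdist_commute)
  qed
  have m: "fst q \<in> fst ` M0" "fst q' \<in> fst ` M0" "fst q \<in> fst ` M1" "fst q' \<in> fst ` M1"
    using fst_memI[OF a(2)] fst_memI[OF b(2)] fst_memI[OF a(3)] fst_memI[OF b(3)] .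
  have sd: "sqdist (fst q, y) (fst q', y') = d\<^sup>2 + (y - y')\<^sup>2" for y y'
    unfolding d2 by (simp add: sqdist_def)
  have st: "sqdist s t = d\<^sup>2 + (snd q - snd q')\<^sup>2"
    using assms(1) sd[of "snd q" "snd q'"] by (auto simp: sqdist_commute)
  have "seg_area (sqrt (d\<^sup>2 + (snd q - snd q')\<^sup>2) / 2)
    \<le> (1 - u) * seg_area (sqrt (d\<^sup>2 + (upper M0 (fst q) - lower M0 (fst q'))\<^sup>2) / 2)
      + u * seg_area (sqrt (d\<^sup>2 + (upper M1 (fst q) - lower M1 (fst q'))\<^sup>2) / 2)
      + d * (((1 - u) * upper M0 (fst q) + u * upper M1 (fst q) - snd q)
        - (snd q' - ((1 - u) * lower M0 (fst q') + u * lower M1 (fst q')))) / 2"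
  proof (rule seg_area_chord_convex[OF u])
    show "d\<^sup>2 + (upper M0 (fst q) - lower M0 (fst q'))\<^sup>2 \<le> 4"
      using le4[OF M0 K_nonempty(1) cM(1) m(1,2)] unfolding sd .
    show "d\<^sup>2 + (upper M1 (fst q) - lower M1 (fst q'))\<^sup>2 \<le> 4"
      using le4[OF M1 K_nonempty(2) cM(2) m(3,4)] unfolding sd .
    \<comment> \<open>Both ends lie in an open unit disk, so by the parallelogram law the chord is
      shorter than two.\<close>
    have "sqdist q c0 < 1" "sqdist q' c0 < 1" using strict q E_subset_L by blast+
    then have "sqdist s c0 < 1" "sqdist t c0 < 1" using assms(1) by auto
    moreover have "sqdist s t + (fst s + fst t - 2 * fst c0)\<^sup>2 + (snd s + snd t - 2 * snd c0)\<^sup>2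
      = 2 * sqdist s c0 + 2 * sqdist t c0"
      unfolding sqdist_def by algebra
    moreover have "0 \<le> (fst s + fst t - 2 * fst c0)\<^sup>2" "0 \<le> (snd s + snd t - 2 * snd c0)\<^sup>2" by simp_all
    ultimately show "d\<^sup>2 + (snd q - snd q')\<^sup>2 < 4" unfolding st[symmetric] by linarith
    show "0 \<le> snd q - snd q'" using end_data_slope(1)[OF assms(1)] by simp
    show "\<bar>d\<bar> * sqrt (1 - (d\<^sup>2 + (snd q - snd q')\<^sup>2) / 4) \<le> (snd q - snd q') * (sqrt (d\<^sup>2 + (snd q - snd q')\<^sup>2) / 2)"
      using end_data_slope(2)[OF assms(1)] unfolding st d_def[symmetric] .
  qed (use up lo in \<open>auto simp: algebra_simps\<close>)
  then show ?thesis unfolding chord_seg_def sd st d_def[symmetric] by (simp add: algebra_simps)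
qed

text \<open>Middle part plus segments is an upper bound for \<open>L\<close> because the chords are
  those of its ends, and a lower bound for \<open>M0\<close> and \<open>M1\<close>, whose own ends
  may lie elsewhere. Opposite bounds are what the inequality requires.\<close>

theorem emeasure_hull_le:
  "emeasure lborel L \<le> ennreal (1 - u) * emeasure lborel M0 + ennreal u * emeasure lborel M1"
proof -
  obtain q1 q2 where q12: "q1 \<in> E" "q2 \<in> E" "end_data 1 L q1 q2" using end_data_exists[of 1] by blast
  obtain q3 q4 where q34: "q3 \<in> E" "q4 \<in> E" "end_data (- 1) L q3 q4" using end_data_exists[of "- 1"] by blast
  note e = q12(3) q34(3) and q = q12(1,2) q34(1,2)
  have qL: "q1 \<in> L" "q2 \<in> L" "q3 \<in> L" "q4 \<in> L" using q E_subset_L by auto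
  have ord: "fst q1 \<le> fst q3" "fst q2 \<le> fst q4" using end_data_ordered[OF e qL] by auto
  have E_fst: "fst p \<in> fst ` M0" "fst p \<in> fst ` M1" if "p \<in> E" for p
    using that unfolding E_avg fibre_average_def by force+
  have cM: "compact M0" "compact M1" "convex M0" "convex M1" "compact L" "convex L"
    unfolding M0 M1 using K_nonempty compact_L L by (auto intro: compact_bdual convex_bdual)
  interpret A: chain M0 "fst q1" "fst q2" "fst q3" "fst q4"
    by unfold_locales (use cM q E_fst ord in auto)
  interpret B: chain M1 "fst q1" "fst q2" "fst q3" "fst q4"
    by unfold_locales (use cM q E_fst ord in auto)
  interpret C: chain L "fst q1" "fst q2" "fst q3" "fst q4"
    by unfold_locales (use cM qL ord in auto)
  have ends: "upper L (fst q1) = snd q1" "lower L (fst q2) = snd q2" "upper L (fst q3) = snd q3" "lower L (fst q4) = snd q4"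
    using end_data_fibres[OF _ e(1) qL(1,2)] end_data_fibres[OF _ e(2) qL(3,4)]
      C.Q_mem[unfolded C.Q1_def C.Q2_def C.Q3_def C.Q4_def]
      le_upper[OF cM(5)] lower_le[OF cM(5)] qL
    by (auto intro!: antisym)
  then have QC: "C.Q1 = q1" "C.Q2 = q2" "C.Q3 = q3" "C.Q4 = q4"
    unfolding C.Q1_def C.Q2_def C.Q3_def C.Q4_def by auto
  have up: "upper L x \<le> (1 - u) * upper M0 x + u * upper M1 x" if xq: "x \<in> {fst q1..fst q3}" for x
  proof -
    have x: "x \<in> fst ` L" using fst_image_interval[OF cM(6) C.mem(1,3)] xq by auto
    obtain y0 y1 where y: "(x, y0) \<in> M0" "(x, y1) \<in> M1"
      "1 * upper L x \<le> (1 - u) * (1 * y0) + u * (1 * y1)"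
    proof (rule fibrewise_comparison[OF e q _ upper_mem[OF cM(5) x], of 1])
      show "(x, upper L x + \<epsilon> * 1) \<notin> L" if "\<epsilon> > 0" for \<epsilon>
        using le_upper[OF cM(5), of x "upper L x + \<epsilon> * 1"] that by auto
    qed (use xq in auto)
    moreover have "(1 - u) * y0 + u * y1 \<le> (1 - u) * upper M0 x + u * upper M1 x"
      using u le_upper[OF cM(1) y(1)] le_upper[OF cM(2) y(2)] by (intro add_mono mult_left_mono) auto
    ultimately show ?thesis by simp
  qed
  have lo: "(1 - u) * lower M0 x + u * lower M1 x \<le> lower L x" if xq: "x \<in> {fst q2..fst q4}" for x
  proof -
    have x: "x \<in> fst ` L" using fst_image_interval[OF cM(6) C.mem(2,4)] xq by auto
    obtain y0 y1 where y: "(x, y0) \<in> M0" "(x, y1) \<in> M1"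
      "- 1 * lower L x \<le> (1 - u) * (- 1 * y0) + u * (- 1 * y1)"
    proof (rule fibrewise_comparison[OF e q _ lower_mem[OF cM(5) x], of "- 1"])
      show "(x, lower L x + \<epsilon> * - 1) \<notin> L" if "\<epsilon> > 0" for \<epsilon>
        using lower_le[OF cM(5), of x "lower L x + \<epsilon> * - 1"] that by auto
    qed (use xq in auto)
    moreover have "(1 - u) * lower M0 x + u * lower M1 x \<le> (1 - u) * y0 + u * y1"
      using u lower_le[OF cM(1) y(1)] lower_le[OF cM(2) y(2)] by (intro add_mono mult_left_mono) auto
    ultimately show ?thesis by simp
  qed
  note iA = upper_lower_integrable[OF cM(1,3)] and iB = upper_lower_integrable[OF cM(2,4)]
    and iC = upper_lower_integrable[OF cM(5,6)]
  let ?U = "\<lambda>M. \<integral>x. indicator {fst q1..fst q3} x * upper M x \<partial>lborel"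
  let ?V = "\<lambda>M. \<integral>x. indicator {fst q2..fst q4} x * lower M x \<partial>lborel"
  have U: "?U L \<le> (1 - u) * ?U M0 + u * ?U M1"
  proof -
    have "?U L \<le> (\<integral>x. (1 - u) * (indicator {fst q1..fst q3} x * upper M0 x)
      + u * (indicator {fst q1..fst q3} x * upper M1 x) \<partial>lborel)"
      using iA(1)[OF A.mem(1,3)] iB(1)[OF B.mem(1,3)] iC(1)[OF C.mem(1,3)] up
      by (intro integral_mono Bochner_Integration.integrable_add integrable_mult_right) (auto simp: indicator_def)
    also have "\<dots> = (1 - u) * ?U M0 + u * ?U M1"
      using iA(1)[OF A.mem(1,3)] iB(1)[OF B.mem(1,3)] by simp
    finally show ?thesis .
  qed
  have V: "(1 - u) * ?V M0 + u * ?V M1 \<le> ?V L"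
  proof -
    have "(1 - u) * ?V M0 + u * ?V M1 = (\<integral>x. (1 - u) * (indicator {fst q2..fst q4} x * lower M0 x)
      + u * (indicator {fst q2..fst q4} x * lower M1 x) \<partial>lborel)"
      using iA(2)[OF A.mem(2,4)] iB(2)[OF B.mem(2,4)] by simp
    also have "\<dots> \<le> ?V L"
      using iA(2)[OF A.mem(2,4)] iB(2)[OF B.mem(2,4)] iC(2)[OF C.mem(2,4)] lo
      by (intro integral_mono Bochner_Integration.integrable_add integrable_mult_right) (auto simp: indicator_def)
    finally show ?thesis .
  qed
  define \<Phi>A where "\<Phi>A = A.mid_area + chord_seg A.Q2 A.Q1 + chord_seg A.Q3 A.Q4"
  define \<Phi>B where "\<Phi>B = B.mid_area + chord_seg B.Q2 B.Q1 + chord_seg B.Q3 B.Q4"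
  obtain k0 k1 where k: "k0 \<in> K0" "k1 \<in> K1" using K_nonempty by blast
  have segs: "chord_seg p p' \<ge> 0" if "p \<in> bdual Ki" "p' \<in> bdual Ki" "k \<in> Ki" for p p' Ki k
    using that by (intro chord_seg_nonneg sqdist_le_4[of _ k]) (auto simp: bdual_def sqdist_commute)
  have \<Phi>0: "0 \<le> \<Phi>A" "0 \<le> \<Phi>B" unfolding \<Phi>A_def \<Phi>B_def
    using A.emeasure_mid(2) B.emeasure_mid(2) A.Q_mem B.Q_mem segs[of _ K0 _ k0] segs[of _ K1 _ k1] k M0 M1
    by (auto intro!: add_nonneg_nonneg)
  have lA: "ennreal \<Phi>A \<le> emeasure lborel M0" unfolding \<Phi>A_def by (rule A.area_lower_bound[OF M0 k(1)])
  have lB: "ennreal \<Phi>B \<le> emeasure lborel M1" unfolding \<Phi>B_def by (rule B.area_lower_bound[OF M1 k(2)])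
  have cs: "chord_seg p p' = chord_seg p' p" for p p' unfolding chord_seg_def by (simp add: sqdist_commute)
  have s1: "chord_seg q2 q1 \<le> (1 - u) * chord_seg A.Q2 A.Q1 + u * chord_seg B.Q2 B.Q1
    + (fst q1 - fst q2) * (((1 - u) * upper M0 (fst q1) + u * upper M1 (fst q1) - snd q1)
        + ((1 - u) * lower M0 (fst q2) + u * lower M1 (fst q2) - snd q2)) / 2"
    using chord_seg_convex[of q1 q2 q2 q1] e(1) q
    unfolding A.Q1_def A.Q2_def B.Q1_def B.Q2_def
    by (simp add: cs[of "(fst q2, _)" "(fst q1, _)"])
  have s2: "chord_seg q3 q4 \<le> (1 - u) * chord_seg A.Q3 A.Q4 + u * chord_seg B.Q3 B.Q4
    + (fst q4 - fst q3) * (((1 - u) * upper M0 (fst q3) + u * upper M1 (fst q3) - snd q3)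
        + ((1 - u) * lower M0 (fst q4) + u * lower M1 (fst q4) - snd q4)) / 2"
    using chord_seg_convex[of q3 q4 q3 q4] e(2) q
    unfolding A.Q3_def A.Q4_def B.Q3_def B.Q4_def by simp
  \<comment> \<open>The gap terms of \<open>s1\<close> and \<open>s2\<close> replace the corner
    ordinates of \<open>L\<close> by averaged ones in the trapezoids, so the right side becomes the
    exact average.\<close>
  have "C.mid_area + chord_seg C.Q2 C.Q1 + chord_seg C.Q3 C.Q4 \<le> (1 - u) * \<Phi>A + u * \<Phi>B"
  proof -
    have "C.mid_area + chord_seg C.Q2 C.Q1 + chord_seg C.Q3 C.Q4
      \<le> ((1 - u) * ?U M0 + u * ?U M1) - ((1 - u) * ?V M0 + u * ?V M1)
        + (fst q1 - fst q2) * (snd q1 + snd q2) / 2 + (fst q4 - fst q3) * (snd q3 + snd q4) / 2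
        + ((1 - u) * chord_seg A.Q2 A.Q1 + u * chord_seg B.Q2 B.Q1
          + (fst q1 - fst q2) * (((1 - u) * upper M0 (fst q1) + u * upper M1 (fst q1) - snd q1)
        + ((1 - u) * lower M0 (fst q2) + u * lower M1 (fst q2) - snd q2)) / 2)
        + ((1 - u) * chord_seg A.Q3 A.Q4 + u * chord_seg B.Q3 B.Q4
          + (fst q4 - fst q3) * (((1 - u) * upper M0 (fst q3) + u * upper M1 (fst q3) - snd q3)
        + ((1 - u) * lower M0 (fst q4) + u * lower M1 (fst q4) - snd q4)) / 2)"
      unfolding C.mid_area_def QC ends using U V s1 s2 by argo
    also have "\<dots> = (1 - u) * \<Phi>A + u * \<Phi>B"
      unfolding \<Phi>A_def \<Phi>B_def A.mid_area_def B.mid_area_def by (simp add: field_simps)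
    finally show ?thesis .
  qed
  then have "ennreal (C.mid_area + chord_seg C.Q2 C.Q1 + chord_seg C.Q3 C.Q4) \<le> ennreal ((1 - u) * \<Phi>A + u * \<Phi>B)"
    by (rule ennreal_leI)
  moreover have "emeasure lborel L \<le> ennreal (C.mid_area + chord_seg C.Q2 C.Q1 + chord_seg C.Q3 C.Q4)"
    by (rule C.area_upper_bound) (use e QC in auto)
  ultimately have "emeasure lborel L \<le> ennreal ((1 - u) * \<Phi>A + u * \<Phi>B)" by (rule order_trans[rotated])
  also have "\<dots> = ennreal (1 - u) * ennreal \<Phi>A + ennreal u * ennreal \<Phi>B"
    using u \<Phi>0 by (simp add: ennreal_mult)
  also have "\<dots> \<le> ennreal (1 - u) * emeasure lborel M0 + ennreal u * emeasure lborel M1"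
    by (intro add_mono mult_left_mono lA lB) auto
  finally show ?thesis .
qed

end

text \<open>The locale above needs a strict center. None exists only if the dual of the average is a single
  point, and then all three hulls are unit disks.\<close>
lemma emeasure_bdual_fibre_average_le:
  assumes K: "compact K0" "compact K1" "K0 \<noteq> {}" "K1 \<noteq> {}" and u: "0 < u" "u < 1"
    and closed: "K0 = bdual (bdual K0)" "K1 = bdual (bdual K1)"
    and ne: "fibre_average u (bdual K0) (bdual K1) \<noteq> {}"
  shows "emeasure lborel (bdual (bdual (fibre_average u (bdual K0) (bdual K1))))
    \<le> ennreal (1 - u) * emeasure lborel (bdual K0) + ennreal u * emeasure lborel (bdual K1)"
proof -
  define E where "E = fibre_average u (bdual K0) (bdual K1)"
  define K where "K = bdual E"
  have avg: "(1 - u) *\<^sub>R c0 + u *\<^sub>R c1 \<in> K" if "c0 \<in> K0" "c1 \<in> K1" for c0 c1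
    unfolding K_def E_def using u that closed by (intro bdual_fibre_average) auto
  obtain a b where ab: "a \<in> K0" "b \<in> K1" using K by blast
  define k where "k = (1 - u) *\<^sub>R a + u *\<^sub>R b"
  have k: "k \<in> K" unfolding k_def by (rule avg[OF ab])
  have "emeasure lborel (bdual K) \<le> ennreal (1 - u) * emeasure lborel (bdual K0) + ennreal u * emeasure lborel (bdual K1)"
  proof (cases "K = {k}")
    case True
    \<comment> \<open>With \<open>b\<close> fixed, distinct points of \<open>K0\<close> would give
      distinct averages in the singleton \<open>K\<close>.\<close>
    have "a' = a" if "a' \<in> K0" for a'
    proof -
      have "(1 - u) *\<^sub>R a' + u *\<^sub>R b = (1 - u) *\<^sub>R a + u *\<^sub>R b"
        using avg[OF that ab(2)] True unfolding k_def by simp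
      then show ?thesis using u by simp
    qed
    then have K0: "K0 = {a}" using ab by blast
    have "b' = b" if "b' \<in> K1" for b'
    proof -
      have "(1 - u) *\<^sub>R a + u *\<^sub>R b' = (1 - u) *\<^sub>R a + u *\<^sub>R b"
        using avg[OF ab(1) that] True unfolding k_def by simp
      then show ?thesis using u by simp
    qed
    then have K1: "K1 = {b}" using ab by blast
    have d: "emeasure lborel (bdual {c}) = emeasure lborel (cball 0 1 :: (real \<times> real) set)" for c
      by (simp add: bdual_eq_cball emeasure_cball)
    have "ennreal (1 - u) * x + ennreal u * x = x" for x
    proof -
      have "ennreal (1 - u) + ennreal u = 1" using u by (simp flip: ennreal_plus)
      then show ?thesis by (metis distrib_right mult_1)
    qed
    then show ?thesis unfolding True K0 K1 d by simp
  next
    case False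
    then obtain k' where "k' \<in> K" "k' \<noteq> k" using k by blast
    then obtain c0 where c0: "\<And>p. p \<in> bdual K \<Longrightarrow> sqdist p c0 < 1"
      using bdual_strict_center[OF k, of k'] by metis
    interpret fibre_average_hull E K "bdual K" c0 "bdual K0" "bdual K1" K0 K1 u
    proof
      show "compact E" unfolding E_def using K by (intro compact_fibre_average compact_bdual)
    qed (use K u ne k c0 in \<open>auto simp: E_def K_def\<close>)
    show ?thesis by (rule emeasure_hull_le)
  qed
  then show ?thesis unfolding K_def E_def .
qed

section \<open>Convexity of the area\<close>

lemma dist_orthonormal_frame:
  fixes e v :: "real^2"
  assumes "norm e = 1" "norm v = 1" "e \<bullet> v = 0"
  shows "dist (fst p *\<^sub>R e + snd p *\<^sub>R v) (fst q *\<^sub>R e + snd q *\<^sub>R v) \<le> 1 \<longleftrightarrow> sqdist p q \<le> 1"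
proof -
  let ?x = "fst p - fst q" and ?y = "snd p - snd q"
  have d: "fst p *\<^sub>R e + snd p *\<^sub>R v - (fst q *\<^sub>R e + snd q *\<^sub>R v) = ?x *\<^sub>R e + ?y *\<^sub>R v"
    by (simp add: algebra_simps)
  have "(norm (?x *\<^sub>R e + ?y *\<^sub>R v))\<^sup>2 = sqdist p q"
    using assms unfolding power2_norm_eq_inner sqdist_def
    by (simp add: inner_add_left inner_add_right inner_commute[of v e] norm_eq_1 power2_eq_square)
  then show ?thesis unfolding dist_norm d
    by (metis abs_norm_cancel abs_square_le_1)
qed

lemma spindle_dual_frame:
  fixes e v :: "real^2"
  assumes ev: "norm e = 1" "norm v = 1" "e \<bullet> v = 0"
  shows "spindle_dual ((\<lambda>p. fst p *\<^sub>R e + snd p *\<^sub>R v) ` S) = (\<lambda>p. fst p *\<^sub>R e + snd p *\<^sub>R v) ` bdual S"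
    (is "spindle_dual (?f ` S) = _")
proof (intro set_eqI iffI)
  fix z assume z: "z \<in> spindle_dual (?f ` S)"
  have "z = ?f (z \<bullet> e, z \<bullet> v)" using orthonormal_frame_expand[OF ev] by simp
  moreover have "(z \<bullet> e, z \<bullet> v) \<in> bdual S"
  proof -
    have "dist (?f p) z \<le> 1" if "p \<in> S" for p using z that by (auto simp: spindle_dual_def)
    then show ?thesis
      using dist_orthonormal_frame[OF ev, of _ "(z \<bullet> e, z \<bullet> v)"] orthonormal_frame_expand[OF ev, of z]
      by (simp add: bdual_def)
  qed
  ultimately show "z \<in> ?f ` bdual S" by blast
next
  fix z assume "z \<in> ?f ` bdual S"
  then show "z \<in> spindle_dual (?f ` S)"
    using dist_orthonormal_frame[OF ev] by (auto simp: spindle_dual_def bdual_def)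
qed

theorem theorem3p4:
  fixes A :: "(real^2) set" and v :: "real^2" and \<alpha> :: "real^2 \<Rightarrow> real"
    and F :: "real \<Rightarrow> ennreal"
  assumes "A \<noteq> {}" and "bounded A" and "norm v = 1"
    and "\<And>t. F t = emeasure lborel (spindle_hull ((\<lambda>x. x + (t * \<alpha> x) *\<^sub>R v) ` A))"
  shows "\<forall>s t u. 0 \<le> u \<and> u \<le> 1 \<longrightarrow>
           F ((1 - u) * s + u * t) \<le> ennreal (1 - u) * F s + ennreal u * F t"
proof (intro allI impI)
  fix s t u :: real assume u: "0 \<le> u \<and> u \<le> 1"
  \<comment> \<open>A quarter turn of \<open>v\<close>, which makes \<open>v\<close> the second
    coordinate direction.\<close>
  define e :: "real^2" where "e = vector [v$2, - v$1]"
  have ev: "norm e = 1" "norm v = 1" "e \<bullet> v = 0"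
    using assms(3) unfolding e_def by (auto simp: norm_eq_1 inner_vec_def sum_2)
  let ?f = "\<lambda>p. fst p *\<^sub>R e + snd p *\<^sub>R v"
  define S where "S r = (\<lambda>x. (x \<bullet> e, x \<bullet> v + r * \<alpha> x)) ` A" for r
  have S_ne: "S r \<noteq> {}" for r using assms(1) by (simp add: S_def)
  have img: "(\<lambda>x. x + (r * \<alpha> x) *\<^sub>R v) ` A = ?f ` S r" for r
    unfolding S_def image_image
  proof (rule image_cong[OF refl])
    fix x
    show "x + (r * \<alpha> x) *\<^sub>R v = ?f (x \<bullet> e, x \<bullet> v + r * \<alpha> x)"
      using orthonormal_frame_expand[OF ev, of x] by (simp add: algebra_simps)
  qed
  have hull: "spindle_hull (?f ` S r) = ?f ` bdual (bdual (S r))" for r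
    unfolding spindle_hull_def spindle_dual_frame[OF ev] ..
  \<comment> \<open>No unit disk contains the points, so the double dual is the whole plane.\<close>
  have F_inf: "F r = \<infinity>" if "bdual (S r) = {}" for r
  proof -
    have "?f ` bdual (bdual (S r)) = UNIV"
    proof (intro set_eqI iffI UNIV_I)
      fix z show "z \<in> ?f ` bdual (bdual (S r))"
        using orthonormal_frame_expand[OF ev, of z] that
        by (intro image_eqI[of _ _ "(z \<bullet> e, z \<bullet> v)"]) (auto simp: bdual_def)
    qed
    then show ?thesis unfolding assms(4) img hull by simp
  qed
  have F_fin: "F r = emeasure lborel (bdual (bdual (S r)))" if "bdual (S r) \<noteq> {}" for r
  proof -
    have "compact (bdual (bdual (S r)))" using that by (rule compact_bdual)
    then show ?thesis unfolding assms(4) img hull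
      using emeasure_orthonormal_image[OF ev, of "bdual (bdual (S r))" 0]
      by (simp add: compact_imp_bounded compact_imp_closed borel_closed)
  qed
  show "F ((1 - u) * s + u * t) \<le> ennreal (1 - u) * F s + ennreal u * F t"
  proof (cases "u = 0 \<or> u = 1")
    case True
    then show ?thesis by auto
  next
    case False
    then have u01: "0 < u" "u < 1" using u by auto
    show ?thesis
    \<comment> \<open>Both weights are positive here, so one infinite area makes the right side
      infinite; in \<open>ennreal\<close> a zero weight would have annihilated it.\<close>
    proof (cases "bdual (S s) = {} \<or> bdual (S t) = {}")
      case True
      then have "ennreal (1 - u) * F s + ennreal u * F t = \<infinity>"
        using F_inf u01 by (auto simp: ennreal_mult_top)
      then show ?thesis by (simp only: infinity_ennreal_def top_greatest)
    next
      case ne: False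
      let ?m = "(1 - u) * s + u * t"
      let ?E = "fibre_average u (bdual (bdual (S s))) (bdual (bdual (S t)))"
      \<comment> \<open>Each point moves in its own vertical fibre at constant speed, so its
        position at time \<open>?m\<close> is the average of those at times \<open>s\<close> and
        \<open>t\<close>.\<close>
      have sub: "S ?m \<subseteq> ?E"
      proof
        fix p assume "p \<in> S ?m"
        then obtain x where x: "x \<in> A" "p = (x \<bullet> e, x \<bullet> v + ?m * \<alpha> x)" by (auto simp: S_def)
        have "(x \<bullet> e, x \<bullet> v + r * \<alpha> x) \<in> bdual (bdual (S r))" for r
          using subset_bdual_bdual[of "S r"] x(1) by (auto simp: S_def)
        moreover have "p = (x \<bullet> e, (1 - u) * (x \<bullet> v + s * \<alpha> x) + u * (x \<bullet> v + t * \<alpha> x))"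
          unfolding x(2) by (simp add: algebra_simps)
        ultimately show "p \<in> ?E" unfolding fibre_average_def by blast
      qed
      have "bdual ?E \<noteq> {}"
      proof -
        obtain a b where "a \<in> bdual (S s)" "b \<in> bdual (S t)" using ne by blast
        then have "(1 - u) *\<^sub>R a + u *\<^sub>R b \<in> bdual ?E"
          using u by (intro bdual_fibre_average) (auto simp: bdual_bdual_bdual)
        then show ?thesis by blast
      qed
      then have m: "bdual (S ?m) \<noteq> {}" using bdual_antimono[OF sub] by blast
      have "F ?m = emeasure lborel (bdual (bdual (S ?m)))" by (rule F_fin[OF m])
      also have "\<dots> \<le> emeasure lborel (bdual (bdual ?E))"
        using bdual_antimono[OF bdual_antimono[OF sub]]
        by (intro emeasure_mono) (auto simp: closed_bdual borel_closed)
      also have "\<dots> \<le> ennreal (1 - u) * emeasure lborel (bdual (bdual (S s))) + ennreal u * emeasure lborel (bdual (bdual (S t)))"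
      proof (rule emeasure_bdual_fibre_average_le)
        show "compact (bdual (S s))" "compact (bdual (S t))" using S_ne by (auto intro: compact_bdual)
        show "?E \<noteq> {}" using sub S_ne by blast
      qed (use ne u01 bdual_bdual_bdual in auto)
      also have "\<dots> = ennreal (1 - u) * F s + ennreal u * F t" using F_fin ne by simp
      finally show ?thesis .
    qed
  qed
qed

end
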